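(* Let $k$ be an algebraically closed field of characteristic $2$, let $X = \mathbb{V}_+(x_0^3+x_1^3+x_2^3+x_3^3+x_4^3) \subset \mathbb{P}^4_k$ be the Fermat cubic threefold, and let $F(X)$ be its Fano surface of lines. Then the Albanese morphism $\alpha: F(X) \to \mathrm{Alb}(F(X))$ is injective on $k$-points.
   Context: $F(X)$ is the Fano scheme parametrising lines on $X$, a smooth connected projective surface. The Albanese morphism is taken with respect to any chosen base point of $F(X)(k)$. *)

theory Defs
  imports "HOL-Library.Poly_Mapping" "HOL-Library.FuncSet" "HOL-Algebra.Group"
    "HOL-Computational_Algebra.Polynomial"
begin

text \<open>
  Classical algebraic geometry over an algebraically closed field: a projective variety is
  identified with its set of closed points. Coordinate vectors are functions on an index type;
  the projective space with coordinates in a finite index set \<open>I\<close> consists of vectors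
  that vanish outside \<open>I\<close>.
\<close>

section \<open>Polynomials in several variables\<close>

type_synonym ('i, 'k) mpol = "('i \<Rightarrow>\<^sub>0 nat) \<Rightarrow>\<^sub>0 'k"

definition mpol_value :: "('i \<Rightarrow> 'k) \<Rightarrow> ('i, 'k::comm_ring_1) mpol \<Rightarrow> 'k" where
  "mpol_value v p = (\<Sum>m\<in>Poly_Mapping.keys p.
     Poly_Mapping.lookup p m * (\<Prod>i\<in>Poly_Mapping.keys m. v i ^ Poly_Mapping.lookup m i))"

definition homogeneous :: "nat \<Rightarrow> ('i, 'k::comm_ring_1) mpol \<Rightarrow> bool" where
  "homogeneous d p \<longleftrightarrow>
     (\<forall>m\<in>Poly_Mapping.keys p. (\<Sum>i\<in>Poly_Mapping.keys m. Poly_Mapping.lookup m i) = d)"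


section \<open>Projective varieties and morphisms\<close>

text \<open>A point of projective space is the set of all its homogeneous coordinate vectors.\<close>

type_synonym ('i, 'k) ppoint = "('i \<Rightarrow> 'k) set"

definition proj_point :: "('i \<Rightarrow> 'k::field) \<Rightarrow> ('i, 'k) ppoint" where
  "proj_point v = {(\<lambda>i. c * v i) | c. c \<noteq> 0}"

definition proj_space :: "'i set \<Rightarrow> ('i, 'k::field) ppoint set" where
  "proj_space I = {proj_point v | v. (\<exists>i. v i \<noteq> 0) \<and> (\<forall>i. i \<notin> I \<longrightarrow> v i = 0)}"

definition zero_locus :: "'i set \<Rightarrow> ('i, 'k::field) mpol set \<Rightarrow> ('i, 'k) ppoint set" where
  "zero_locus I S = {P \<in> proj_space I. \<forall>f\<in>S. \<forall>v\<in>P. mpol_value v f = 0}"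

definition zariski_closed :: "'i set \<Rightarrow> ('i, 'k::field) ppoint set \<Rightarrow> bool" where
  "zariski_closed I Z \<longleftrightarrow> (\<exists>S. (\<forall>f\<in>S. \<exists>d. homogeneous d f) \<and> Z = zero_locus I S)"

definition zariski_irreducible :: "'i set \<Rightarrow> ('i, 'k::field) ppoint set \<Rightarrow> bool" where
  "zariski_irreducible I X \<longleftrightarrow> X \<noteq> {} \<and>
     (\<forall>Z1 Z2. zariski_closed I Z1 \<longrightarrow> zariski_closed I Z2 \<longrightarrow> X \<subseteq> Z1 \<union> Z2 \<longrightarrow>
        X \<subseteq> Z1 \<or> X \<subseteq> Z2)"

definition projective_variety :: "'i set \<Rightarrow> ('i, 'k::field) ppoint set \<Rightarrow> bool" where
  "projective_variety I X \<longleftrightarrow> finite I \<and> zariski_closed I X \<and> zariski_irreducible I X"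

text \<open>
  A map between projective sets is a morphism iff on some open neighbourhood \<open>X - Z\<close> of each
  point it is given by forms of a common degree. These forms have no common zero on
  \<open>X - Z\<close>, because \<open>Y\<close> consists of points of a projective space and so does not contain
  \<open>proj_point (\<lambda>_. 0)\<close>.
\<close>

definition variety_morphism ::
  "'i set \<Rightarrow> ('i, 'k::field) ppoint set \<Rightarrow> ('j, 'k) ppoint set \<Rightarrow>
     (('i, 'k) ppoint \<Rightarrow> ('j, 'k) ppoint) \<Rightarrow> bool" where
  "variety_morphism I X Y f \<longleftrightarrow> f ` X \<subseteq> Y \<and>
     (\<forall>P\<in>X. \<exists>Z d F. zariski_closed I Z \<and> P \<notin> Z \<and> (\<forall>j. homogeneous d (F j)) \<and>
        (\<forall>Q\<in>X - Z. \<forall>v\<in>Q. f Q = proj_point (\<lambda>j. mpol_value v (F j))))"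

text \<open>Products are realised by the Segre embedding.\<close>

definition segre :: "('i, 'k::field) ppoint \<Rightarrow> ('j, 'k) ppoint \<Rightarrow> ('i \<times> 'j, 'k) ppoint" where
  "segre P Q = {(\<lambda>(i, j). v i * w j) | v w. v \<in> P \<and> w \<in> Q}"

definition segre_product ::
  "('i, 'k::field) ppoint set \<Rightarrow> ('j, 'k) ppoint set \<Rightarrow> ('i \<times> 'j, 'k) ppoint set" where
  "segre_product X Y = {segre P Q | P Q. P \<in> X \<and> Q \<in> Y}"


section \<open>Abelian varieties and the Albanese morphism\<close>

text \<open>
  An abelian variety is a projective variety that is also an algebraic group. Commutativity is
  automatic, and so is smoothness, as the field will be algebraically closed. The variety is
  embedded in the projective space with coordinates \<open>0, \<dots>, n\<close>.
\<close>

definition abelian_variety :: "nat \<Rightarrow> (nat, 'k::field) ppoint monoid \<Rightarrow> bool" where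
  "abelian_variety n A \<longleftrightarrow>
     projective_variety {..n} (carrier A) \<and> group A \<and>
     (\<exists>\<mu>. variety_morphism ({..n} \<times> {..n}) (segre_product (carrier A) (carrier A)) (carrier A) \<mu> \<and>
        (\<forall>P\<in>carrier A. \<forall>Q\<in>carrier A. \<mu> (segre P Q) = P \<otimes>\<^bsub>A\<^esub> Q)) \<and>
     variety_morphism {..n} (carrier A) (carrier A) (\<lambda>P. inv\<^bsub>A\<^esub> P)"

text \<open>
  \<open>(A, \<alpha>)\<close> is an Albanese variety of \<open>(X, p)\<close> if \<open>\<alpha>\<close> is initial among the
  morphisms from \<open>X\<close> to abelian varieties that send \<open>p\<close> to the neutral element. The
  condition \<open>extensional\<close> only makes the factorisation unique as a HOL function.
\<close>

definition albanese ::
  "'i set \<Rightarrow> ('i, 'k::field) ppoint set \<Rightarrow> ('i, 'k) ppoint \<Rightarrow>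
     nat \<Rightarrow> (nat, 'k) ppoint monoid \<Rightarrow> (('i, 'k) ppoint \<Rightarrow> (nat, 'k) ppoint) \<Rightarrow> bool" where
  "albanese I X p n A \<alpha> \<longleftrightarrow>
     abelian_variety n A \<and> variety_morphism I X (carrier A) \<alpha> \<and> \<alpha> p = \<one>\<^bsub>A\<^esub> \<and>
     (\<forall>m B f. abelian_variety m B \<and> variety_morphism I X (carrier B) f \<and> f p = \<one>\<^bsub>B\<^esub> \<longrightarrow>
        (\<exists>!\<phi>. \<phi> \<in> extensional (carrier A) \<and> \<phi> \<in> hom A B \<and>
           variety_morphism {..n} (carrier A) (carrier B) \<phi> \<and> (\<forall>P\<in>X. \<phi> (\<alpha> P) = f P)))"


section \<open>Lines and Fano varieties\<close>

definition line_through :: "('i, 'k::field) ppoint \<Rightarrow> ('i, 'k) ppoint \<Rightarrow> ('i, 'k) ppoint set" where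
  "line_through P Q = {proj_point (\<lambda>i. s * v i + t * w i) | v w s t.
     v \<in> P \<and> w \<in> Q \<and> (s \<noteq> 0 \<or> t \<noteq> 0)}"

definition proj_lines :: "'i set \<Rightarrow> ('i, 'k::field) ppoint set set" where
  "proj_lines I = {line_through P Q | P Q. P \<in> proj_space I \<and> Q \<in> proj_space I \<and> P \<noteq> Q}"

text \<open>
  The Pluecker point of a line: letting the coordinate vectors range over all pairs of distinct
  points of the line yields exactly one point of projective space, since a change of basis scales
  the minors by a nonzero determinant.
\<close>

definition pluecker :: "(nat, 'k::field) ppoint set \<Rightarrow> (nat \<times> nat, 'k) ppoint" where
  "pluecker L = {(\<lambda>(i, j). if i < j then v i * w j - v j * w i else 0) | v w P Q.
     P \<in> L \<and> Q \<in> L \<and> P \<noteq> Q \<and> v \<in> P \<and> w \<in> Q}"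

definition pluecker_index :: "nat \<Rightarrow> (nat \<times> nat) set" where
  "pluecker_index n = {(i, j). i < j \<and> j \<le> n}"

text \<open>
  The lines contained in \<open>X\<close>, as a closed subset of the Grassmannian in its Pluecker
  embedding. This is the variety underlying the Fano scheme and determines that scheme whenever
  it is reduced, for instance when \<open>X\<close> is a smooth cubic threefold.
\<close>

definition fano :: "nat \<Rightarrow> (nat, 'k::field) ppoint set \<Rightarrow> (nat \<times> nat, 'k) ppoint set" where
  "fano n X = pluecker ` {L \<in> proj_lines {..n}. L \<subseteq> X}"

definition fermat_cubic_threefold :: "(nat, 'k::field) ppoint set" where
  "fermat_cubic_threefold = zero_locus {..4}
     {\<Sum>i\<le>4. Poly_Mapping.single (Poly_Mapping.single i 3) 1}"

end

theory Submission
  imports Defs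
begin

text \<open>
  By the universal property it suffices to separate any two lines \<open>L \<noteq> L'\<close> on \<open>X\<close> by a morphism
  from \<open>F(X)\<close> to one elliptic curve \<open>E\<close>. The tangent hyperplane section of \<open>X\<close> at an Eckardt point
  \<open>v = \<gamma> e\<^sub>i + e\<^sub>j\<close> (\<open>\<gamma>\<^sup>3 = 1\<close>) is the cone over \<open>E\<close> with vertex \<open>v\<close>; intersecting a line with that
  hyperplane and projecting from \<open>v\<close> gives a map to \<open>E\<close>, linear in Pluecker coordinates and
  undefined on the lines through \<open>v\<close>. The maps for the three values of \<open>\<gamma>\<close> take collinear values, so each
  of them extends as the third intersection point of \<open>E\<close> with the chord through the other two.

  If \<open>v\<close> is outside the span of \<open>L \<union> L'\<close>, then \<open>L\<close> and \<open>L'\<close> have the same image only if they share a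
  point on the tangent hyperplane at \<open>v\<close>; some \<open>v\<close> is outside the span and excludes this.

  The group law of \<open>E\<close> is built from the chord construction. Associativity is checked for points in
  general position and extended by density, since a form with infinitely many zeros on \<open>E\<close>
  vanishes on \<open>E\<close>.
\<close>

section \<open>Forms and morphisms\<close>

text \<open>What makes the characteristic special: \<open>x\<^sup>3 = x\<^sup>2 * x\<close> and
  squaring is additive, so the Fermat cubic is the Hermitian form \<open>herm x x\<close> over the
  field with 4 elements, and a line lies on X exactly when \<open>herm\<close> vanishes on all pairs
  of its vectors. Cubic conditions become bilinear ones up to a Frobenius twist, and statements
  about smoothness reduce to \<open>isotropic_parallel\<close>. On E, doubling is the negative of
  the Frobenius map of that field, so the flexes of E are its rational points over it. Two
  degenerate situations shape the formulas. The secant formula for the chord vanishes on the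
  diagonal, so pairs of points of E need a second chart. And the three maps attached to the values
  of \<gamma> may coincide at a line, where collinearity of the values says nothing; the common
  value must then be shown to be a flex, so that its tangent leads back to it.\<close>

definition form :: "nat \<Rightarrow> (('i \<Rightarrow> 'k::comm_ring_1) \<Rightarrow> 'k) \<Rightarrow> bool" where
  "form d g \<longleftrightarrow> (\<exists>F. homogeneous d F \<and> (\<forall>v. mpol_value v F = g v))"

definition monomial_value :: "('i \<Rightarrow> 'k::comm_ring_1) \<Rightarrow> ('i \<Rightarrow>\<^sub>0 nat) \<Rightarrow> 'k" where
  "monomial_value v m = (\<Prod>i\<in>Poly_Mapping.keys m. v i ^ Poly_Mapping.lookup m i)"

definition monomial_degree :: "('i \<Rightarrow>\<^sub>0 nat) \<Rightarrow> nat" where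
  "monomial_degree m = (\<Sum>i\<in>Poly_Mapping.keys m. Poly_Mapping.lookup m i)"

lemma monomial_value_superset:
  assumes "finite S" "Poly_Mapping.keys m \<subseteq> S"
  shows "monomial_value v m = (\<Prod>i\<in>S. v i ^ Poly_Mapping.lookup m i)"
  unfolding monomial_value_def
  by (rule prod.mono_neutral_left) (use assms in \<open>auto simp: in_keys_iff\<close>)

lemma monomial_degree_superset:
  assumes "finite S" "Poly_Mapping.keys m \<subseteq> S"
  shows "monomial_degree m = (\<Sum>i\<in>S. Poly_Mapping.lookup m i)"
  unfolding monomial_degree_def
  by (rule sum.mono_neutral_left) (use assms in \<open>auto simp: in_keys_iff\<close>)

lemma monomial_value_add: "monomial_value v (m + n) = monomial_value v m * monomial_value v n"
proof -
  let ?S = "Poly_Mapping.keys m \<union> Poly_Mapping.keys n"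
  have "monomial_value v (m + n) = (\<Prod>i\<in>?S. v i ^ Poly_Mapping.lookup (m + n) i)"
    by (rule monomial_value_superset) (use Poly_Mapping.keys_add[of m n] in auto)
  also have "\<dots> = (\<Prod>i\<in>?S. v i ^ Poly_Mapping.lookup m i) * (\<Prod>i\<in>?S. v i ^ Poly_Mapping.lookup n i)"
    by (simp add: lookup_add power_add prod.distrib)
  also have "\<dots> = monomial_value v m * monomial_value v n"
    by (simp add: monomial_value_superset[of ?S])
  finally show ?thesis .
qed

lemma monomial_degree_add: "monomial_degree (m + n) = monomial_degree m + monomial_degree n"
proof -
  let ?S = "Poly_Mapping.keys m \<union> Poly_Mapping.keys n"
  have "monomial_degree (m + n) = (\<Sum>i\<in>?S. Poly_Mapping.lookup (m + n) i)"
    by (rule monomial_degree_superset) (use Poly_Mapping.keys_add[of m n] in auto)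
  also have "\<dots> = (\<Sum>i\<in>?S. Poly_Mapping.lookup m i) + (\<Sum>i\<in>?S. Poly_Mapping.lookup n i)"
    by (simp add: lookup_add sum.distrib)
  also have "\<dots> = monomial_degree m + monomial_degree n"
    by (simp add: monomial_degree_superset[of ?S])
  finally show ?thesis .
qed

lemma mpol_value_altdef:
  "mpol_value v F = (\<Sum>m\<in>Poly_Mapping.keys F. Poly_Mapping.lookup F m * monomial_value v m)"
  by (simp add: mpol_value_def monomial_value_def)

lemma homogeneous_altdef: "homogeneous d F \<longleftrightarrow> (\<forall>m\<in>Poly_Mapping.keys F. monomial_degree m = d)"
  by (simp add: homogeneous_def monomial_degree_def)

lemma mpol_value_superset:
  assumes "finite S" "Poly_Mapping.keys F \<subseteq> S"
  shows "mpol_value v F = (\<Sum>m\<in>S. Poly_Mapping.lookup F m * monomial_value v m)"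
  unfolding mpol_value_altdef
  by (rule sum.mono_neutral_left) (use assms in \<open>auto simp: in_keys_iff\<close>)

lemma mpol_value_add: "mpol_value v (F + G) = mpol_value v F + mpol_value v G"
proof -
  let ?S = "Poly_Mapping.keys F \<union> Poly_Mapping.keys G"
  have "mpol_value v (F + G) = (\<Sum>m\<in>?S. Poly_Mapping.lookup (F + G) m * monomial_value v m)"
    by (rule mpol_value_superset) (use Poly_Mapping.keys_add[of F G] in auto)
  also have "\<dots> = (\<Sum>m\<in>?S. Poly_Mapping.lookup F m * monomial_value v m) + (\<Sum>m\<in>?S. Poly_Mapping.lookup G m * monomial_value v m)"
    by (simp add: lookup_add sum.distrib distrib_right)
  also have "\<dots> = mpol_value v F + mpol_value v G"
    by (simp add: mpol_value_superset[of ?S])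
  finally show ?thesis .
qed

lemma mpol_value_sum: "mpol_value v (\<Sum>i\<in>S. F i) = (\<Sum>i\<in>S. mpol_value v (F i))"
  by (induction S rule: infinite_finite_induct) (simp_all add: mpol_value_add, simp_all add: mpol_value_def)

lemma mpol_value_single: "mpol_value v (Poly_Mapping.single m c) = c * monomial_value v m"
  by (simp add: mpol_value_altdef)

lemma monomial_value_single: "monomial_value v (Poly_Mapping.single i n) = v i ^ n"
  by (simp add: monomial_value_def)

lemma form_monomial: "monomial_degree m = d \<Longrightarrow> form d (\<lambda>v. c * monomial_value v m)"
  unfolding form_def
  by (rule exI[of _ "Poly_Mapping.single m c"]) (simp add: homogeneous_altdef mpol_value_single)

lemma form_zero: "form d (\<lambda>v. 0)"
  unfolding form_def by (rule exI[of _ 0]) (simp add: homogeneous_def mpol_value_def)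

text \<open>Closure properties such as this one certify a coordinate formula as a form by following
  its syntax; charts of morphisms can then be written as plain functions instead of
  polynomials.\<close>

lemma form_add:
  assumes "form d f" "form d g"
  shows "form d (\<lambda>v. f v + g v)"
proof -
  from assms obtain F G where *: "homogeneous d F" "\<forall>v. mpol_value v F = f v"
    "homogeneous d G" "\<forall>v. mpol_value v G = g v"
    unfolding form_def by blast
  have "homogeneous d (F + G)"
    using * Poly_Mapping.keys_add[of F G] unfolding homogeneous_def by auto
  then show ?thesis unfolding form_def using *
    by (intro exI[of _ "F + G"]) (simp add: mpol_value_add)
qed

lemma form_sum: "(\<And>i. i \<in> S \<Longrightarrow> form d (f i)) \<Longrightarrow> form d (\<lambda>v. \<Sum>i\<in>S. f i v)"
  by (induction S rule: infinite_finite_induct) (auto intro: form_add form_zero)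

lemma form_expand:
  assumes "form d g"
  obtains c and M :: "('i \<Rightarrow>\<^sub>0 nat) set" where "finite M" "\<And>m. m \<in> M \<Longrightarrow> monomial_degree m = d"
    "g = (\<lambda>v. \<Sum>m\<in>M. c m * monomial_value v m)"
proof -
  from assms obtain F where F: "homogeneous d F" "\<forall>v. mpol_value v F = g v"
    unfolding form_def by blast
  show ?thesis
    by (rule that[of "Poly_Mapping.keys F" "Poly_Mapping.lookup F"])
      (use F in \<open>auto simp: homogeneous_altdef mpol_value_altdef\<close>)
qed

lemma form_mult:
  assumes "form d f" "form e g" shows "form (d + e) (\<lambda>v. f v * g v)"
proof -
  obtain c M where M: "finite M" "\<And>m. m \<in> M \<Longrightarrow> monomial_degree m = d"
    and f: "f = (\<lambda>v. \<Sum>m\<in>M. c m * monomial_value v m)" using assms(1) by (rule form_expand) blast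
  obtain b N where N: "finite N" "\<And>m. m \<in> N \<Longrightarrow> monomial_degree m = e"
    and g: "g = (\<lambda>v. \<Sum>m\<in>N. b m * monomial_value v m)" using assms(2) by (rule form_expand) blast
  have "(\<lambda>v. f v * g v) = (\<lambda>v. \<Sum>m\<in>M. \<Sum>n\<in>N. (c m * b n) * monomial_value v (m + n))"
    unfolding f g by (simp add: sum_product monomial_value_add mult.assoc mult.left_commute)
  then show ?thesis
    by (simp only:) (intro form_sum form_monomial; simp add: M N monomial_degree_add)
qed

lemma form_var: "form 1 (\<lambda>v. v i)"
  using form_monomial[of "Poly_Mapping.single i 1" 1 1]
  by (simp add: monomial_value_single monomial_degree_def)

lemma form_const: "form 0 (\<lambda>v. c)"
  using form_monomial[of 0 0 c] by (simp add: monomial_value_def monomial_degree_def)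

lemma form_cmult: "form d f \<Longrightarrow> form d (\<lambda>v. c * f v)"
  using form_mult[OF form_const, of d f] by simp

lemma form_power: "form d f \<Longrightarrow> form (n * d) (\<lambda>v. f v ^ n)"
proof (induction n)
  case (Suc n)
  then show ?case using form_mult[OF Suc.prems Suc.IH] by simp
qed (simp add: form_const)

lemma form_prod: "(\<And>i. i \<in> S \<Longrightarrow> form (d i) (f i)) \<Longrightarrow> form (\<Sum>i\<in>S. d i) (\<lambda>v. \<Prod>i\<in>S. f i v)"
  by (induction S rule: infinite_finite_induct) (auto intro: form_mult form_const)

lemma form_compose:
  assumes "form d g" "\<And>i. form e (h i)"
  shows "form (d * e) (\<lambda>v. g (\<lambda>i. h i v))"
proof -
  obtain c M where M: "finite M" "\<And>m. m \<in> M \<Longrightarrow> monomial_degree m = d"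
    and g: "g = (\<lambda>v. \<Sum>m\<in>M. c m * monomial_value v m)" using assms(1) by (rule form_expand) blast
  show ?thesis unfolding g
  proof (intro form_sum form_cmult)
    fix m assume "m \<in> M"
    then have d: "d = (\<Sum>i\<in>Poly_Mapping.keys m. Poly_Mapping.lookup m i)"
      using M(2) by (auto simp: monomial_degree_def)
    show "form (d * e) (\<lambda>v. monomial_value (\<lambda>i. h i v) m)"
      unfolding monomial_value_def d sum_distrib_right
      by (intro form_prod form_power assms)
  qed
qed

lemma form_scale: "form d g \<Longrightarrow> g (\<lambda>i. c * v i) = c ^ d * g v"
proof (elim form_expand)
  fix b M assume M: "finite M" "\<And>m. m \<in> M \<Longrightarrow> monomial_degree m = d"
    and g: "g = (\<lambda>v. \<Sum>m\<in>M. b m * monomial_value v m)"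
  have "monomial_value (\<lambda>i. c * v i) m = c ^ d * monomial_value v m" if "m \<in> M" for m
    using M(2)[OF that]
    by (auto simp: monomial_value_def monomial_degree_def power_mult_distrib prod.distrib power_sum)
  then show ?thesis unfolding g sum_distrib_left by (auto intro!: sum.cong simp: mult_ac)
qed

lemma form_diff: "form d f \<Longrightarrow> form d g \<Longrightarrow> form d (\<lambda>v. f v - g v)"
  using form_add[OF _ form_cmult[of d g "-1"], of f] by simp

lemma form_degree_cong: "form d f \<Longrightarrow> d = e \<Longrightarrow> form e f"
  by simp

section \<open>Points of projective space, closed sets and local charts\<close>

lemma mem_proj_point: "w \<in> proj_point v \<longleftrightarrow> (\<exists>c. c \<noteq> 0 \<and> w = (\<lambda>i. c * v i))"
  by (auto simp: proj_point_def)

lemma self_in_proj_point [simp]: "v \<in> proj_point v"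
  unfolding mem_proj_point by (rule exI[of _ 1]) simp

lemma proj_point_scale [simp]: "c \<noteq> 0 \<Longrightarrow> proj_point (\<lambda>i. c * v i) = proj_point v"
proof (intro equalityI subsetI)
  fix w assume c: "c \<noteq> 0"
  show "w \<in> proj_point v" if "w \<in> proj_point (\<lambda>i. c * v i)"
  proof -
    from that obtain b where "b \<noteq> 0" "w = (\<lambda>i. b * (c * v i))"
      unfolding mem_proj_point by blast
    then show ?thesis unfolding mem_proj_point using c
      by (intro exI[of _ "b * c"]) (auto simp: mult.assoc)
  qed
  show "w \<in> proj_point (\<lambda>i. c * v i)" if "w \<in> proj_point v"
  proof -
    from that obtain b where "b \<noteq> 0" "w = (\<lambda>i. b * v i)" unfolding mem_proj_point by blast
    then show ?thesis unfolding mem_proj_point using c by (intro exI[of _ "b / c"]) auto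
  qed
qed

lemma proj_point_eq_iff: "proj_point v = proj_point w \<longleftrightarrow> (\<exists>c. c \<noteq> 0 \<and> w = (\<lambda>i. c * v i))"
proof
  assume "proj_point v = proj_point w"
  then have "w \<in> proj_point v" by simp
  then show "\<exists>c. c \<noteq> 0 \<and> w = (\<lambda>i. c * v i)" by (simp add: mem_proj_point)
qed auto

lemma proj_spaceE:
  assumes "P \<in> proj_space I" "v \<in> P"
  shows "P = proj_point v" "\<exists>i. v i \<noteq> 0" "\<And>i. i \<notin> I \<Longrightarrow> v i = 0"
proof -
  obtain u where u: "P = proj_point u" "\<exists>i. u i \<noteq> 0" "\<And>i. i \<notin> I \<Longrightarrow> u i = 0"
    using assms(1) unfolding proj_space_def by auto
  obtain c where "c \<noteq> 0" "v = (\<lambda>i. c * u i)" using assms(2) u by (auto simp: mem_proj_point)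
  then show "P = proj_point v" "\<exists>i. v i \<noteq> 0" "\<And>i. i \<notin> I \<Longrightarrow> v i = 0" using u by auto
qed

lemma proj_spaceI: "v i \<noteq> 0 \<Longrightarrow> (\<And>i. i \<notin> I \<Longrightarrow> v i = 0) \<Longrightarrow> proj_point v \<in> proj_space I"
  unfolding proj_space_def by auto

lemma proj_space_nonempty: "P \<in> proj_space I \<Longrightarrow> \<exists>v. v \<in> P"
  unfolding proj_space_def by (auto intro: self_in_proj_point)

lemma form_nonzero_proj:
  assumes "form d g" "P \<in> proj_space I" "v \<in> P" "w \<in> P" "g v \<noteq> 0"
  shows "g w \<noteq> 0"
proof -
  have "w \<in> proj_point v" using proj_spaceE(1)[OF assms(2,3)] assms(4) by simp
  then obtain c where "c \<noteq> 0" "w = (\<lambda>i. c * v i)" by (auto simp: mem_proj_point)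
  then show ?thesis using form_scale[OF assms(1)] assms(5) by simp
qed

lemma zariski_closed_form:
  assumes "form d g"
  shows "zariski_closed I {P \<in> proj_space I. \<forall>v\<in>P. g v = 0}"
proof -
  from assms obtain F where "homogeneous d F" "\<forall>v. mpol_value v F = g v"
    unfolding form_def by blast
  then show ?thesis unfolding zariski_closed_def zero_locus_def
    by (intro exI[of _ "{F}"]) auto
qed

lemma zariski_closed_separate:
  assumes "zariski_closed I Z" "P \<in> proj_space I" "P \<notin> Z"
  shows "\<exists>d g v. form d g \<and> v \<in> P \<and> g v \<noteq> 0 \<and> (\<forall>Q\<in>Z. \<forall>w\<in>Q. g w = 0)"
proof -
  obtain S where S: "\<forall>f\<in>S. \<exists>d. homogeneous d f" "Z = zero_locus I S"
    using assms(1) unfolding zariski_closed_def by auto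
  then obtain F v where F: "F \<in> S" "v \<in> P" "mpol_value v F \<noteq> 0"
    using assms unfolding zero_locus_def by auto
  then obtain d where "homogeneous d F" using S by auto
  then have "form d (\<lambda>v. mpol_value v F)" unfolding form_def by auto
  moreover have "\<forall>Q\<in>Z. \<forall>w\<in>Q. mpol_value w F = 0"
    using F S unfolding zero_locus_def by blast
  ultimately show ?thesis using F by (intro exI conjI)
qed

text \<open>The sets \<open>s \<noteq> 0\<close> form a basis of the Zariski topology, so one form
  \<open>s\<close> and one family of forms \<open>G\<close> around each point describe a morphism;
  \<open>variety_morphismD\<close> is the converse.\<close>

lemma variety_morphismI:
  assumes "X \<subseteq> proj_space I" "f ` X \<subseteq> Y"
    and "\<And>P. P \<in> X \<Longrightarrow> \<exists>e s d G v. form e s \<and> (\<forall>j. form d (G j)) \<and> v \<in> P \<and> s v \<noteq> 0 \<and>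
           (\<forall>Q\<in>X. \<forall>v\<in>Q. s v \<noteq> 0 \<longrightarrow> f Q = proj_point (\<lambda>j. G j v))"
  shows "variety_morphism I X Y f"
  unfolding variety_morphism_def
proof (intro conjI ballI)
  fix P assume P: "P \<in> X"
  from assms(3)[OF P] obtain e s d G v where sG: "form e s" "\<forall>j. form d (G j)" "v \<in> P" "s v \<noteq> 0"
      "\<forall>Q\<in>X. \<forall>v\<in>Q. s v \<noteq> 0 \<longrightarrow> f Q = proj_point (\<lambda>j. G j v)"
    by (elim exE conjE)
  obtain F where F: "\<And>j. homogeneous d (F j)" "\<And>j v. mpol_value v (F j) = G j v"
    using sG(2) unfolding form_def by metis
  let ?Z = "{P \<in> proj_space I. \<forall>v\<in>P. s v = 0}"
  show "\<exists>Z d F. zariski_closed I Z \<and> P \<notin> Z \<and> (\<forall>j. homogeneous d (F j)) \<and>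
        (\<forall>Q\<in>X - Z. \<forall>v\<in>Q. f Q = proj_point (\<lambda>j. mpol_value v (F j)))"
  proof (rule exI[of _ ?Z], rule exI[of _ d], rule exI[of _ F], intro conjI ballI allI)
    show "zariski_closed I ?Z" using sG(1) by (rule zariski_closed_form)
    show "P \<notin> ?Z" using sG by auto
    fix Q v assume "Q \<in> X - ?Z" "v \<in> Q"
    then have "s v \<noteq> 0" using form_nonzero_proj[OF sG(1)] assms(1) by blast
    then show "f Q = proj_point (\<lambda>j. mpol_value v (F j))"
      using sG(5) F(2) \<open>Q \<in> X - ?Z\<close> \<open>v \<in> Q\<close> by simp
  qed (use F in auto)
qed (use assms in auto)

lemma variety_morphismD:
  assumes "variety_morphism I X Y f" "X \<subseteq> proj_space I" "P \<in> X" "v \<in> P"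
  shows "\<exists>e s d G. form e s \<and> (\<forall>j. form d (G j)) \<and> s v \<noteq> 0 \<and>
    (\<forall>Q\<in>X. \<forall>w\<in>Q. s w \<noteq> 0 \<longrightarrow> f Q = proj_point (\<lambda>j. G j w))"
proof -
  have "\<exists>Z d F. zariski_closed I Z \<and> P \<notin> Z \<and> (\<forall>j. homogeneous d (F j)) \<and>
        (\<forall>Q\<in>X - Z. \<forall>v\<in>Q. f Q = proj_point (\<lambda>j. mpol_value v (F j)))"
    using assms(1,3) unfolding variety_morphism_def by (elim conjE) (rule bspec)
  then obtain Z d F where Z: "zariski_closed I Z" "P \<notin> Z" "\<forall>j. homogeneous d (F j)"
    "\<forall>Q\<in>X - Z. \<forall>v\<in>Q. f Q = proj_point (\<lambda>j. mpol_value v (F j))"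
    by (elim exE conjE)
  obtain e g w where g: "form e g" "w \<in> P" "g w \<noteq> 0" "\<forall>Q\<in>Z. \<forall>w\<in>Q. g w = 0"
    using zariski_closed_separate[OF Z(1) subsetD[OF assms(2,3)] Z(2)] by (elim exE conjE)
  show ?thesis
  proof (intro exI conjI allI ballI impI)
    show "form e g" by fact
    show "g v \<noteq> 0"
      by (rule form_nonzero_proj[OF g(1) subsetD[OF assms(2,3)] g(2) assms(4) g(3)])
    show "form d (\<lambda>v. mpol_value v (F j))" for j using Z(3) unfolding form_def by auto
    fix Q w assume "Q \<in> X" "w \<in> Q" "g w \<noteq> 0"
    then have "Q \<in> X - Z" using g(4) by auto
    then show "f Q = proj_point (\<lambda>j. mpol_value w (F j))" using Z(4) \<open>w \<in> Q\<close> by auto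
  qed
qed

lemma variety_morphism_compose:
  assumes f: "variety_morphism I X Y f" and g: "variety_morphism J Y W g"
    and "X \<subseteq> proj_space I" "Y \<subseteq> proj_space J"
  shows "variety_morphism I X W (\<lambda>P. g (f P))"
proof (rule variety_morphismI[OF assms(3)])
  have fX: "f ` X \<subseteq> Y" and gY: "g ` Y \<subseteq> W" using f g unfolding variety_morphism_def by auto
  show "(\<lambda>P. g (f P)) ` X \<subseteq> W" using fX gY by auto
  fix P assume P: "P \<in> X"
  then obtain v where v: "v \<in> P" using assms(3) proj_space_nonempty by blast
  from variety_morphismD[OF f assms(3) P v] obtain e s d G where
    F: "form e s" "\<forall>j. form d (G j)" "s v \<noteq> 0"
      "\<forall>Q\<in>X. \<forall>w\<in>Q. s w \<noteq> 0 \<longrightarrow> f Q = proj_point (\<lambda>j. G j w)"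
    by (elim exE conjE)
  have fP: "(\<lambda>j. G j v) \<in> f P" using F(3,4) P v by simp
  from variety_morphismD[OF g assms(4) subsetD[OF fX imageI[OF P]] fP] obtain e' s' d' G' where
    G: "form e' s'" "\<forall>j. form d' (G' j)" "s' (\<lambda>j. G j v) \<noteq> 0"
      "\<forall>Q\<in>Y. \<forall>w\<in>Q. s' w \<noteq> 0 \<longrightarrow> g Q = proj_point (\<lambda>j. G' j w)"
    by (elim exE conjE)
  show "\<exists>e s d G v. form e s \<and> (\<forall>j. form d (G j)) \<and> v \<in> P \<and> s v \<noteq> 0 \<and>
           (\<forall>Q\<in>X. \<forall>v\<in>Q. s v \<noteq> 0 \<longrightarrow> g (f Q) = proj_point (\<lambda>j. G j v))"
  proof (intro exI conjI)
    \<comment> \<open>The chart of the composite is the chart of \<open>f\<close> intersected with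
      the preimage of the chart of \<open>g\<close>.\<close>
    show "form (e + e' * d) (\<lambda>v. s v * s' (\<lambda>j. G j v))"
      by (intro form_mult form_compose F(1) G(1) F(2)[rule_format])
    show "\<forall>j. form (d' * d) (\<lambda>v. G' j (\<lambda>j. G j v))"
      by (intro allI form_compose G(2)[rule_format] F(2)[rule_format])
    show "v \<in> P" by fact
    show "s v * s' (\<lambda>j. G j v) \<noteq> 0" using F G by simp
    show "\<forall>Q\<in>X. \<forall>v\<in>Q. s v * s' (\<lambda>j. G j v) \<noteq> 0 \<longrightarrow> g (f Q) = proj_point (\<lambda>j. G' j (\<lambda>j. G j v))"
    proof (intro ballI impI)
      fix Q w assume Q: "Q \<in> X" "w \<in> Q" and nz: "s w * s' (\<lambda>j. G j w) \<noteq> 0"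
      have "f Q = proj_point (\<lambda>j. G j w)" using F(4) Q nz by auto
      then have "(\<lambda>j. G j w) \<in> f Q" by simp
      then show "g (f Q) = proj_point (\<lambda>j. G' j (\<lambda>j. G j w))" using G(4) Q(1) fX nz by auto
    qed
  qed
qed

section \<open>The curve \<open>x\<^sup>3 = y z (y + z)\<close> and its chords\<close>

text \<open>Together with \<open>algebra_simps\<close>, which brings equal monomials next to each
  other, these rules let the simplifier verify polynomial identities modulo 2.\<close>

lemma char_two_simps:
  fixes a :: "'k::comm_ring_1"
  assumes "CHAR('k) = 2"
  shows "a + a = 0" "a + (a + b) = b" "- a = a" "a - b = a + b" "a + b = 0 \<longleftrightarrow> a = b" "(2::'k) = 0"
proof -
  have "of_nat CHAR('k) = (0::'k)" by (rule of_nat_CHAR)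
  then show two: "(2::'k) = 0" using assms by simp
  have aa: "a + a = 0" for a :: 'k
    by (metis two mult_2 mult_zero_left)
  then show "a + a = 0" .
  show "a + (a + b) = b" using aa[of a] by (metis add.assoc add_0)
  show neg: "- a = a" for a :: 'k using aa[of a] by (metis minus_unique)
  then show "a - b = a + b" by (metis diff_conv_add_uminus)
  then show "a + b = 0 \<longleftrightarrow> a = b" by (metis right_minus_eq)
qed

lemma parallel_imp_proj_point_eq:
  assumes "v \<noteq> (\<lambda>_. 0)" "w \<noteq> (\<lambda>_. 0)" "\<And>i j. v i * w j = v j * w i"
  shows "proj_point v = proj_point (w :: 'i \<Rightarrow> 'k::field)"
proof -
  obtain j where j: "w j \<noteq> 0" using assms(2) by auto
  then have v: "v = (\<lambda>i. v j / w j * w i)" using assms(3) by (auto simp: field_simps)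
  then have "v j \<noteq> 0" using assms(1) by (metis (no_types, lifting) div_0 mult_zero_left)
  then have "v j / w j \<noteq> 0" using j by simp
  then show ?thesis using proj_point_scale[of "v j / w j" w] v by simp
qed

definition vec3 :: "'a \<Rightarrow> 'a \<Rightarrow> 'a \<Rightarrow> nat \<Rightarrow> 'a::zero" where
  "vec3 x y z = (\<lambda>i. if i = 0 then x else if i = 1 then y else if i = 2 then z else 0)"

lemma vec3_simps [simp]: "vec3 x y z 0 = x" "vec3 x y z 1 = y" "vec3 x y z (Suc 0) = y" "vec3 x y z 2 = z"
  "i > 2 \<Longrightarrow> vec3 x y z i = 0"
  by (auto simp: vec3_def)

lemma nat_cases3: "i = 0 \<or> i = 1 \<or> i = 2 \<or> i > (2::nat)"
  by auto

lemma vec3_eq_iff: "v = vec3 x y z \<longleftrightarrow> v 0 = x \<and> v 1 = y \<and> v 2 = z \<and> (\<forall>i>2. v i = 0)"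
proof
  assume *: "v 0 = x \<and> v 1 = y \<and> v 2 = z \<and> (\<forall>i>2. v i = 0)"
  have "v i = vec3 x y z i" for i using nat_cases3[of i] * by (elim disjE) auto
  then show "v = vec3 x y z" ..
qed auto

lemma vec3_scale: "(\<lambda>i. c * vec3 x y z i) = vec3 (c * x) (c * y) (c * z :: 'k::field)"
  by (subst vec3_eq_iff) auto

lemma form_vec3:
  assumes "form d f" "form d g" "form d h"
  shows "form d (\<lambda>v. vec3 (f v) (g v) (h v) j)"
  using nat_cases3[of j] assms by (elim disjE) (auto simp: form_zero)

definition curve_vecs :: "(nat \<Rightarrow> 'k::field) set" where
  "curve_vecs = {v. v \<noteq> (\<lambda>_. 0) \<and> (\<forall>i>2. v i = 0) \<and> v 0 ^ 3 = v 1 * v 2 * (v 1 + v 2)}"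

definition curve :: "(nat, 'k::field) ppoint set" where
  "curve = proj_point ` curve_vecs"

definition hform :: "(nat \<Rightarrow> 'k::field) \<Rightarrow> (nat \<Rightarrow> 'k) \<Rightarrow> 'k" where
  "hform v w = (v 0)\<^sup>2 * w 0 + (v 2)\<^sup>2 * w 1 + (v 1)\<^sup>2 * w 2"

text \<open>\<open>hform v w\<close> is the derivative of the cubic form at \<open>v\<close> in direction \<open>w\<close>. On the line through
  points \<open>v\<close> and \<open>w\<close> of the curve the cubic form at \<open>s v + t w\<close> is \<open>s\<^sup>2 t (hform v w) + s t\<^sup>2 (hform w v)\<close>,
  so its third zero is \<open>chord v w\<close>.\<close>

definition chord :: "(nat \<Rightarrow> 'k::field) \<Rightarrow> (nat \<Rightarrow> 'k) \<Rightarrow> nat \<Rightarrow> 'k" where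
  "chord v w = (\<lambda>i. hform w v * v i + hform v w * w i)"

text \<open>\<open>rot\<close> and its inverse \<open>rot'\<close> are the translations by a point of order 3 and its negative, so \<open>chord'\<close>
  agrees with \<open>chord\<close> where both are nonzero; in contrast to \<open>chord\<close>, it does not vanish on the diagonal.\<close>

definition rot :: "(nat \<Rightarrow> 'k::field) \<Rightarrow> nat \<Rightarrow> 'k" where
  "rot v = vec3 (v 0) (v 2) (v 1 + v 2)"

definition rot' :: "(nat \<Rightarrow> 'k::field) \<Rightarrow> nat \<Rightarrow> 'k" where
  "rot' v = vec3 (v 0) (v 1 + v 2) (v 1)"

definition chord' :: "(nat \<Rightarrow> 'k::field) \<Rightarrow> (nat \<Rightarrow> 'k) \<Rightarrow> nat \<Rightarrow> 'k" where
  "chord' v w = chord (rot v) (rot' w)"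

text \<open>This involution exchanges the other two intersections of the curve with a line through
  \<open>infpt\<close>, see \<open>star_infpt\<close>.\<close>

definition negv :: "(nat \<Rightarrow> 'k::field) \<Rightarrow> nat \<Rightarrow> 'k" where
  "negv v = vec3 (v 0) (v 1 + v 2) (v 2)"

text \<open>\<open>chord'\<close> serves only where \<open>chord\<close> vanishes. The choice of
  representatives is immaterial because both formulas are bihomogeneous, see
  \<open>star_eq\<close>.\<close>

definition star :: "(nat, 'k::field) ppoint \<Rightarrow> (nat, 'k) ppoint \<Rightarrow> (nat, 'k) ppoint" where
  "star P Q = (let v = SOME v. v \<in> P; w = SOME w. w \<in> Q in
     proj_point (if chord v w \<noteq> (\<lambda>_. 0) then chord v w else chord' v w))"

definition neg :: "(nat, 'k::field) ppoint \<Rightarrow> (nat, 'k) ppoint" where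
  "neg P = proj_point (negv (SOME v. v \<in> P))"

definition ell_add :: "(nat, 'k::field) ppoint \<Rightarrow> (nat, 'k) ppoint \<Rightarrow> (nat, 'k) ppoint" where
  "ell_add P Q = neg (star P Q)"

text \<open>A flex: the line \<open>z = 0\<close> meets the curve only here. With a flex as neutral
  element, collinear points add up to zero.\<close>

definition infpt :: "(nat, 'k::field) ppoint" where
  "infpt = proj_point (vec3 0 1 0)"

lemma curve_vecs_iff:
  "v \<in> curve_vecs \<longleftrightarrow> (v 0 \<noteq> 0 \<or> v 1 \<noteq> 0 \<or> v 2 \<noteq> 0) \<and> (\<forall>i>2. v i = 0) \<and>
     v 0 ^ 3 = v 1 * v 2 * (v 1 + v 2)"
proof -
  have "v \<noteq> (\<lambda>_. 0) \<longleftrightarrow> v 0 \<noteq> 0 \<or> v 1 \<noteq> 0 \<or> v 2 \<noteq> 0" if "\<forall>i>2. v i = 0"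
    using that vec3_eq_iff[of v 0 0 0] vec3_eq_iff[of "\<lambda>_. 0" 0 0 "0::'a"] by auto
  then show ?thesis unfolding curve_vecs_def by auto
qed

lemma curve_vecs_vec3: "vec3 x y z \<in> curve_vecs \<longleftrightarrow> (x \<noteq> 0 \<or> y \<noteq> 0 \<or> z \<noteq> 0) \<and> x ^ 3 = y * z * (y + z)"
  by (simp add: curve_vecs_iff)

lemma vec3_eta: "v \<in> curve_vecs \<Longrightarrow> v = vec3 (v 0) (v 1) (v 2)"
  by (subst vec3_eq_iff) (simp add: curve_vecs_def)

lemma curve_vecs_scale: "v \<in> curve_vecs \<Longrightarrow> c \<noteq> 0 \<Longrightarrow> (\<lambda>i. c * v i) \<in> curve_vecs"
  by (auto simp: curve_vecs_iff power_mult_distrib algebra_simps power3_eq_cube)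

lemma curveD:
  assumes "P \<in> curve" "v \<in> P"
  shows "v \<in> curve_vecs" "P = proj_point v"
proof -
  obtain u where u: "u \<in> curve_vecs" "P = proj_point u" using assms(1) by (auto simp: curve_def)
  then obtain c where "c \<noteq> 0" "v = (\<lambda>i. c * u i)" using assms(2) by (auto simp: mem_proj_point)
  then show "v \<in> curve_vecs" "P = proj_point v" using u curve_vecs_scale by auto
qed

lemma curve_nonempty: "P \<in> curve \<Longrightarrow> \<exists>v. v \<in> P"
  by (auto simp: curve_def intro: self_in_proj_point)

lemma proj_point_in_curve: "proj_point v \<in> curve \<longleftrightarrow> v \<in> curve_vecs"
  by (metis curveD(1) curve_def imageI self_in_proj_point)

lemma curve_subset: "curve \<subseteq> proj_space {..2}"
proof
  fix P :: "(nat, 'a) ppoint" assume "P \<in> curve"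
  then obtain v where v: "v \<in> curve_vecs" "P = proj_point v" by (auto simp: curve_def)
  then have "\<exists>i. v i \<noteq> 0" by (auto simp: curve_vecs_iff)
  then show "P \<in> proj_space {..2}" using v by (auto simp: curve_vecs_def intro!: proj_spaceI)
qed

lemma hform_scale: "hform (\<lambda>i. c * v i) (\<lambda>i. d * w i) = c\<^sup>2 * d * hform v w"
  by (simp add: hform_def algebra_simps power_mult_distrib)

lemma chord_scale: "chord (\<lambda>i. c * v i) (\<lambda>i. d * w i) = (\<lambda>i. c\<^sup>2 * d\<^sup>2 * chord v w i)"
  unfolding chord_def hform_scale by (simp add: algebra_simps power2_eq_square)

lemma rot_scale: "rot (\<lambda>i. c * v i) = (\<lambda>i. c * rot v i)" "rot' (\<lambda>i. c * v i) = (\<lambda>i. c * rot' v i)"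
    "negv (\<lambda>i. c * v i) = (\<lambda>i. c * negv v i)"
  unfolding rot_def rot'_def negv_def vec3_scale by (simp_all add: algebra_simps)

lemma chord'_scale: "chord' (\<lambda>i. c * v i) (\<lambda>i. d * w i) = (\<lambda>i. c\<^sup>2 * d\<^sup>2 * chord' v w i)"
  unfolding chord'_def rot_scale chord_scale ..

lemma chord_commute: "chord v w = chord w v"
  by (auto simp: chord_def)

text \<open>\<open>\<omega>\<close> is a primitive cube root of unity and generates the field with 4
  elements.\<close>

locale char_two =
  fixes \<omega> :: "'k::alg_closed_field"
  assumes char_two: "CHAR('k) = 2" and omega: "\<omega>\<^sup>2 = \<omega> + 1"
begin

lemmas char2 = char_two_simps[where 'k = 'k, OF char_two]

lemmas powers = power2_eq_square power3_eq_cube power4_eq_xxxx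

lemma omega_mult: "\<omega> * \<omega> = \<omega> + 1" "\<omega> * (\<omega> * x) = \<omega> * x + x" "\<omega> \<noteq> 0" "\<omega> \<noteq> 1" "\<omega> ^ 3 = 1"
proof -
  show 1: "\<omega> * \<omega> = \<omega> + 1" using omega by (simp add: power2_eq_square)
  then show "\<omega> * (\<omega> * x) = \<omega> * x + x" by (metis distrib_right mult.assoc mult_1)
  show "\<omega> \<noteq> 0" using 1 by auto
  show "\<omega> \<noteq> 1" using 1 by (auto simp: char2)
  show "\<omega> ^ 3 = 1" by (simp add: powers 1 algebra_simps char2)
qed

text \<open>The second equation is needed because the simplifier nests products to the right.\<close>

lemma cubic_rewrite:
  fixes x y z :: 'k
  assumes "x ^ 3 = y * z * (y + z)"
  shows "x * (x * x) = y * (y * z) + y * (z * z)" "x * (x * (x * t)) = y * (y * (z * t)) + y * (z * (z * t))"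
proof -
  show 1: "x * (x * x) = y * (y * z) + y * (z * z)" using assms by (simp add: powers algebra_simps)
  show "x * (x * (x * t)) = y * (y * (z * t)) + y * (z * (z * t))"
    using arg_cong[OF 1, of "\<lambda>u. u * t"] by (simp add: algebra_simps)
qed

lemma curve_vecs_cubic: "v \<in> curve_vecs \<Longrightarrow> v 0 ^ 3 = v 1 * v 2 * (v 1 + v (2::nat) :: 'k)"
  by (simp add: curve_vecs_def)

lemma hform_self: "v \<in> curve_vecs \<Longrightarrow> hform v v = (0::'k)"
  by (simp add: hform_def powers cubic_rewrite(1)[OF curve_vecs_cubic] algebra_simps char2)

lemma chord_cubic:
  fixes v w :: "nat \<Rightarrow> 'k"
  assumes "v \<in> curve_vecs" "w \<in> curve_vecs"
  shows "chord v w 0 ^ 3 = chord v w 1 * chord v w 2 * (chord v w 1 + chord v w 2)"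
proof -
  have "(a * v 0 + b * w 0) ^ 3 = (a * v 1 + b * w 1) * (a * v 2 + b * w 2) * ((a * v 1 + b * w 1) + (a * v 2 + b * w 2))
     + (a * b * (a * hform v w + b * hform w v))" for a b
    unfolding hform_def powers
    by (simp add: algebra_simps char2 cubic_rewrite[OF curve_vecs_cubic[OF assms(1)]]
        cubic_rewrite[OF curve_vecs_cubic[OF assms(2)]])
  \<comment> \<open>For these coefficients both summands of the last factor are the same product, so
    they cancel.\<close>
  from this[of "hform w v" "hform v w"] show ?thesis by (simp add: chord_def mult.commute char2)
qed

lemma chord_in_curve_vecs:
  "\<lbrakk>v \<in> curve_vecs; w \<in> curve_vecs; chord v w \<noteq> (\<lambda>_. 0)\<rbrakk> \<Longrightarrow> chord v w \<in> curve_vecs" for v w :: "nat \<Rightarrow> 'k"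
  unfolding curve_vecs_def using chord_cubic[of v w]
  by (simp add: curve_vecs_def) (simp add: chord_def)

lemma rot_in_curve_vecs:
  fixes v :: "nat \<Rightarrow> 'k"
  assumes "v \<in> curve_vecs"
  shows "rot v \<in> curve_vecs" "rot' v \<in> curve_vecs" "negv v \<in> curve_vecs"
  using assms by (auto simp: curve_vecs_iff rot_def rot'_def negv_def algebra_simps char2)

text \<open>A nondegenerate Hermitian form on a 3-space has no isotropic plane: the Frobenius twists of
  two independent vectors of such a plane would both be orthogonal to it, hence parallel.\<close>

lemma isotropic_parallel:
  fixes a b c d e f :: 'k
  assumes 1: "a\<^sup>2 * a + b\<^sup>2 * b + c\<^sup>2 * c = 0" and 2: "a\<^sup>2 * d + b\<^sup>2 * e + c\<^sup>2 * f = 0"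
    and 3: "d\<^sup>2 * a + e\<^sup>2 * b + f\<^sup>2 * c = 0" and 4: "d\<^sup>2 * d + e\<^sup>2 * e + f\<^sup>2 * f = 0"
  shows "a * e = b * d"
proof -
  \<comment> \<open>The cross product of \<open>(a, b, c)\<close> and \<open>(d, e, f)\<close>; the
    four relations below compare it with the Frobenius twists of both vectors.\<close>
  define p q r where "p = b * f + c * e" "q = a * f + c * d" "r = a * e + b * d"
  note defs = p_q_r_def
  have "a\<^sup>2 * r + c\<^sup>2 * p = e * (a\<^sup>2 * a + b\<^sup>2 * b + c\<^sup>2 * c) + b * (a\<^sup>2 * d + b\<^sup>2 * e + c\<^sup>2 * f)"
    unfolding defs by (simp add: algebra_simps char2)
  then have ap: "a\<^sup>2 * r = c\<^sup>2 * p" by (simp add: 1 2 char2)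
  have "b\<^sup>2 * r + c\<^sup>2 * q = d * (a\<^sup>2 * a + b\<^sup>2 * b + c\<^sup>2 * c) + a * (a\<^sup>2 * d + b\<^sup>2 * e + c\<^sup>2 * f)"
    unfolding defs by (simp add: algebra_simps char2)
  then have bq: "b\<^sup>2 * r = c\<^sup>2 * q" by (simp add: 1 2 char2)
  have "d\<^sup>2 * r + f\<^sup>2 * p = e * (d\<^sup>2 * a + e\<^sup>2 * b + f\<^sup>2 * c) + b * (d\<^sup>2 * d + e\<^sup>2 * e + f\<^sup>2 * f)"
    unfolding defs by (simp add: algebra_simps char2)
  then have dp: "d\<^sup>2 * r = f\<^sup>2 * p" by (simp add: 3 4 char2)
  have "e\<^sup>2 * r + f\<^sup>2 * q = d * (d\<^sup>2 * a + e\<^sup>2 * b + f\<^sup>2 * c) + a * (d\<^sup>2 * d + e\<^sup>2 * e + f\<^sup>2 * f)"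
    unfolding defs by (simp add: algebra_simps char2)
  then have eq: "e\<^sup>2 * r = f\<^sup>2 * q" by (simp add: 3 4 char2)
  \<comment> \<open>Squaring \<open>r\<close> gives
    \<open>a\<^sup>2 e\<^sup>2 + b\<^sup>2 d\<^sup>2\<close>. After multiplication by another
    \<open>r\<^sup>2\<close> the relations turn both terms into
    \<open>c\<^sup>2 f\<^sup>2 p q\<close>.\<close>
  have "r\<^sup>2 * r\<^sup>2 = (a\<^sup>2 * r) * (e\<^sup>2 * r) + (b\<^sup>2 * r) * (d\<^sup>2 * r)"
    unfolding defs powers by (simp add: algebra_simps char2)
  also have "\<dots> = 0" unfolding ap bq dp eq by (simp add: algebra_simps char2)
  finally have "r = 0" by simp
  then show ?thesis by (simp add: p_q_r_def char2)
qed

text \<open>If a coefficient of \<open>chord\<close> is nonzero, its vanishing is a linear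
  dependence. If both coefficients vanish, the cubic form is zero on the whole span of
  \<open>v\<close> and \<open>w\<close>, and a smooth cubic contains no line.\<close>

lemma chord_eq_0_imp:
  fixes v w :: "nat \<Rightarrow> 'k"
  assumes v: "v \<in> curve_vecs" and w: "w \<in> curve_vecs" and 0: "chord v w = (\<lambda>_. 0)"
  shows "proj_point v = proj_point w"
proof (rule parallel_imp_proj_point_eq)
  show nz: "v \<noteq> (\<lambda>_. 0)" "w \<noteq> (\<lambda>_. 0)" using v w by (auto simp: curve_vecs_def)
  have eq: "hform w v * v i = hform v w * w i" for i
    using fun_cong[OF 0, of i] by (simp add: chord_def char2)
  show "v i * w j = v j * w i" for i j
  proof (cases "hform w v = 0 \<and> hform v w = 0")
    case False
    then have "hform w v \<noteq> 0 \<or> hform v w \<noteq> 0" by simp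
    then show ?thesis
    proof
      assume nz: "hform w v \<noteq> 0"
      have "hform w v * (v i * w j) = hform w v * (v j * w i)"
        using eq[of i] eq[of j] by (metis mult.assoc mult.commute)
      then show ?thesis using nz by simp
    next
      assume nz: "hform v w \<noteq> 0"
      have "hform v w * (v i * w j) = hform v w * (v j * w i)"
        using eq[of i] eq[of j] by (metis mult.assoc mult.commute)
      then show ?thesis using nz by simp
    qed
  next
    case True
    text \<open>\<open>hform\<close> is Hermitian only after exchanging the last two coordinates, and the standard
      diagonal form is obtained from it by a linear change of variables over the field with 4 elements.\<close>
    define L where "L u = (\<lambda>i. vec3 (u 0) (u 1 + \<omega> * u 2) (u 1 + u 2 + \<omega> * u 2) i)" for u :: "nat \<Rightarrow> 'k"
    have hL: "hform u u' = (L u 0)\<^sup>2 * L u' 0 + (L u 1)\<^sup>2 * L u' 1 + (L u 2)\<^sup>2 * L u' 2" for u u'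
      unfolding hform_def L_def powers by (simp add: algebra_simps char2 omega_mult)
    have iso: "hform v v = 0" "hform v w = 0" "hform w v = 0" "hform w w = 0"
      using True hform_self v w by auto
    have a: "L v 0 * L w 1 = L v 1 * L w 0" "L v 0 * L w 2 = L v 2 * L w 0" "L v 1 * L w 2 = L v 2 * L w 1"
      by (rule isotropic_parallel[of _ _ "L v 2" _ _ "L w 2"] isotropic_parallel[of _ _ "L v 1" _ _ "L w 1"]
         isotropic_parallel[of _ _ "L v 0" _ _ "L w 0"];
         use iso in \<open>simp add: hL add_ac\<close>)+
    have v0: "v 1 = L v 1 + \<omega> * L v 1 + \<omega> * L v 2" "v 2 = L v 1 + L v 2" "v 0 = L v 0"
      and w0: "w 1 = L w 1 + \<omega> * L w 1 + \<omega> * L w 2" "w 2 = L w 1 + L w 2" "w 0 = L w 0"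
      unfolding L_def by (simp_all add: algebra_simps char2 omega_mult)
    have b: "v 0 * w 1 = v 1 * w 0" "v 0 * w 2 = v 2 * w 0" "v 1 * w 2 = v 2 * w 1"
      unfolding v0 w0 using a by (simp_all add: algebra_simps char2 omega_mult)
    have "v i = 0" "w i = 0" if "i > 2" for i using v w that by (auto simp: curve_vecs_def)
    then show ?thesis using nat_cases3[of i] nat_cases3[of j] b
      by (elim disjE) (auto simp: mult.commute)
  qed
qed

text \<open>On this supersingular curve doubling is the negative of the Frobenius map over the field
  with 4 elements, so the tangent at \<open>v\<close> meets the curve again in the Frobenius image
  of \<open>v\<close>.\<close>

lemma chord'_self:
  fixes v :: "nat \<Rightarrow> 'k"
  assumes "v \<in> curve_vecs"
  shows "chord' v v = (\<lambda>i. v i ^ 4)"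
proof
  fix i
  have *: "i > 2 \<Longrightarrow> v i = 0" using assms by (auto simp: curve_vecs_def)
  show "chord' v v i = v i ^ 4" using nat_cases3[of i]
    by (elim disjE)
      (simp_all add: * chord'_def chord_def rot_def rot'_def hform_def powers algebra_simps char2
        cubic_rewrite[OF curve_vecs_cubic[OF assms]])
qed

lemma chord_chord'_parallel:
  fixes v w :: "nat \<Rightarrow> 'k"
  assumes "v \<in> curve_vecs" "w \<in> curve_vecs"
  shows "chord v w i * chord' v w j = chord v w j * chord' v w i"
proof -
  note s = chord'_def chord_def rot_def rot'_def hform_def powers algebra_simps char2
        cubic_rewrite[OF curve_vecs_cubic[OF assms(1)]] cubic_rewrite[OF curve_vecs_cubic[OF assms(2)]]
  have *: "chord v w 0 * chord' v w 1 = chord v w 1 * chord' v w 0"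
    "chord v w 0 * chord' v w 2 = chord v w 2 * chord' v w 0"
    "chord v w 1 * chord' v w 2 = chord v w 2 * chord' v w 1"
    by (simp_all add: s)
  have "i > 2 \<Longrightarrow> chord v w i = 0" "i > 2 \<Longrightarrow> chord' v w i = 0" for i
    using assms unfolding chord_def chord'_def curve_vecs_def rot_def rot'_def by simp_all
  then show ?thesis using nat_cases3[of i] nat_cases3[of j] *
    by (elim disjE) (auto simp: mult.commute)
qed

text \<open>\<open>chord\<close> vanishes only on the diagonal and \<open>chord'\<close> nowhere on
  it, so the two formulas together cover all pairs.\<close>

lemma chord_or_chord':
  fixes v w :: "nat \<Rightarrow> 'k"
  assumes "v \<in> curve_vecs" "w \<in> curve_vecs"
  shows "chord v w \<noteq> (\<lambda>_. 0) \<or> chord' v w \<noteq> (\<lambda>_. 0)"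
proof (rule ccontr)
  assume *: "\<not> ?thesis"
  then have "proj_point v = proj_point w" using chord_eq_0_imp assms by blast
  then obtain c where c: "c \<noteq> 0" "w = (\<lambda>i. c * v i)" by (auto simp: proj_point_eq_iff)
  have "chord' v w = (\<lambda>i. c\<^sup>2 * v i ^ 4)"
    using chord'_scale[of 1 v c v] chord'_self[OF assms(1)] c by simp
  then have "c\<^sup>2 * v i ^ 4 = 0" for i using * by metis
  then show False using c assms(1) by (auto simp: curve_vecs_def)
qed

lemma star_eq:
  fixes v w :: "nat \<Rightarrow> 'k"
  assumes "P \<in> curve" "Q \<in> curve" "v \<in> P" "w \<in> Q"
  shows "star P Q = proj_point (if chord v w \<noteq> (\<lambda>_. 0) then chord v w else chord' v w)"
proof -
  define v0 w0 where d: "v0 = (SOME v. v \<in> P)" "w0 = (SOME w. w \<in> Q)"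
  have "v0 \<in> P" unfolding d by (rule someI[of "\<lambda>u. u \<in> P", OF assms(3)])
  moreover have "w0 \<in> Q" unfolding d by (rule someI[of "\<lambda>u. u \<in> Q", OF assms(4)])
  ultimately obtain c b where *: "c \<noteq> 0" "v0 = (\<lambda>i. c * v i)" "b \<noteq> 0" "w0 = (\<lambda>i. b * w i)"
    using curveD(2)[OF assms(1,3)] curveD(2)[OF assms(2,4)] by (auto simp: mem_proj_point)
  have "star P Q = proj_point (if chord v0 w0 \<noteq> (\<lambda>_. 0) then chord v0 w0 else chord' v0 w0)"
    unfolding star_def d Let_def ..
  also have "\<dots> = proj_point (\<lambda>i. c\<^sup>2 * b\<^sup>2 * (if chord v w \<noteq> (\<lambda>_. 0) then chord v w else chord' v w) i)"
    unfolding *(2,4) chord_scale chord'_scale using *(1,3) by (auto simp: fun_eq_iff)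
  also have "\<dots> = proj_point (if chord v w \<noteq> (\<lambda>_. 0) then chord v w else chord' v w)"
    using * by (intro proj_point_scale) simp
  finally show ?thesis .
qed

lemma star_chord:
  fixes v w :: "nat \<Rightarrow> 'k"
  assumes "v \<in> curve_vecs" "w \<in> curve_vecs" "chord v w \<noteq> (\<lambda>_. 0)"
  shows "star (proj_point v) (proj_point w) = proj_point (chord v w)"
  using star_eq[of "proj_point v" "proj_point w" v w] assms by (simp add: proj_point_in_curve)

lemma star_chord':
  fixes v w :: "nat \<Rightarrow> 'k"
  assumes "v \<in> curve_vecs" "w \<in> curve_vecs" "chord' v w \<noteq> (\<lambda>_. 0)"
  shows "star (proj_point v) (proj_point w) = proj_point (chord' v w)"
proof (cases "chord v w = (\<lambda>_. 0)")
  case True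
  then show ?thesis using star_eq[of "proj_point v" "proj_point w" v w] assms
    by (simp add: proj_point_in_curve)
next
  case False
  have "proj_point (chord v w) = proj_point (chord' v w)"
    by (intro parallel_imp_proj_point_eq False assms(3) chord_chord'_parallel assms(1,2))
  then show ?thesis using star_chord[OF assms(1,2) False] by simp
qed

lemma star_in_curve:
  assumes "P \<in> curve" "Q \<in> (curve :: (nat, 'k) ppoint set)"
  shows "star P Q \<in> curve"
proof -
  obtain v w where vw: "v \<in> curve_vecs" "P = proj_point v" "w \<in> curve_vecs" "Q = proj_point w"
    using assms by (auto simp: curve_def)
  show ?thesis
  proof (cases "chord v w = (\<lambda>_. 0)")
    case False
    then show ?thesis using vw star_chord chord_in_curve_vecs by (simp add: proj_point_in_curve)
  next
    case True
    then have *: "chord' v w \<noteq> (\<lambda>_. 0)" using chord_or_chord' vw by blast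
    then have "chord' v w \<in> curve_vecs" unfolding chord'_def
      using vw rot_in_curve_vecs by (intro chord_in_curve_vecs) auto
    then show ?thesis using star_chord'[OF vw(1,3) *] vw by (simp add: proj_point_in_curve)
  qed
qed

text \<open>\<open>chord'\<close> is not visibly symmetric, but it enters only for equal points,
  where there is nothing to prove.\<close>

lemma star_commute:
  assumes "P \<in> curve" "Q \<in> (curve :: (nat, 'k) ppoint set)"
  shows "star P Q = star Q P"
proof (cases "P = Q")
  case False
  obtain v w where vw: "v \<in> curve_vecs" "P = proj_point v" "w \<in> curve_vecs" "Q = proj_point w"
    using assms by (auto simp: curve_def)
  then have "chord v w \<noteq> (\<lambda>_. 0)" using chord_eq_0_imp False by blast
  then show ?thesis using vw star_chord chord_commute by metis
qed simp

lemma neg_proj_point: "v \<in> curve_vecs \<Longrightarrow> neg (proj_point v) = proj_point (negv (v :: nat \<Rightarrow> 'k))"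
proof -
  have "(SOME u. u \<in> proj_point v) \<in> proj_point v" by (rule someI[of _ v]) simp
  then obtain c where "c \<noteq> 0" "(SOME u. u \<in> proj_point v) = (\<lambda>i. c * v i)" by (auto simp: mem_proj_point)
  then show ?thesis unfolding neg_def by (simp add: rot_scale)
qed

lemma neg_in_curve: "P \<in> curve \<Longrightarrow> neg P \<in> (curve :: (nat, 'k) ppoint set)"
  by (metis curveD curve_nonempty neg_proj_point proj_point_in_curve rot_in_curve_vecs(3))

lemma negv_negv: "v \<in> curve_vecs \<Longrightarrow> negv (negv v) = (v :: nat \<Rightarrow> 'k)"
  by (rule sym) (simp add: negv_def vec3_eq_iff curve_vecs_def char2 algebra_simps)

lemma neg_neg: "P \<in> curve \<Longrightarrow> neg (neg P) = (P :: (nat, 'k) ppoint)"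
  by (metis curveD curve_nonempty neg_proj_point negv_negv rot_in_curve_vecs(3))

lemma infpt_in_curve: "infpt \<in> (curve :: (nat, 'k) ppoint set)"
  by (simp add: infpt_def proj_point_in_curve curve_vecs_vec3)

lemma ell_add_in_curve: "P \<in> curve \<Longrightarrow> Q \<in> curve \<Longrightarrow> ell_add P Q \<in> (curve :: (nat, 'k) ppoint set)"
  unfolding ell_add_def by (intro neg_in_curve star_in_curve)

lemma ell_add_commute:
  "P \<in> curve \<Longrightarrow> Q \<in> curve \<Longrightarrow> ell_add P Q = ell_add Q (P :: (nat, 'k) ppoint)"
  unfolding ell_add_def by (simp add: star_commute)

lemma curve_cases:
  assumes "P \<in> (curve :: (nat, 'k) ppoint set)"
  obtains "P = infpt" | x y where "P = proj_point (vec3 x y 1)" "x ^ 3 = y * (y + 1)"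
proof -
  obtain v where v: "v \<in> curve_vecs" "P = proj_point v" using assms by (auto simp: curve_def)
  show ?thesis
  proof (cases "v 2 = 0")
    case True
    then have "v 0 = 0" "v 1 \<noteq> 0" "v = vec3 (v 1 * 0) (v 1 * 1) (v 1 * 0)"
      using v by (auto simp: curve_vecs_iff vec3_eq_iff)
    then have "P = proj_point (\<lambda>i. v 1 * vec3 0 1 0 i)" using v by (simp add: vec3_scale)
    then show ?thesis using that(1) proj_point_scale[OF \<open>v 1 \<noteq> 0\<close>] unfolding infpt_def by metis
  next
    case False
    let ?x = "v 0 / v 2" and ?y = "v 1 / v 2"
    have "v = (\<lambda>i. v 2 * vec3 ?x ?y 1 i)" unfolding vec3_scale using vec3_eta[OF v(1)] False by simp
    then have P: "P = proj_point (vec3 ?x ?y 1)" using v(2) proj_point_scale[OF False] by metis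
    then have "vec3 ?x ?y 1 \<in> curve_vecs" using assms by (simp add: proj_point_in_curve)
    then show ?thesis using that(2)[OF P] by (simp add: curve_vecs_vec3)
  qed
qed

lemma star_infpt:
  assumes "P \<in> (curve :: (nat, 'k) ppoint set)"
  shows "star infpt P = neg P"
  using assms
proof (cases rule: curve_cases)
  case 1
  have c: "vec3 0 1 0 \<in> (curve_vecs :: (nat \<Rightarrow> 'k) set)" by (simp add: curve_vecs_vec3)
  have "chord' (vec3 0 1 0) (vec3 0 1 (0::'k)) = vec3 0 1 0"
    unfolding chord'_self[OF c] by (auto simp: vec3_def fun_eq_iff)
  then have "star infpt infpt = (infpt :: (nat, 'k) ppoint)"
    using star_chord'[OF c c] c unfolding infpt_def by (auto simp: curve_vecs_def)
  then show ?thesis using 1 neg_proj_point[OF c] by (simp add: infpt_def negv_def)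
next
  case (2 x y)
  have c: "vec3 0 1 0 \<in> (curve_vecs :: (nat \<Rightarrow> 'k) set)" "vec3 x y 1 \<in> curve_vecs"
    using 2 by (auto simp: curve_vecs_vec3)
  have e: "chord (vec3 0 1 0) (vec3 x y 1) = negv (vec3 x y 1)"
    unfolding negv_def by (subst vec3_eq_iff) (simp add: chord_def hform_def add.commute)
  then have "chord (vec3 0 1 0) (vec3 x y 1) \<noteq> (\<lambda>_. 0)"
    using rot_in_curve_vecs(3)[OF c(2)] by (auto simp: curve_vecs_def)
  then show ?thesis using star_chord[OF c] e neg_proj_point[OF c(2)] 2 by (simp add: infpt_def)
qed

lemma star_neg:
  assumes "P \<in> (curve :: (nat, 'k) ppoint set)"
  shows "star P (neg P) = infpt"
  using assms
proof (cases rule: curve_cases)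
  case 1
  have "neg infpt = (infpt :: (nat, 'k) ppoint)"
    using neg_proj_point[of "vec3 0 1 0"] by (simp add: infpt_def negv_def curve_vecs_vec3)
  then show ?thesis using 1 star_infpt[OF infpt_in_curve] by simp
next
  case (2 x y)
  have c: "vec3 x y 1 \<in> curve_vecs" using 2 by (auto simp: curve_vecs_vec3)
  have e: "chord (vec3 x y 1) (negv (vec3 x y 1)) = vec3 0 1 0"
    using 2 unfolding negv_def
    by (subst vec3_eq_iff) (simp add: chord_def hform_def powers algebra_simps char2)
  then have "chord (vec3 x y 1) (negv (vec3 x y 1)) \<noteq> (\<lambda>_. 0)" by (metis vec3_simps(2) zero_neq_one)
  then show ?thesis
    using star_chord[OF c rot_in_curve_vecs(3)[OF c]] e neg_proj_point[OF c] 2 by (simp add: infpt_def)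
qed

end

section \<open>Zeros of forms on the curve\<close>

context char_two
begin

text \<open>The coordinate ring of the affine curve \<open>y\<^sup>2 + y = x\<^sup>3\<close> is free
  over the polynomials in \<open>x\<close> with basis 1, \<open>y\<close>; \<open>A\<close> and
  \<open>B\<close> are the coordinates in this basis.\<close>

definition affine_rep :: "('k \<Rightarrow> 'k \<Rightarrow> 'k) \<Rightarrow> bool" where
  "affine_rep f \<longleftrightarrow> (\<exists>A B. \<forall>x y. x ^ 3 = y * (y + 1) \<longrightarrow> f x y = poly A x + poly B x * y)"

lemma affine_repI: "(\<And>x y. x ^ 3 = y * (y + 1) \<Longrightarrow> f x y = poly A x + poly B x * y) \<Longrightarrow> affine_rep f"
  unfolding affine_rep_def by blast

lemma affine_rep_add:
  assumes "affine_rep f" "affine_rep g"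
  shows "affine_rep (\<lambda>x y. f x y + g x y)"
proof -
  from assms obtain A B A' B' where
    "\<forall>x y. x ^ 3 = y * (y + 1) \<longrightarrow> f x y = poly A x + poly B x * y"
    "\<forall>x y. x ^ 3 = y * (y + 1) \<longrightarrow> g x y = poly A' x + poly B' x * y"
    unfolding affine_rep_def by blast
  then show ?thesis
    by (intro affine_repI[of _ "A + A'" "B + B'"]) (simp add: algebra_simps)
qed

lemma affine_rep_mult:
  assumes "affine_rep f" "affine_rep g"
  shows "affine_rep (\<lambda>x y. f x y * g x y)"
proof -
  from assms obtain A B A' B' where *:
    "\<forall>x y. x ^ 3 = y * (y + 1) \<longrightarrow> f x y = poly A x + poly B x * y"
    "\<forall>x y. x ^ 3 = y * (y + 1) \<longrightarrow> g x y = poly A' x + poly B' x * y"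
    unfolding affine_rep_def by blast
  show ?thesis
  proof (rule affine_repI[of _ "A * A' + B * B' * monom 1 3" "A * B' + B * A' + B * B'"])
    fix x y :: 'k
    assume xy: "x ^ 3 = y * (y + 1)"
    then show "f x y * g x y = poly (A * A' + B * B' * monom 1 3) x +
        poly (A * B' + B * A' + B * B') x * y"
      using * by (simp add: poly_monom algebra_simps char2)
  qed
qed

lemma affine_rep_const: "affine_rep (\<lambda>x y. c)"
  by (rule affine_repI[of _ "[:c:]" 0]) simp

lemma affine_rep_coordinate: "affine_rep (\<lambda>x y. vec3 x y 1 i)"
  using nat_cases3[of i]
  by (elim disjE) (auto intro: affine_repI[of _ "[:0, 1:]" 0] affine_repI[of _ 0 1] affine_repI[of _ 1 0]
      affine_repI[of _ 0 0])

lemma affine_rep_power: "affine_rep f \<Longrightarrow> affine_rep (\<lambda>x y. f x y ^ n)"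
  by (induction n) (auto intro: affine_rep_const affine_rep_mult)

lemma affine_rep_prod: "(\<And>i. i \<in> S \<Longrightarrow> affine_rep (f i)) \<Longrightarrow> affine_rep (\<lambda>x y. \<Prod>i\<in>S. f i x y)"
  by (induction S rule: infinite_finite_induct) (auto intro: affine_rep_const affine_rep_mult)

lemma affine_rep_sum: "(\<And>i. i \<in> S \<Longrightarrow> affine_rep (f i)) \<Longrightarrow> affine_rep (\<lambda>x y. \<Sum>i\<in>S. f i x y)"
  by (induction S rule: infinite_finite_induct) (auto intro: affine_rep_const affine_rep_add)

lemma affine_rep_form: "form d g \<Longrightarrow> affine_rep (\<lambda>x y. g (vec3 x y 1))"
proof (erule form_expand)
  fix c M assume g: "g = (\<lambda>v. \<Sum>m\<in>M. c m * monomial_value v m)"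
  show ?thesis unfolding g monomial_value_def
    by (intro affine_rep_sum affine_rep_mult affine_rep_const affine_rep_prod affine_rep_power
        affine_rep_coordinate)
qed

text \<open>The left-hand side is the norm of \<open>A + B y\<close> over the polynomials in \<open>x\<close>; its three terms cannot
  cancel since the degrees of the first and the last one have different parity.\<close>

lemma norm_eq_0:
  fixes A B :: "'k poly"
  assumes "A * A + A * B + B * B * monom 1 3 = 0"
  shows "A = 0 \<and> B = 0"
proof (rule ccontr)
  assume nz: "\<not> ?thesis"
  have two: "p + p = 0" for p :: "'k poly"
    by (rule poly_eqI) (simp only: coeff_add char2 coeff_0)
  have eq: "A * A = A * B + B * B * monom 1 3"
    by (rule add_right_imp_eq[of _ "A * B + B * B * monom 1 3"])
      (simp only: two assms flip: add.assoc)
  have A: "A \<noteq> 0" "B \<noteq> 0" using nz assms by (auto simp: monom_eq_0_iff)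
  let ?a = "degree A" and ?b = "degree B"
  have d: "degree (A * A) = 2 * ?a" "degree (A * B) = ?a + ?b" "degree (B * B * monom 1 3) = 2 * ?b + 3"
    using A by (simp_all add: degree_mult_eq degree_monom_eq monom_eq_0_iff)
  show False
  proof (cases "?a \<le> ?b + 1")
    case True
    have "degree (A * B + B * B * monom 1 3) = 2 * ?b + 3"
      using d True by (subst degree_add_eq_right) auto
    then show False using eq d True by simp
  next
    case False
    have "degree (A * B + B * B * monom 1 3) \<le> max (?a + ?b) (2 * ?b + 3)"
      using d by (metis degree_add_le_max)
    then show False using eq d False by simp
  qed
qed

section \<open>Points of the affine chart and the vanishing of forms\<close>

definition affine_points :: "('k \<times> 'k) set" where
  "affine_points = {(x, y). x ^ 3 = y * (y + 1)}"

abbreviation pt :: "'k \<Rightarrow> 'k \<Rightarrow> (nat, 'k) ppoint" where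
  "pt x y \<equiv> proj_point (vec3 x y 1)"

lemma pt_eq_iff: "pt x y = pt x' y' \<longleftrightarrow> x = x' \<and> y = y'"
proof
  assume "pt x y = pt x' y'"
  then obtain c where "vec3 x' y' 1 = (\<lambda>i. c * vec3 x y 1 i)" by (auto simp: proj_point_eq_iff)
  then have "vec3 x' y' 1 = vec3 (c * x) (c * y) (c * 1)" by (simp add: vec3_scale)
  then show "x = x' \<and> y = y'" by (simp add: vec3_eq_iff)
qed simp

lemma pt_in_curve: "pt x y \<in> curve \<longleftrightarrow> x ^ 3 = y * (y + 1)"
  by (simp add: proj_point_in_curve curve_vecs_vec3)

lemma pt_neq_infpt: "pt x y \<noteq> infpt"
proof
  assume "pt x y = infpt"
  then obtain c where "c \<noteq> 0" "vec3 0 1 0 = (\<lambda>i. c * vec3 x y 1 i)"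
    unfolding infpt_def by (auto simp: proj_point_eq_iff)
  then have "vec3 0 1 0 (2::nat) = c * vec3 x y 1 2" by metis
  then show False using \<open>c \<noteq> 0\<close> by simp
qed

lemma curve_eq: "curve = insert infpt ((\<lambda>(x, y). pt x y) ` affine_points)"
proof (intro equalityI subsetI)
  fix P assume "P \<in> (curve :: (nat, 'k) ppoint set)"
  then show "P \<in> insert infpt ((\<lambda>(x, y). pt x y) ` affine_points)"
    by (cases rule: curve_cases) (auto simp: affine_points_def)
next
  fix P assume "P \<in> insert infpt ((\<lambda>(x, y). pt x y) ` affine_points)"
  then show "P \<in> curve" by (auto simp: infpt_in_curve affine_points_def pt_in_curve)
qed

text \<open>Over a finite field the product of all linear factors plus 1 would be a nonconstant
  polynomial without roots.\<close>

lemma infinite_UNIV: "infinite (UNIV :: 'k set)"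
proof
  assume fin: "finite (UNIV :: 'k set)"
  define p where "p = (\<Prod>a\<in>(UNIV :: 'k set). [:-a, 1:]) + 1"
  have "degree (\<Prod>a\<in>(UNIV :: 'k set). [:-a, 1:]) = card (UNIV :: 'k set)"
    by (subst degree_prod_sum_eq) auto
  moreover have "card (UNIV :: 'k set) > 0" using fin by (simp add: card_gt_0_iff)
  ultimately have "degree p > 0" unfolding p_def by (subst degree_add_eq_left) auto
  then obtain x where "poly p x = 0" using alg_closed_imp_poly_has_root by blast
  moreover have "poly (\<Prod>a\<in>(UNIV :: 'k set). [:-a, 1:]) x = 0"
    using fin by (auto simp: poly_prod)
  ultimately show False by (simp add: p_def)
qed

lemma affine_points_root: "(x, y) \<in> affine_points \<longleftrightarrow> poly [:x ^ 3, 1, 1:] y = 0"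
proof -
  have "poly [:x ^ 3, 1, 1:] y = x ^ 3 + y * (y + 1)" by (simp add: algebra_simps)
  then show ?thesis by (simp only: affine_points_def char2 mem_Collect_eq prod.case)
qed

lemma ex_affine_point: "\<exists>y. (x, y) \<in> affine_points"
proof -
  have "degree [:x ^ 3, 1, 1:] > 0" by simp
  then show ?thesis unfolding affine_points_root by (rule alg_closed_imp_poly_has_root)
qed

lemma infinite_affine_points: "infinite affine_points"
proof
  assume "finite affine_points"
  then have "finite (fst ` affine_points)" by simp
  moreover have "fst ` affine_points = UNIV" using ex_affine_point by force
  ultimately show False using infinite_UNIV by simp
qed

lemma finite_affine_fiber: "finite {y. (x, y) \<in> affine_points}"
  unfolding affine_points_root by (rule poly_roots_finite) simp

lemma infinite_fst_image:
  assumes "infinite Z" "Z \<subseteq> affine_points"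
  shows "infinite (fst ` Z)"
proof
  assume "finite (fst ` Z)"
  then have "finite (\<Union>x\<in>fst ` Z. (\<lambda>y. (x, y)) ` {y. (x, y) \<in> affine_points})"
    by (rule finite_UN_I) (intro finite_imageI finite_affine_fiber)
  moreover have "Z \<subseteq> (\<Union>x\<in>fst ` Z. (\<lambda>y. (x, y)) ` {y. (x, y) \<in> affine_points})"
    using assms(2) by force
  ultimately show False using assms(1) finite_subset by blast
qed

text \<open>The map \<open>y \<mapsto> y + 1\<close> exchanges the points over a given
  \<open>x\<close>. Multiplying \<open>g\<close> by its image under this map gives a norm
  \<open>N\<close> in \<open>x\<close> alone, with a root at the abscissa of every zero of
  \<open>g\<close>; since the fibres over \<open>x\<close> are finite, these are infinitely many
  roots.\<close>

lemma form_vanishes_affine: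
  assumes "form d g" "infinite {(x, y) \<in> affine_points. g (vec3 x y 1) = 0}" "(x, y) \<in> affine_points"
  shows "g (vec3 x y 1) = 0"
proof -
  obtain A B where AB: "\<forall>x y. x ^ 3 = y * (y + 1) \<longrightarrow> g (vec3 x y 1) = poly A x + poly B x * y"
    using affine_rep_form[OF assms(1)] unfolding affine_rep_def by blast
  define N where "N = A * A + A * B + B * B * monom 1 3"
  have "poly N x = 0" if xy: "(x, y) \<in> affine_points" "g (vec3 x y 1) = 0" for x y
  proof -
    have x3: "x ^ 3 = y * (y + 1)" using xy by (simp add: affine_points_def)
    have "poly N x = (poly A x + poly B x * y) * (poly A x + poly B x * (y + 1))"
    proof -
      have "(a + b * y) * (a + b * (y + 1)) = a * a + a * b + b * b * (y * (y + 1))" for a b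
        by (simp add: algebra_simps char2)
      then show ?thesis by (simp add: N_def poly_monom x3)
    qed
    then show ?thesis using AB x3 xy by simp
  qed
  then have "fst ` {(x, y) \<in> affine_points. g (vec3 x y 1) = 0} \<subseteq> {x. poly N x = 0}" by auto
  moreover have "infinite (fst ` {(x, y) \<in> affine_points. g (vec3 x y 1) = 0})"
    by (rule infinite_fst_image[OF assms(2)]) auto
  ultimately have "infinite {x. poly N x = 0}" by (rule infinite_super)
  then have "N = 0" using poly_roots_finite by blast
  then have "A = 0 \<and> B = 0" unfolding N_def by (rule norm_eq_0)
  then show ?thesis using AB assms(3) by (simp add: affine_points_def)
qed

text \<open>The affine chart misses \<open>infpt\<close>. As \<open>rot\<close> carries (0 : 1 : 1)
  to \<open>infpt\<close>, the affine statement is applied once more to \<open>g\<close> composed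
  with \<open>rot\<close>, which already vanishes at all affine points with
  \<open>y \<noteq> 1\<close> because \<open>rot\<close> keeps these in the chart.\<close>

lemma form_vanishes:
  assumes g: "form d g" and inf: "infinite {P \<in> curve. \<forall>v\<in>P. g v = 0}" and P: "P \<in> curve" "v \<in> P"
  shows "g v = (0 :: 'k)"
proof -
  have zero: "g w = 0 \<longleftrightarrow> g u = 0" if "Q \<in> curve" "u \<in> Q" "w \<in> Q" for Q u w
    using form_nonzero_proj[OF g subsetD[OF curve_subset]] that by blast
  have "infinite {(x, y) \<in> affine_points. g (vec3 x y 1) = 0}"
  proof
    assume "finite {(x, y) \<in> affine_points. g (vec3 x y 1) = 0}"
    then have "finite (insert infpt ((\<lambda>(x, y). pt x y) ` {(x, y) \<in> affine_points. g (vec3 x y 1) = 0}))"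
      by simp
    moreover have "{P \<in> curve. \<forall>v\<in>P. g v = 0} \<subseteq>
        insert infpt ((\<lambda>(x, y). pt x y) ` {(x, y) \<in> affine_points. g (vec3 x y 1) = 0})"
      unfolding curve_eq by auto
    ultimately show False using inf finite_subset by blast
  qed
  from form_vanishes_affine[OF g this] have aff: "g (vec3 x y 1) = 0" if "(x, y) \<in> affine_points" for x y
    using that .
  have rot: "form (d * 1) (\<lambda>v. g (\<lambda>i. rot v i))"
    unfolding rot_def by (intro form_compose g form_vec3 form_var form_add)
  have rot_zero: "g (rot (vec3 x y 1)) = 0" if xy: "(x, y) \<in> affine_points" "y \<noteq> 1" for x y
  proof -
    have y1: "y + 1 \<noteq> 0" using xy by (simp add: char2)
    let ?u = "x / (y + 1)" and ?w = "1 / (y + 1)"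
    have "?w + 1 = y / (y + 1)" using y1 by (simp add: field_simps char2)
    moreover have "?u ^ 3 = ?w * (y / (y + 1))"
      using xy y1 by (simp add: affine_points_def power_divide power3_eq_cube)
    ultimately have "?u ^ 3 = ?w * (?w + 1)" by simp
    then have "(?u, ?w) \<in> affine_points" by (simp add: affine_points_def)
    then have "g (vec3 ?u ?w 1) = 0" by (rule aff)
    moreover have "rot (vec3 x y 1) = (\<lambda>i. (y + 1) * vec3 ?u ?w 1 i)"
      unfolding vec3_scale using y1 by (simp add: rot_def)
    ultimately show ?thesis using form_scale[OF g] by simp
  qed
  have "affine_points - {(0, 1)} \<subseteq> {(x, y) \<in> affine_points. g (rot (vec3 x y 1)) = 0}"
  proof
    fix p assume p: "p \<in> affine_points - {(0, 1)}"
    then have "snd p \<noteq> 1" by (cases p) (auto simp: affine_points_def char2)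
    then show "p \<in> {(x, y) \<in> affine_points. g (rot (vec3 x y 1)) = 0}"
      using p rot_zero by (cases p) auto
  qed
  moreover have "infinite (affine_points - {(0, 1)})" using infinite_affine_points by simp
  ultimately have "infinite {(x, y) \<in> affine_points. g (rot (vec3 x y 1)) = 0}"
    using finite_subset by blast
  moreover have "(0, 1) \<in> affine_points" by (simp add: affine_points_def char2)
  ultimately have "g (rot (vec3 0 1 1)) = 0" by (rule form_vanishes_affine[OF rot])
  moreover have "rot (vec3 0 1 1) = vec3 0 1 (0::'k)" by (simp add: rot_def char2)
  ultimately have inf0: "g (vec3 0 1 0) = 0" by simp
  show ?thesis
    using P(1)
  proof (cases rule: curve_cases)
    case 1
    then show ?thesis using zero[OF P, of "vec3 0 1 0"] inf0 by (simp add: infpt_def)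
  next
    case (2 x y)
    then show ?thesis using zero[OF P, of "vec3 x y 1"] aff[of x y] by (simp add: affine_points_def)
  qed
qed

end

section \<open>Translations\<close>

lemma form_hform:
  assumes "\<And>i. form a (f i)" "\<And>i. form b (g i)"
  shows "form (2 * a + b) (\<lambda>u. hform (\<lambda>i. f i u) (\<lambda>i. g i u))"
  unfolding hform_def by (intro form_add form_mult form_power assms)

lemma form_chord:
  assumes "\<And>i. form a (f i)" "\<And>i. form b (g i)"
  shows "form (2 * a + 2 * b) (\<lambda>u. chord (\<lambda>i. f i u) (\<lambda>i. g i u) j)"
proof -
  have "form (2 * b + a + a) (\<lambda>u. hform (\<lambda>i. g i u) (\<lambda>i. f i u) * f j u)"
    by (intro form_mult form_hform assms)
  moreover have "form (2 * a + b + b) (\<lambda>u. hform (\<lambda>i. f i u) (\<lambda>i. g i u) * g j u)"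
    by (intro form_mult form_hform assms)
  ultimately show ?thesis unfolding chord_def
    by (intro form_add) (auto elim: form_degree_cong)
qed

lemma form_rot:
  assumes "\<And>i. form a (f i)"
  shows "form a (\<lambda>u. rot (\<lambda>i. f i u) j)" "form a (\<lambda>u. rot' (\<lambda>i. f i u) j)"
    "form a (\<lambda>u. negv (\<lambda>i. f i u) j)"
  unfolding rot_def rot'_def negv_def by (intro form_vec3 form_add assms)+

lemma form_chord':
  assumes "\<And>i. form a (f i)" "\<And>i. form b (g i)"
  shows "form (2 * a + 2 * b) (\<lambda>u. chord' (\<lambda>i. f i u) (\<lambda>i. g i u) j)"
  unfolding chord'_def by (intro form_chord form_rot assms)

context char_two
begin

lemma ell_add_chord:
  fixes v w :: "nat \<Rightarrow> 'k"
  assumes "v \<in> curve_vecs" "w \<in> curve_vecs" "chord v w \<noteq> (\<lambda>_. 0)"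
  shows "ell_add (proj_point v) (proj_point w) = proj_point (negv (chord v w))"
  unfolding ell_add_def star_chord[OF assms] by (intro neg_proj_point chord_in_curve_vecs assms)

lemma ell_add_chord':
  fixes v w :: "nat \<Rightarrow> 'k"
  assumes "v \<in> curve_vecs" "w \<in> curve_vecs" "chord' v w \<noteq> (\<lambda>_. 0)"
  shows "ell_add (proj_point v) (proj_point w) = proj_point (negv (chord' v w))"
  unfolding ell_add_def star_chord'[OF assms]
  using assms unfolding chord'_def by (intro neg_proj_point chord_in_curve_vecs rot_in_curve_vecs)

lemma translation_morphism:
  assumes "P \<in> (curve :: (nat, 'k) ppoint set)"
  shows "variety_morphism {..2} curve curve (ell_add P)"
proof (rule variety_morphismI[OF curve_subset])
  show "ell_add P ` curve \<subseteq> curve" using ell_add_in_curve assms by auto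
  obtain v where v: "v \<in> curve_vecs" "P = proj_point v" using assms by (auto simp: curve_def)
  fix R :: "(nat, 'k) ppoint" assume "R \<in> curve"
  then obtain w where w: "w \<in> curve_vecs" "R = proj_point w" by (auto simp: curve_def)
  show "\<exists>e s d G v. form e s \<and> (\<forall>j. form d (G j)) \<and> v \<in> R \<and> s v \<noteq> 0 \<and>
           (\<forall>Q\<in>curve. \<forall>v\<in>Q. s v \<noteq> 0 \<longrightarrow> ell_add P Q = proj_point (\<lambda>j. G j v))"
  proof (cases "chord v w = (\<lambda>_. 0)")
    case False
    then obtain i where i: "chord v w i \<noteq> 0" by auto
    show ?thesis
    proof (intro exI conjI allI ballI impI)
      show "form (2 * 0 + 2 * 1) (\<lambda>u. chord v u i)" by (intro form_chord form_const form_var)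
      show "form (2 * 0 + 2 * 1) (\<lambda>u. negv (chord v u) j)" for j
        by (intro form_chord form_rot(3) form_const form_var)
      show "w \<in> R" using w by simp
      show "chord v w i \<noteq> 0" by fact
      fix Q u assume "Q \<in> curve" "u \<in> Q" "chord v u i \<noteq> 0"
      then show "ell_add P Q = proj_point (negv (chord v u))"
        using v curveD[of Q u] ell_add_chord[of v u] by fastforce
    qed
  next
    case True
    then obtain i where i: "chord' v w i \<noteq> 0" using chord_or_chord'[OF v(1) w(1)] by auto
    show ?thesis
    proof (intro exI conjI allI ballI impI)
      show "form (2 * 0 + 2 * 1) (\<lambda>u. chord' v u i)" by (intro form_chord' form_const form_var)
      show "form (2 * 0 + 2 * 1) (\<lambda>u. negv (chord' v u) j)" for j
        by (intro form_chord' form_rot(3) form_const form_var)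
      show "w \<in> R" using w by simp
      show "chord' v w i \<noteq> 0" by fact
      fix Q u assume "Q \<in> curve" "u \<in> Q" "chord' v u i \<noteq> 0"
      then show "ell_add P Q = proj_point (negv (chord' v u))"
        using v curveD[of Q u] ell_add_chord'[of v u] by fastforce
    qed
  qed
qed

lemma morphisms_agree:
  fixes f g :: "(nat, 'k) ppoint \<Rightarrow> (nat, 'k) ppoint"
  assumes f: "variety_morphism {..2} curve curve f" and g: "variety_morphism {..2} curve curve g"
    and inf: "infinite {P \<in> curve. f P = g P}" and P: "P \<in> curve"
  shows "f P = g P"
proof -
  obtain v where v: "v \<in> P" using P curve_nonempty by blast
  from variety_morphismD[OF f curve_subset P v] obtain e s d G where F: "form e s" "\<forall>j. form d (G j)"
    "s v \<noteq> 0" "\<forall>Q\<in>curve. \<forall>w\<in>Q. s w \<noteq> 0 \<longrightarrow> f Q = proj_point (\<lambda>j. G j w)"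
    by (elim exE conjE)
  from variety_morphismD[OF g curve_subset P v] obtain e' s' d' G' where G: "form e' s'" "\<forall>j. form d' (G' j)"
    "s' v \<noteq> 0" "\<forall>Q\<in>curve. \<forall>w\<in>Q. s' w \<noteq> 0 \<longrightarrow> g Q = proj_point (\<lambda>j. G' j w)"
    by (elim exE conjE)
  have fP: "f P = proj_point (\<lambda>j. G j v)" and gP: "g P = proj_point (\<lambda>j. G' j v)"
    using F(3,4) G(3,4) P v by auto
  have "f P \<in> curve" "g P \<in> curve" using f g P unfolding variety_morphism_def by auto
  then have "(\<lambda>j. G j v) \<in> curve_vecs" "(\<lambda>j. G' j v) \<in> curve_vecs"
    using fP gP by (simp_all add: proj_point_in_curve)
  then have nz: "(\<lambda>j. G j v) \<noteq> (\<lambda>_. 0)" "(\<lambda>j. G' j v) \<noteq> (\<lambda>_. 0)" by (auto simp: curve_vecs_def)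
  have "G i v * G' j v = G j v * G' i v" for i j
  proof -
    \<comment> \<open>The minors test whether the two local formulas agree at \<open>u\<close>; the
      factor \<open>s u * s' u\<close> makes \<open>h\<close> vanish also where one of them is not
      valid.\<close>
    define h where "h = (\<lambda>u. s u * s' u * (G i u * G' j u - G j u * G' i u))"
    have "form (e + e' + (d + d')) h" unfolding h_def
      by (intro form_mult form_diff F(1) G(1) F(2)[rule_format] G(2)[rule_format])
    moreover have "infinite {P \<in> curve. \<forall>v\<in>P. h v = 0}"
    proof (rule infinite_super[OF _ inf], clarify)
      fix Q :: "(nat, 'k) ppoint" and u
      assume Q: "Q \<in> curve" "f Q = g Q" "u \<in> Q"
      show "h u = 0"
      proof (cases "s u = 0 \<or> s' u = 0")
        case False
        then have "proj_point (\<lambda>j. G j u) = proj_point (\<lambda>j. G' j u)" using F(4) G(4) Q by simp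
        then obtain c where "(\<lambda>j. G' j u) = (\<lambda>j. c * G j u)" by (auto simp: proj_point_eq_iff)
        then have "G' j u = c * G j u" for j by metis
        then show ?thesis by (simp add: h_def)
      qed (auto simp: h_def)
    qed
    ultimately have "h v = 0" by (rule form_vanishes[OF _ _ P v])
    then show ?thesis using F(3) G(3) by (simp add: h_def)
  qed
  then show ?thesis unfolding fP gP by (intro parallel_imp_proj_point_eq nz)
qed

lemma const_morphism:
  assumes "Q \<in> (curve :: (nat, 'k) ppoint set)"
  shows "variety_morphism {..2} curve curve (\<lambda>_. Q)"
proof (rule variety_morphismI[OF curve_subset])
  obtain w where w: "w \<in> curve_vecs" "Q = proj_point w" using assms by (auto simp: curve_def)
  fix P :: "(nat, 'k) ppoint" assume "P \<in> curve"
  then obtain v where v: "v \<in> P" using curve_nonempty by blast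
  show "\<exists>e s d G v. form e s \<and> (\<forall>j. form d (G j)) \<and> v \<in> P \<and> s v \<noteq> 0 \<and>
           (\<forall>R\<in>curve. \<forall>v\<in>R. s v \<noteq> 0 \<longrightarrow> Q = proj_point (\<lambda>j. G j v))"
    by (rule exI[of _ 0], rule exI[of _ "\<lambda>_. 1"], rule exI[of _ 0], rule exI[of _ "\<lambda>j _. w j"],
        rule exI[of _ v]) (use v w in \<open>auto intro: form_const\<close>)
qed (use assms in auto)

lemma infinite_curve: "infinite (curve :: (nat, 'k) ppoint set)"
proof -
  have "inj_on (\<lambda>(x, y). pt x y) affine_points" by (auto simp: inj_on_def pt_eq_iff)
  then have "infinite ((\<lambda>(x, y). pt x y) ` affine_points)"
    using infinite_affine_points finite_image_iff by blast
  then show ?thesis unfolding curve_eq by simp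
qed

lemma ell_add_infpt: "P \<in> curve \<Longrightarrow> ell_add infpt P = (P :: (nat, 'k) ppoint)"
  unfolding ell_add_def by (simp add: star_infpt neg_neg)

lemma neg_infpt: "neg infpt = (infpt :: (nat, 'k) ppoint)"
  unfolding infpt_def by (simp add: neg_proj_point curve_vecs_vec3) (simp add: negv_def)

lemma ell_add_neg: "P \<in> curve \<Longrightarrow> ell_add P (neg P) = (infpt :: (nat, 'k) ppoint)"
  unfolding ell_add_def by (simp add: star_neg neg_infpt)

text \<open>Injectivity of translations would need associativity, whose proof relies on this lemma.
  Instead, an infinite fibre would make the translation constant by \<open>morphisms_agree\<close>,
  but it takes the value \<open>P\<close> at \<open>infpt\<close> and the value \<open>infpt\<close>
  at \<open>neg P\<close>.\<close>

lemma finite_ell_add_fiber: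
  assumes P: "P \<in> (curve :: (nat, 'k) ppoint set)" "P \<noteq> infpt"
  shows "finite {R \<in> curve. ell_add P R = Q}"
proof (cases "Q \<in> curve")
  case True
  show ?thesis
  proof (rule ccontr)
    assume inf: "\<not> ?thesis"
    have eq: "ell_add P R = Q" if "R \<in> curve" for R
      by (rule morphisms_agree[OF translation_morphism[OF P(1)] const_morphism[OF True] inf that])
    have "P = Q" using eq[OF infpt_in_curve] ell_add_commute[OF P(1) infpt_in_curve] ell_add_infpt[OF P(1)] by simp
    then show False using eq[OF neg_in_curve[OF P(1)]] ell_add_neg[OF P(1)] P(2) by simp
  qed
next
  case False
  then have "{R \<in> curve. ell_add P R = Q} = {}" using ell_add_in_curve[OF P(1)] by auto
  then show ?thesis by (simp only: finite.emptyI)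
qed

lemma finite_line:
  assumes "b \<noteq> 0 \<or> a \<noteq> (0::'k)"
  shows "finite {(x, y) \<in> affine_points. b * y + a * x + c = 0}"
proof (rule ccontr)
  assume inf: "\<not> ?thesis"
  define g where "g = (\<lambda>v::nat \<Rightarrow> 'k. b * v 1 + a * v 0 + c * v 2)"
  have g: "form 1 g" unfolding g_def by (intro form_add form_cmult form_var)
  have "g (vec3 x y 1) = 0" if "(x, y) \<in> affine_points" for x y
    by (rule form_vanishes_affine[OF g _ that]) (use inf in \<open>simp add: g_def\<close>)
  \<comment> \<open>Three points of the curve that are not collinear.\<close>
  from this[of 0 0] this[of 0 1] this[of 1 \<omega>] show False
    using assms by (auto simp: g_def affine_points_def char2 omega_mult algebra_simps)
qed

end

section \<open>Associativity\<close>

context char_two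
begin

lemma affine_points_cubic:
  assumes "(x, y) \<in> affine_points"
  shows "x * (x * x) = y + y * y" "x * (x * (x * t)) = y * t + y * (y * t)"
proof -
  show 1: "x * (x * x) = y + y * y"
    using assms by (simp add: affine_points_def powers algebra_simps)
  show "x * (x * (x * t)) = y * t + y * (y * t)"
    using arg_cong[OF 1, of "\<lambda>u. u * t"] by (simp add: algebra_simps)
qed

text \<open>The classical secant formula: the abscissas of the three points on a line of slope
  \<open>l\<close> add up to \<open>l\<^sup>2\<close>. The factor between the projective and the
  affine coordinates is the cube of \<open>x1 + x2\<close>.\<close>

lemma star_affine:
  assumes 1: "(x1, y1) \<in> affine_points" and 2: "(x2, y2) \<in> affine_points" and "x1 \<noteq> x2"
    and l: "y1 + y2 = l * (x1 + x2)" and x: "x = l\<^sup>2 + x1 + x2"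
  shows "star (pt x1 y1) (pt x2 y2) = pt x (l * (x + x1) + y1)"
proof -
  have v: "vec3 x1 y1 1 \<in> curve_vecs" "vec3 x2 y2 1 \<in> curve_vecs"
    using 1 2 by (auto simp: affine_points_def curve_vecs_vec3)
  define d e where "d = x1 + x2" and "e = y1 + y2"
  have d: "d \<noteq> 0" using assms(3) by (simp add: d_def char2)
  have e: "e = l * d" using l by (simp add: d_def e_def)
  note s = powers algebra_simps char2 affine_points_cubic[OF 1] affine_points_cubic[OF 2]
  have c: "chord (vec3 x1 y1 1) (vec3 x2 y2 1) 0 = d * e\<^sup>2 + d ^ 4"
    "chord (vec3 x1 y1 1) (vec3 x2 y2 1) 1 = e ^ 3 + e * d ^ 3 + d\<^sup>2 * e * x1 + d ^ 3 * y1"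
    "chord (vec3 x1 y1 1) (vec3 x2 y2 1) 2 = d ^ 3"
    unfolding d_def e_def by (simp_all add: chord_def hform_def s)
  have xd: "x = l\<^sup>2 + d" using x by (simp add: d_def add.assoc)
  have "chord (vec3 x1 y1 1) (vec3 x2 y2 1) = vec3 (d ^ 3 * x) (d ^ 3 * (l * (x + x1) + y1)) (d ^ 3 * 1)"
  proof (subst vec3_eq_iff, intro conjI allI impI)
    show "chord (vec3 x1 y1 1) (vec3 x2 y2 1) i = 0" if "i > 2" for i
      using that by (simp add: chord_def)
  qed (unfold c e xd powers, simp_all add: algebra_simps)
  then have eq: "chord (vec3 x1 y1 1) (vec3 x2 y2 1) = (\<lambda>i. d ^ 3 * vec3 x (l * (x + x1) + y1) 1 i)"
    by (simp add: vec3_scale)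
  have "chord (vec3 x1 y1 1) (vec3 x2 y2 1) \<noteq> (\<lambda>_. 0)" using c(3) d by auto
  from star_chord[OF v this] show ?thesis unfolding eq using d by simp
qed

lemma neg_pt: "(x, y) \<in> affine_points \<Longrightarrow> neg (pt x y) = pt x (y + 1)"
  by (simp add: neg_proj_point curve_vecs_vec3 affine_points_def) (simp add: negv_def)

lemma affine_points_iff_curve: "(x, y) \<in> affine_points \<longleftrightarrow> pt x y \<in> curve"
  by (simp add: affine_points_def pt_in_curve)

text \<open>The conic \<open>y = y1 + l (x + x1) + \<alpha> (x + x1) (x + x2)\<close> passes through the three given points.
  Its fourth intersection with the curve has abscissa \<open>\<beta>\<^sup>2 + x1 + x2 + x3\<close>, which is symmetric in the
  three points; this is what makes the group law associative.\<close>

lemma star_ell_add_affine: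
  assumes 1: "(x1, y1) \<in> affine_points" and 2: "(x2, y2) \<in> affine_points" and 3: "(x3, y3) \<in> affine_points"
    and ne: "x1 \<noteq> x2" "x1 \<noteq> x3" "x2 \<noteq> x3" "l\<^sup>2 + x1 + x2 \<noteq> x3"
    and l: "y1 + y2 = l * (x1 + x2)" and \<alpha>: "y3 = y1 + l * (x3 + x1) + \<alpha> * (x3 + x1) * (x3 + x2)"
    and \<beta>: "\<alpha> * \<beta> = 1" and X: "X = \<beta>\<^sup>2 + x1 + x2 + x3"
  shows "star (ell_add (pt x1 y1) (pt x2 y2)) (pt x3 y3) = pt X ((l + \<beta>) * (X + x3) + y3)"
proof -
  define xS where "xS = l\<^sup>2 + x1 + x2"
  define yS where "yS = l * (xS + x1) + y1"
  have S: "star (pt x1 y1) (pt x2 y2) = pt xS yS"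
    unfolding yS_def by (rule star_affine[OF 1 2 ne(1) l xS_def])
  have pS: "(xS, yS) \<in> affine_points"
    using star_in_curve 1 2 S by (metis affine_points_iff_curve)
  then have pS': "(xS, yS + 1) \<in> affine_points"
    by (metis neg_pt neg_in_curve affine_points_iff_curve)
  \<comment> \<open>The vertical distance of the third point from the secant through the first
    two.\<close>
  define u where "u = \<alpha> * (x3 + x1) * (x3 + x2)"
  have u: "u = y3 + l * (x3 + x1) + y1" unfolding u_def \<alpha> by (simp add: algebra_simps char2)
  have y2: "y2 = y1 + l * (x1 + x2)" using l by (metis char2(2))
  \<comment> \<open>The difference of the curve equations at the first two points; dividing by
    \<open>x1 + x2\<close> gives the relation \<open>ll\<close>, which eliminates the linear
    occurrence of \<open>l\<close>.\<close>
  have "(x1 + x2) * (l\<^sup>2 * (x1 + x2) + l) = (x1 + x2) * (x1\<^sup>2 + x1 * x2 + x2\<^sup>2)"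
    using 2 unfolding y2 affine_points_def
    by (simp add: powers algebra_simps char2 affine_points_cubic[OF 1])
  then have "l\<^sup>2 * (x1 + x2) + l = x1\<^sup>2 + x1 * x2 + x2\<^sup>2" using ne(1) by (simp add: char2)
  then have ll: "l = l\<^sup>2 * (x1 + x2) + x1\<^sup>2 + x1 * x2 + x2\<^sup>2"
    by (metis char2(2) add.assoc add.commute)
  \<comment> \<open>This is the value at \<open>x3\<close> of the cubic polynomial that describes
    the intersection of the secant with the curve; its roots are \<open>x1\<close>,
    \<open>x2\<close> and \<open>xS\<close>.\<close>
  have "u * (u + 1) = (x3 + x1) * (x3\<^sup>2 + x3 * x1 + x1\<^sup>2 + l\<^sup>2 * (x3 + x1) + l)"
    unfolding u by (simp add: powers algebra_simps char2 affine_points_cubic[OF 1] affine_points_cubic[OF 3])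
  also have "\<dots> = (x3 + x1) * (x3\<^sup>2 + x3 * x1 + x1\<^sup>2 + l\<^sup>2 * (x3 + x1) +
      (l\<^sup>2 * (x1 + x2) + x1\<^sup>2 + x1 * x2 + x2\<^sup>2))"
    using ll by simp
  also have "\<dots> = (x3 + x1) * (x3 + x2) * (x3 + xS)"
    unfolding xS_def by (simp add: powers algebra_simps char2)
  finally have "(x3 + x1) * (x3 + x2) * (\<alpha> * (u + 1)) = (x3 + x1) * (x3 + x2) * (x3 + xS)"
    unfolding u_def by (simp add: mult_ac)
  then have "\<alpha> * (u + 1) = x3 + xS" using ne by (simp add: char2)
  then have "u + 1 = \<beta> * (x3 + xS)" using \<beta> by (metis mult.assoc mult.commute mult_1)
  then have slope: "yS + 1 + y3 = (l + \<beta>) * (xS + x3)"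
  proof -
    have "yS + 1 + y3 = l * (xS + x3) + (u + 1)"
      unfolding yS_def u by (simp add: algebra_simps char2)
    then show ?thesis using \<open>u + 1 = \<beta> * (x3 + xS)\<close> by (simp add: algebra_simps)
  qed
  have X': "X = (l + \<beta>)\<^sup>2 + xS + x3" unfolding X xS_def by (simp add: powers algebra_simps char2)
  have "star (pt xS (yS + 1)) (pt x3 y3) = star (pt x3 y3) (pt xS (yS + 1))"
    using pS' 3 by (intro star_commute) (simp_all add: affine_points_iff_curve)
  also have "\<dots> = pt X ((l + \<beta>) * (X + x3) + y3)"
  proof (rule star_affine[OF 3 pS'])
    show "x3 \<noteq> xS" using ne xS_def by auto
    show "y3 + (yS + 1) = (l + \<beta>) * (x3 + xS)" using slope by (simp add: add_ac)
    show "X = (l + \<beta>)\<^sup>2 + x3 + xS" using X' by (simp add: add_ac)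
  qed
  finally show ?thesis unfolding ell_add_def S using neg_pt[OF pS] by simp
qed

lemma ell_add_assoc_affine:
  assumes 1: "(x1, y1) \<in> affine_points" and 2: "(x2, y2) \<in> affine_points" and 3: "(x3, y3) \<in> affine_points"
    and ne: "x1 \<noteq> x2" "x1 \<noteq> x3" "x2 \<noteq> x3" "l\<^sup>2 + x1 + x2 \<noteq> x3" "l'\<^sup>2 + x2 + x3 \<noteq> x1" "l \<noteq> l'"
    and l: "y1 + y2 = l * (x1 + x2)" and l': "y2 + y3 = l' * (x2 + x3)"
  shows "ell_add (ell_add (pt x1 y1) (pt x2 y2)) (pt x3 y3) = ell_add (pt x1 y1) (ell_add (pt x2 y2) (pt x3 y3))"
proof -
  \<comment> \<open>The second divided difference of the three points. It does not depend on their
    order, so both bracketings lead to the same conic, and it is nonzero because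
    \<open>l \<noteq> l'\<close> says that the points are not collinear.\<close>
  define \<alpha> where "\<alpha> = (l + l') / (x1 + x3)"
  have x13: "x1 + x3 \<noteq> 0" using ne by (simp add: char2)
  have \<alpha>: "\<alpha> * (x1 + x3) = l + l'" using x13 by (simp add: \<alpha>_def)
  have "l + l' \<noteq> 0" using ne by (simp add: char2)
  then have "\<alpha> \<noteq> 0" using x13 by (simp add: \<alpha>_def)
  define \<beta> where "\<beta> = 1 / \<alpha>"
  have \<beta>: "\<alpha> * \<beta> = 1" using \<open>\<alpha> \<noteq> 0\<close> by (simp add: \<beta>_def)
  have y2: "y2 = y1 + l * (x1 + x2)" using l by (metis char2(2))
  have y3: "y3 = y2 + l' * (x2 + x3)" using l' by (metis char2(2))
  have L': "l' = l + \<alpha> * (x1 + x3)" using \<alpha> by (metis char2(2))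
  define X where "X = \<beta>\<^sup>2 + x1 + x2 + x3"
  have "star (ell_add (pt x1 y1) (pt x2 y2)) (pt x3 y3) = pt X ((l + \<beta>) * (X + x3) + y3)"
    by (rule star_ell_add_affine[OF 1 2 3 ne(1-4) l _ \<beta> X_def])
      (unfold y3 y2 L', simp add: algebra_simps char2)
  moreover have "star (ell_add (pt x2 y2) (pt x3 y3)) (pt x1 y1) = pt X ((l' + \<beta>) * (X + x1) + y1)"
    by (rule star_ell_add_affine[OF 2 3 1 ne(3) _ _ ne(5) l' _ \<beta>])
      (use ne in \<open>simp_all add: X_def add_ac\<close>, unfold y2 L', simp add: algebra_simps char2)
  moreover have "(l + \<beta>) * (X + x3) + y3 = (l' + \<beta>) * (X + x1) + y1"
  proof -
    have \<beta>': "\<alpha> * (\<beta> * t) = t" "\<beta> * (\<alpha> * t) = t" "\<beta> * \<alpha> = 1" for t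
      using \<beta> by (simp_all add: mult.left_commute[of \<beta>] mult.commute[of \<beta>] flip: mult.assoc)
    show ?thesis unfolding y3 y2 L' X_def powers
      by (simp add: algebra_simps char2 \<beta> \<beta>')
  qed
  ultimately have "star (ell_add (pt x1 y1) (pt x2 y2)) (pt x3 y3) = star (ell_add (pt x2 y2) (pt x3 y3)) (pt x1 y1)"
    by simp
  then have "ell_add (ell_add (pt x1 y1) (pt x2 y2)) (pt x3 y3) = ell_add (ell_add (pt x2 y2) (pt x3 y3)) (pt x1 y1)"
    by (simp add: ell_add_def)
  also have "\<dots> = ell_add (pt x1 y1) (ell_add (pt x2 y2) (pt x3 y3))"
    using 1 2 3 by (intro ell_add_commute ell_add_in_curve) (simp_all add: affine_points_iff_curve)
  finally show ?thesis .
qed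

lemma ell_add_assoc_1:
  assumes 1: "(x1, y1) \<in> affine_points" and 2: "(x2, y2) \<in> affine_points" and ne: "x1 \<noteq> x2"
    and R: "R \<in> curve"
  shows "ell_add (ell_add (pt x1 y1) (pt x2 y2)) R = ell_add (pt x1 y1) (ell_add (pt x2 y2) R)"
proof -
  have P: "pt x1 y1 \<in> curve" and Q: "pt x2 y2 \<in> curve" using 1 2 by (simp_all add: affine_points_iff_curve)
  define l where "l = (y1 + y2) / (x1 + x2)"
  have "x1 + x2 \<noteq> 0" using ne by (simp add: char2)
  then have l: "y1 + y2 = l * (x1 + x2)" by (simp add: l_def)
  let ?L = "\<lambda>b a c. (\<lambda>(x, y). pt x y) ` {(x, y) \<in> affine_points. b * y + a * x + c = 0}"
  \<comment> \<open>Excluded are the points \<open>R\<close> at infinity, those with the abscissa of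
    one of the given points or of their \<open>star\<close>, those on the secant through the given
    points, and those for which the sum with the second point has abscissa
    \<open>x1\<close>.\<close>
  define bad where "bad = insert infpt (?L 0 1 x1 \<union> ?L 0 1 x2 \<union> ?L 0 1 (l\<^sup>2 + x1 + x2) \<union>
    ?L 1 l (y2 + l * x2) \<union> (\<Union>y\<in>{y. (x1, y) \<in> affine_points}. {R \<in> curve. ell_add (pt x2 y2) R = pt x1 y}))"
  have "finite bad" unfolding bad_def
    by (intro finite.insertI finite_UnI finite_imageI finite_line finite_UN_I finite_affine_fiber
        finite_ell_add_fiber Q pt_neq_infpt) simp_all
  then have "infinite (curve - bad)" using infinite_curve by simp
  moreover have "curve - bad \<subseteq> {R \<in> curve. ell_add (ell_add (pt x1 y1) (pt x2 y2)) R =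
      ell_add (pt x1 y1) (ell_add (pt x2 y2) R)}"
  proof
    fix R :: "(nat, 'k) ppoint" assume R: "R \<in> curve - bad"
    then have "R \<in> curve" by simp
    then show "R \<in> {R \<in> curve. ell_add (ell_add (pt x1 y1) (pt x2 y2)) R =
      ell_add (pt x1 y1) (ell_add (pt x2 y2) R)}"
    proof (cases rule: curve_cases)
      case 1
      then show ?thesis using R by (simp add: bad_def)
    next
      case (2 x3 y3)
      then have 3: "(x3, y3) \<in> affine_points" by (simp add: affine_points_def)
      have nL: "b * y3 + a * x3 + c \<noteq> 0" if "?L b a c \<subseteq> bad" for a b c
        using that R 2 3 by auto
      have x31: "x1 \<noteq> x3" and x32: "x2 \<noteq> x3" and xS: "l\<^sup>2 + x1 + x2 \<noteq> x3" and
        lin: "1 * y3 + l * x3 + (y2 + l * x2) \<noteq> 0"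
        using nL[of 0 1 x1] nL[of 0 1 x2] nL[of 0 1 "l\<^sup>2 + x1 + x2"] nL[of 1 l "y2 + l * x2"]
        unfolding bad_def by (auto simp: char2)
      define l' where "l' = (y2 + y3) / (x2 + x3)"
      have "x2 + x3 \<noteq> 0" using x32 by (simp add: char2)
      then have l': "y2 + y3 = l' * (x2 + x3)" by (simp add: l'_def)
      have "l \<noteq> l'"
      proof
        assume "l = l'"
        have "1 * y3 + l * x3 + (y2 + l * x2) = (y2 + y3) + l * (x2 + x3)"
          by (simp add: algebra_simps)
        also have "\<dots> = 0" using l' \<open>l = l'\<close> by (simp only: char2)
        finally show False using lin by simp
      qed
      have S: "star (pt x2 y2) (pt x3 y3) = pt (l'\<^sup>2 + x2 + x3) (l' * (l'\<^sup>2 + x2 + x3 + x2) + y2)"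
        by (rule star_affine[OF assms(2) 3 x32 l' refl])
      then have pS: "(l'\<^sup>2 + x2 + x3, l' * (l'\<^sup>2 + x2 + x3 + x2) + y2) \<in> affine_points"
        using star_in_curve[of "pt x2 y2" "pt x3 y3"] Q 3 by (simp add: affine_points_iff_curve)
      have "l'\<^sup>2 + x2 + x3 \<noteq> x1"
      proof
        assume *: "l'\<^sup>2 + x2 + x3 = x1"
        have e: "ell_add (pt x2 y2) R = pt x1 (l' * (x1 + x2) + y2 + 1)"
          unfolding ell_add_def 2(1) S using neg_pt[OF pS] * by simp
        moreover have "ell_add (pt x2 y2) R \<in> curve" using Q \<open>R \<in> curve\<close> by (rule ell_add_in_curve)
        ultimately have "R \<in> bad" unfolding bad_def using \<open>R \<in> curve\<close>
          by (auto simp: affine_points_iff_curve)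
        then show False using R by simp
      qed
      then show ?thesis using ell_add_assoc_affine[OF assms(1,2) 3 ne x31 x32 xS _ \<open>l \<noteq> l'\<close> l l']
          \<open>R \<in> curve\<close> 2(1) by simp
    qed
  qed
  ultimately have inf: "infinite {R \<in> curve. ell_add (ell_add (pt x1 y1) (pt x2 y2)) R =
      ell_add (pt x1 y1) (ell_add (pt x2 y2) R)}" using infinite_super by blast
  show ?thesis
    by (rule morphisms_agree[OF translation_morphism variety_morphism_compose[OF translation_morphism
        translation_morphism] inf R]) (use P Q ell_add_in_curve curve_subset in auto)
qed

text \<open>Density is applied twice more, in the middle argument and in the first one. Translations
  act on the right argument of \<open>ell_add\<close>, so commutativity moves the varying point
  there.\<close>

lemma ell_add_assoc:
  assumes P: "P \<in> (curve :: (nat, 'k) ppoint set)" and Q: "Q \<in> curve" and R: "R \<in> curve"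
  shows "ell_add (ell_add P Q) R = ell_add P (ell_add Q R)"
proof -
  have cm: "ell_add A B = ell_add B A" if "A \<in> curve" "B \<in> curve" for A B :: "(nat, 'k) ppoint"
    using that by (rule ell_add_commute)
  note cl = ell_add_in_curve
  have comp: "variety_morphism {..2} curve curve (\<lambda>Q. ell_add A (ell_add B Q))"
    if "A \<in> curve" "B \<in> curve" for A B :: "(nat, 'k) ppoint"
    by (rule variety_morphism_compose[OF translation_morphism translation_morphism])
      (use that curve_subset in auto)
  have step2: "ell_add R (ell_add (pt x1 y1) Q) = ell_add (pt x1 y1) (ell_add R Q)"
    if 1: "(x1, y1) \<in> affine_points" and Q: "Q \<in> curve" for x1 y1 Q
  proof -
    have P: "pt x1 y1 \<in> curve" using 1 by (simp add: affine_points_iff_curve)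
    let ?L = "(\<lambda>(x, y). pt x y) ` {(x, y) \<in> affine_points. 0 * y + 1 * x + x1 = 0}"
    have "finite (insert infpt ?L)" by (intro finite.insertI finite_imageI finite_line) simp
    then have "infinite (curve - insert infpt ?L)" using infinite_curve by simp
    then have inf: "infinite {Q \<in> curve. ell_add R (ell_add (pt x1 y1) Q) = ell_add (pt x1 y1) (ell_add R Q)}"
    proof (rule infinite_super[rotated], intro subsetI)
      fix Q :: "(nat, 'k) ppoint" assume "Q \<in> curve - insert infpt ?L"
      then have Q: "Q \<in> curve" "Q \<noteq> infpt" "Q \<notin> ?L" by auto
      from Q(1) have "ell_add R (ell_add (pt x1 y1) Q) = ell_add (pt x1 y1) (ell_add R Q)"
      proof (cases rule: curve_cases)
        case (2 x2 y2)
        then have 22: "(x2, y2) \<in> affine_points" by (simp add: affine_points_def)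
        then have "x1 \<noteq> x2" using 2 Q(3) by (auto simp: char2)
        from ell_add_assoc_1[OF 1 22 this R] show ?thesis
          using 2 Q P R cm cl by metis
      qed (use Q in simp)
      then show "Q \<in> {Q \<in> curve. ell_add R (ell_add (pt x1 y1) Q) = ell_add (pt x1 y1) (ell_add R Q)}"
        using Q(1) by simp
    qed
    show ?thesis by (rule morphisms_agree[OF comp[OF R P] comp[OF P R] inf Q])
  qed
  have "ell_add R (ell_add Q P) = ell_add (ell_add R Q) P"
  proof (rule morphisms_agree[OF comp translation_morphism _ P])
    have "infinite (curve - {infpt :: (nat, 'k) ppoint})" using infinite_curve by simp
    then show "infinite {P \<in> curve. ell_add R (ell_add Q P) = ell_add (ell_add R Q) P}"
    proof (rule infinite_super[rotated], intro subsetI)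
      fix P :: "(nat, 'k) ppoint" assume "P \<in> curve - {infpt}"
      then have P: "P \<in> curve" "P \<noteq> infpt" by auto
      from P(1) have "ell_add R (ell_add Q P) = ell_add (ell_add R Q) P"
      proof (cases rule: curve_cases)
        case (2 x1 y1)
        then have "(x1, y1) \<in> affine_points" by (simp add: affine_points_def)
        from step2[OF this Q] show ?thesis using 2 P Q R cm cl by metis
      qed (use P in simp)
      then show "P \<in> {P \<in> curve. ell_add R (ell_add Q P) = ell_add (ell_add R Q) P}"
        using P(1) by simp
    qed
  qed (use Q R cl in auto)
  then show ?thesis using P Q R cm cl by metis
qed

end

section \<open>The abelian variety structure\<close>

definition tensor :: "('i \<Rightarrow> 'k::field) \<Rightarrow> ('j \<Rightarrow> 'k) \<Rightarrow> 'i \<times> 'j \<Rightarrow> 'k" where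
  "tensor v w = (\<lambda>(i, j). v i * w j)"

lemma segre_proj_point: "segre (proj_point v) (proj_point w) = proj_point (tensor v w)"
proof (intro equalityI subsetI)
  fix u assume "u \<in> segre (proj_point v) (proj_point w)"
  then obtain c d where "c \<noteq> 0" "d \<noteq> 0" "u = (\<lambda>(i, j). (c * v i) * (d * w j))"
    by (auto simp: segre_def mem_proj_point)
  then show "u \<in> proj_point (tensor v w)" unfolding mem_proj_point
    by (intro exI[of _ "c * d"]) (auto simp: tensor_def)
next
  fix u assume "u \<in> proj_point (tensor v w)"
  then obtain c where c: "c \<noteq> 0" "u = (\<lambda>i. c * tensor v w i)" by (auto simp: mem_proj_point)
  have "(\<lambda>i. c * v i) \<in> proj_point v" using c by (auto simp: mem_proj_point)
  moreover have "u = (\<lambda>(i, j). (c * v i) * w j)" using c by (auto simp: tensor_def)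
  ultimately show "u \<in> segre (proj_point v) (proj_point w)"
    unfolding segre_def mem_Collect_eq
    by (intro exI[of _ "\<lambda>i. c * v i"] exI[of _ w] conjI self_in_proj_point)
qed

lemma tensor_inject:
  assumes "tensor v w = (\<lambda>i. c * tensor v' w' i)" "w \<noteq> (\<lambda>_. 0)"
    "v \<noteq> (\<lambda>_. 0)" "v' \<noteq> (\<lambda>_. 0)"
  shows "proj_point v = proj_point v'"
proof (rule parallel_imp_proj_point_eq[OF assms(3,4)])
  fix i k
  obtain j where j: "w j \<noteq> 0" using assms(2) by auto
  have eq: "v i * w j = c * (v' i * w' j)" for i
    using fun_cong[OF assms(1), of "(i, j)"] by (simp add: tensor_def)
  have "(v i * v' k) * w j = (v k * v' i) * w j"
  proof -
    have "(v i * v' k) * w j = v' k * (v i * w j)" by (simp add: mult_ac)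
    also have "\<dots> = v' i * (v k * w j)" unfolding eq by (simp add: mult_ac)
    finally show ?thesis by (simp add: mult_ac)
  qed
  then show "v i * v' k = v k * v' i" using j by simp
qed

lemma segre_inject:
  assumes "segre P Q = segre P' Q'" "P \<in> curve" "Q \<in> curve" "P' \<in> curve" "Q' \<in> curve"
  shows "P = P' \<and> Q = Q'"
proof -
  obtain v w v' w' where vw: "v \<in> curve_vecs" "P = proj_point v" "w \<in> curve_vecs" "Q = proj_point w"
    "v' \<in> curve_vecs" "P' = proj_point v'" "w' \<in> curve_vecs" "Q' = proj_point w'"
    using assms by (auto simp: curve_def)
  have nz: "v \<noteq> (\<lambda>_. 0)" "w \<noteq> (\<lambda>_. 0)" "v' \<noteq> (\<lambda>_. 0)" "w' \<noteq> (\<lambda>_. 0)"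
    using vw by (auto simp: curve_vecs_def)
  have "proj_point (tensor v' w') = proj_point (tensor v w)"
    using assms(1) vw by (simp add: segre_proj_point)
  then obtain c where c: "tensor v w = (\<lambda>i. c * tensor v' w' i)" by (auto simp: proj_point_eq_iff)
  have "tensor w v = (\<lambda>i. c * tensor w' v' i)"
  proof
    fix i :: "nat \<times> nat"
    show "tensor w v i = c * tensor w' v' i"
      using fun_cong[OF c, of "(snd i, fst i)"] by (cases i) (simp add: tensor_def mult.commute)
  qed
  then show ?thesis using tensor_inject[OF c nz(2,1,3)] tensor_inject[of w v c w' v'] nz vw by simp
qed

lemma segre_product_curve_subset:
  "segre_product curve curve \<subseteq> proj_space ({..2} \<times> {..2})"
proof
  fix S :: "(nat \<times> nat, 'a) ppoint" assume "S \<in> segre_product curve curve"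
  then obtain v w where vw: "v \<in> curve_vecs" "w \<in> curve_vecs" "S = proj_point (tensor v w)"
    by (auto simp: segre_product_def curve_def segre_proj_point)
  then obtain i j where "v i \<noteq> 0" "w j \<noteq> 0" by (fastforce simp: curve_vecs_def)
  then have "tensor v w (i, j) \<noteq> 0" by (simp add: tensor_def)
  then show "S \<in> proj_space ({..2} \<times> {..2})" unfolding vw(3)
    by (rule proj_spaceI) (use vw in \<open>auto simp: tensor_def curve_vecs_def\<close>)
qed

text \<open>\<open>chord\<close> has bidegree (2, 2), so it is given by quadratic forms in the Segre
  coordinates. Together with the linear map \<open>tensor_rot\<close> this expresses both charts of
  the group law on the product.\<close>

definition tensor_chord :: "(nat \<times> nat \<Rightarrow> 'k::field) \<Rightarrow> nat \<Rightarrow> 'k" where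
  "tensor_chord u i = (u (0, 0) * u (i, 0) + u (1, 2) * u (i, 2) + u (2, 1) * u (i, 1)) +
    (u (0, 0) * u (0, i) + u (2, 1) * u (2, i) + u (1, 2) * u (1, i))"

definition tensor_rot :: "(nat \<times> nat \<Rightarrow> 'k::field) \<Rightarrow> nat \<times> nat \<Rightarrow> 'k" where
  "tensor_rot u = (\<lambda>(a, b). rot (\<lambda>k. rot' (\<lambda>j. u (k, j)) b) a)"

lemma tensor_chord_tensor: "tensor_chord (tensor v w) = chord v w"
  by (auto simp: tensor_chord_def tensor_def chord_def hform_def algebra_simps power2_eq_square)

lemma tensor_rot_tensor: "tensor_rot (tensor v w) = tensor (rot v) (rot' w)"
proof -
  have "rot (\<lambda>k. rot' (\<lambda>j. v k * w j) b) a = rot v a * rot' w b" for a b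
    using rot_scale(1)[of "rot' w b" v] by (simp add: rot_scale(2) mult.commute)
  then show ?thesis by (auto simp: tensor_rot_def tensor_def)
qed

lemma form_tensor_chord:
  assumes "\<And>i. form d (f i)"
  shows "form (2 * d) (\<lambda>u. tensor_chord (\<lambda>i. f i u) j)"
proof -
  have "form (d + d) (\<lambda>u. tensor_chord (\<lambda>i. f i u) j)"
    unfolding tensor_chord_def by (intro form_add form_mult assms)
  then show ?thesis by (simp add: mult_2)
qed

lemma form_tensor_rot: "form 1 (\<lambda>u. tensor_rot u i)"
  unfolding tensor_rot_def by (cases i) (auto intro!: form_rot form_var[unfolded One_nat_def])

context char_two
begin

definition ell_group :: "(nat, 'k) ppoint monoid" where
  "ell_group = \<lparr>carrier = curve, monoid.mult = ell_add, one = infpt\<rparr>"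

lemma ell_group_simps [simp]:
  "carrier ell_group = curve" "monoid.mult ell_group = ell_add" "one ell_group = infpt"
  by (simp_all add: ell_group_def)

lemma group_ell_group: "group ell_group"
proof (rule groupI)
  show "\<exists>Q\<in>carrier ell_group. Q \<otimes>\<^bsub>ell_group\<^esub> P = \<one>\<^bsub>ell_group\<^esub>" if "P \<in> carrier ell_group" for P
    using that ell_add_neg[of P] ell_add_commute[of P "neg P"] neg_in_curve[of P]
    by (intro bexI[of _ "neg P"]) auto
qed (auto simp: ell_add_in_curve infpt_in_curve ell_add_assoc ell_add_infpt)

lemma inv_ell_group:
  assumes "P \<in> curve"
  shows "inv\<^bsub>ell_group\<^esub> P = neg P"
proof (rule group.inv_equality[OF group_ell_group])
  show "neg P \<otimes>\<^bsub>ell_group\<^esub> P = \<one>\<^bsub>ell_group\<^esub>"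
    using assms ell_add_neg ell_add_commute[OF assms neg_in_curve[OF assms]] by simp
qed (use assms neg_in_curve in auto)

section \<open>The curve as a projective variety and its operations as morphisms\<close>

lemma zariski_closed_curve: "zariski_closed {..2} (curve :: (nat, 'k) ppoint set)"
proof -
  define g where "g = (\<lambda>v :: nat \<Rightarrow> 'k. v 0 ^ 3 + v 1 * v 2 * (v 1 + v 2))"
  have "form (3 * 1) (\<lambda>v :: nat \<Rightarrow> 'k. v 0 ^ 3)" by (intro form_power form_var)
  moreover have "form (1 + 1 + 1) (\<lambda>v :: nat \<Rightarrow> 'k. v 1 * v 2 * (v 1 + v 2))"
    by (intro form_mult form_var form_add)
  ultimately have "form 3 g" unfolding g_def by (intro form_add) (simp_all add: numeral_3_eq_3)
  moreover have "curve = {P \<in> proj_space {..2}. \<forall>v\<in>P. g v = 0}"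
  proof (intro equalityI subsetI)
    fix P assume "P \<in> (curve :: (nat, 'k) ppoint set)"
    then show "P \<in> {P \<in> proj_space {..2}. \<forall>v\<in>P. g v = 0}"
      using curve_subset curveD(1)[of P] by (auto simp: g_def curve_vecs_def char2)
  next
    fix P assume P: "P \<in> {P \<in> proj_space {..2}. \<forall>v\<in>P. g v = 0}"
    then obtain v where v: "v \<in> P" using proj_space_nonempty by blast
    from proj_spaceE[of P "{..2}", OF _ v] P have "P = proj_point v" "\<exists>i. v i \<noteq> 0" "\<forall>i>2. v i = 0"
      by auto
    moreover have "g v = 0" using P v by auto
    ultimately have "v \<in> curve_vecs" by (auto simp: curve_vecs_def g_def char2)
    then show "P \<in> curve" using \<open>P = proj_point v\<close> by (simp add: proj_point_in_curve)
  qed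
  ultimately show ?thesis using zariski_closed_form[of 3 g "{..2}"] by (simp only:)
qed

text \<open>By \<open>form_vanishes\<close> a closed set that does not contain the curve meets it in
  finitely many points, and two such sets cannot cover an infinite curve.\<close>

lemma zariski_irreducible_curve: "zariski_irreducible {..2} (curve :: (nat, 'k) ppoint set)"
  unfolding zariski_irreducible_def
proof (intro conjI allI impI)
  show "(curve :: (nat, 'k) ppoint set) \<noteq> {}" using infpt_in_curve by auto
  fix Z1 Z2 :: "(nat, 'k) ppoint set"
  assume Z: "zariski_closed {..2} Z1" "zariski_closed {..2} Z2" "curve \<subseteq> Z1 \<union> Z2"
  show "curve \<subseteq> Z1 \<or> curve \<subseteq> Z2"
  proof (rule ccontr)
    assume "\<not> ?thesis"
    then obtain P Q where P: "P \<in> curve" "P \<notin> Z1" and Q: "Q \<in> curve" "Q \<notin> Z2" by auto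
    obtain d g v where g: "form d g" "v \<in> P" "g v \<noteq> 0" "\<forall>Q\<in>Z1. \<forall>w\<in>Q. g w = 0"
      using zariski_closed_separate[OF Z(1) subsetD[OF curve_subset P(1)] P(2)] by (elim exE conjE)
    obtain d' g' v' where g': "form d' g'" "v' \<in> Q" "g' v' \<noteq> 0" "\<forall>Q\<in>Z2. \<forall>w\<in>Q. g' w = 0"
      using zariski_closed_separate[OF Z(2) subsetD[OF curve_subset Q(1)] Q(2)] by (elim exE conjE)
    have "finite {P \<in> curve. \<forall>v\<in>P. g v = 0}"
      using form_vanishes[OF g(1) _ P(1) g(2)] g(3) by blast
    moreover have "finite {P \<in> curve. \<forall>v\<in>P. g' v = 0}"
      using form_vanishes[OF g'(1) _ Q(1) g'(2)] g'(3) by blast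
    moreover have "curve \<subseteq> {P \<in> curve. \<forall>v\<in>P. g v = 0} \<union> {P \<in> curve. \<forall>v\<in>P. g' v = 0}"
      using Z(3) g(4) g'(4) by blast
    ultimately have "finite (curve :: (nat, 'k) ppoint set)" by (meson finite_UnI finite_subset)
    then show False using infinite_curve by simp
  qed
qed

lemma neg_morphism: "variety_morphism {..2} (curve :: (nat, 'k) ppoint set) curve neg"
proof (rule variety_morphismI[OF curve_subset])
  fix P :: "(nat, 'k) ppoint" assume "P \<in> curve"
  then obtain v where v: "v \<in> P" using curve_nonempty by blast
  show "\<exists>e s d G v. form e s \<and> (\<forall>j. form d (G j)) \<and> v \<in> P \<and> s v \<noteq> 0 \<and>
           (\<forall>Q\<in>curve. \<forall>v\<in>Q. s v \<noteq> 0 \<longrightarrow> neg Q = proj_point (\<lambda>j. G j v))"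
  proof (intro exI conjI allI ballI impI)
    show "form 0 (\<lambda>_ :: nat \<Rightarrow> 'k. 1 :: 'k)" by (rule form_const)
    show "form 1 (\<lambda>u :: nat \<Rightarrow> 'k. negv u j)" for j by (intro form_rot(3) form_var)
    show "v \<in> P" by fact
    fix Q :: "(nat, 'k) ppoint" and u assume "Q \<in> curve" "u \<in> Q"
    then show "neg Q = proj_point (negv u)" using curveD[of Q u] neg_proj_point by simp
  qed simp
qed (use neg_in_curve in auto)

text \<open>By \<open>segre_inject\<close> the description under \<open>SOME\<close> fits exactly
  one point, the sum of the two factors.\<close>

definition segre_add :: "(nat \<times> nat, 'k) ppoint \<Rightarrow> (nat, 'k) ppoint" where
  "segre_add S = (SOME R. \<exists>P\<in>curve. \<exists>Q\<in>curve. S = segre P Q \<and> R = ell_add P Q)"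

lemma segre_add_segre:
  assumes "P \<in> curve" "Q \<in> curve"
  shows "segre_add (segre P Q) = ell_add P Q"
  unfolding segre_add_def
proof (rule some_equality)
  show "\<exists>P'\<in>curve. \<exists>Q'\<in>curve. segre P Q = segre P' Q' \<and> ell_add P Q = ell_add P' Q'"
    using assms by auto
next
  fix R assume "\<exists>P'\<in>curve. \<exists>Q'\<in>curve. segre P Q = segre P' Q' \<and> R = ell_add P' Q'"
  then show "R = ell_add P Q" using segre_inject assms by metis
qed

lemma segre_add_morphism:
  "variety_morphism ({..2} \<times> {..2}) (segre_product curve curve) curve segre_add"
proof (rule variety_morphismI[OF segre_product_curve_subset])
  show "segre_add ` segre_product curve curve \<subseteq> curve"
    by (auto simp: segre_product_def segre_add_segre ell_add_in_curve)
  have el: "\<exists>v w. v \<in> curve_vecs \<and> w \<in> curve_vecs \<and> u = tensor v w \<and>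
      segre_add S = ell_add (proj_point v) (proj_point w)"
    if S: "S \<in> segre_product curve curve" and u: "u \<in> S" for S u
  proof -
    obtain P Q where PQ: "P \<in> curve" "Q \<in> curve" "S = segre P Q"
      using S by (auto simp: segre_product_def)
    then obtain v w where vw: "v \<in> P" "w \<in> Q" "u = tensor v w"
      using u by (auto simp: segre_def tensor_def)
    then show ?thesis using PQ segre_add_segre curveD[OF PQ(1) vw(1)] curveD[OF PQ(2) vw(2)] by metis
  qed
  fix S :: "(nat \<times> nat, 'k) ppoint" assume S: "S \<in> segre_product curve curve"
  then obtain u where u: "u \<in> S" using segre_product_curve_subset proj_space_nonempty by blast
  from el[OF S u] obtain v w where vw: "v \<in> curve_vecs" "w \<in> curve_vecs" "u = tensor v w"
    by blast
  show "\<exists>e s d G v. form e s \<and> (\<forall>j. form d (G j)) \<and> v \<in> S \<and> s v \<noteq> 0 \<and>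
           (\<forall>Q\<in>segre_product curve curve. \<forall>v\<in>Q. s v \<noteq> 0 \<longrightarrow> segre_add Q = proj_point (\<lambda>j. G j v))"
  proof (cases "chord v w = (\<lambda>_. 0)")
    case False
    then obtain i where i: "chord v w i \<noteq> 0" by auto
    show ?thesis
    proof (intro exI conjI allI ballI impI)
      show "form (2 * 1) (\<lambda>u :: nat \<times> nat \<Rightarrow> 'k. tensor_chord u i)"
        by (intro form_tensor_chord form_var)
      show "form (2 * 1) (\<lambda>u :: nat \<times> nat \<Rightarrow> 'k. negv (tensor_chord u) j)" for j
        by (intro form_rot(3) form_tensor_chord form_var)
      show "u \<in> S" by fact
      show "tensor_chord u i \<noteq> 0" using i vw by (simp add: tensor_chord_tensor)
      fix Q :: "(nat \<times> nat, 'k) ppoint" and t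
      assume Q: "Q \<in> segre_product curve curve" "t \<in> Q" and nz: "tensor_chord t i \<noteq> 0"
      from el[OF Q] obtain v w where vw: "v \<in> curve_vecs" "w \<in> curve_vecs" "t = tensor v w"
        "segre_add Q = ell_add (proj_point v) (proj_point w)" by blast
      have "chord v w \<noteq> (\<lambda>_. 0)" using nz vw by (auto simp: tensor_chord_tensor)
      then show "segre_add Q = proj_point (negv (tensor_chord t))"
        using ell_add_chord[OF vw(1,2)] vw by (simp add: tensor_chord_tensor)
    qed
  next
    case True
    then obtain i where i: "chord' v w i \<noteq> 0" using chord_or_chord'[OF vw(1,2)] by auto
    have t: "tensor_chord (tensor_rot (tensor v w)) = chord' v w" for v w :: "nat \<Rightarrow> 'k"
      by (simp add: tensor_rot_tensor tensor_chord_tensor chord'_def)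
    show ?thesis
    proof (intro exI conjI allI ballI impI)
      show "form (2 * 1) (\<lambda>u :: nat \<times> nat \<Rightarrow> 'k. tensor_chord (tensor_rot u) i)"
        by (intro form_tensor_chord form_tensor_rot)
      show "form (2 * 1) (\<lambda>u :: nat \<times> nat \<Rightarrow> 'k. negv (tensor_chord (tensor_rot u)) j)" for j
        by (intro form_rot(3) form_tensor_chord form_tensor_rot)
      show "u \<in> S" by fact
      show "tensor_chord (tensor_rot u) i \<noteq> 0" using i vw by (simp add: t)
      fix Q :: "(nat \<times> nat, 'k) ppoint" and x
      assume Q: "Q \<in> segre_product curve curve" "x \<in> Q" and nz: "tensor_chord (tensor_rot x) i \<noteq> 0"
      from el[OF Q] obtain v w where vw: "v \<in> curve_vecs" "w \<in> curve_vecs" "x = tensor v w"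
        "segre_add Q = ell_add (proj_point v) (proj_point w)" by blast
      have "chord' v w \<noteq> (\<lambda>_. 0)" using nz vw by (auto simp: t)
      then show "segre_add Q = proj_point (negv (tensor_chord (tensor_rot x)))"
        using ell_add_chord'[OF vw(1,2)] vw by (simp add: t)
    qed
  qed
qed

lemma abelian_variety_ell_group: "abelian_variety 2 ell_group"
  unfolding abelian_variety_def projective_variety_def
proof (intro conjI)
  show "\<exists>\<mu>. variety_morphism ({..2} \<times> {..2}) (segre_product (carrier ell_group) (carrier ell_group))
      (carrier ell_group) \<mu> \<and>
      (\<forall>P\<in>carrier ell_group. \<forall>Q\<in>carrier ell_group. \<mu> (segre P Q) = P \<otimes>\<^bsub>ell_group\<^esub> Q)"
    using segre_add_morphism segre_add_segre by (intro exI[of _ segre_add]) simp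
  have "variety_morphism {..2} curve curve (\<lambda>P. inv\<^bsub>ell_group\<^esub> P)
      \<longleftrightarrow> variety_morphism {..2} (curve :: (nat, 'k) ppoint set) curve neg"
    unfolding variety_morphism_def by (simp add: inv_ell_group cong: image_cong_simp)
  then show "variety_morphism {..2} (carrier ell_group) (carrier ell_group) (\<lambda>P. inv\<^bsub>ell_group\<^esub> P)"
    using neg_morphism by simp
qed (simp_all add: zariski_closed_curve zariski_irreducible_curve group_ell_group)

end

section \<open>Lines on the Fermat cubic threefold\<close>

definition herm :: "(nat \<Rightarrow> 'k::field) \<Rightarrow> (nat \<Rightarrow> 'k) \<Rightarrow> 'k" where
  "herm a b = (\<Sum>n\<le>4. (a n)\<^sup>2 * b n)"

text \<open>By \<open>herm_add\<close> the four equations put every combination of \<open>a\<close>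
  and \<open>b\<close> on X.\<close>

definition fermat_line :: "(nat \<Rightarrow> 'k::field) \<Rightarrow> (nat \<Rightarrow> 'k) \<Rightarrow> bool" where
  "fermat_line a b \<longleftrightarrow> (\<forall>n>4. a n = 0 \<and> b n = 0) \<and> (\<exists>r s. a r * b s \<noteq> a s * b r) \<and>
     herm a a = 0 \<and> herm a b = 0 \<and> herm b a = 0 \<and> herm b b = 0"

definition minor :: "(nat \<Rightarrow> 'k::field) \<Rightarrow> (nat \<Rightarrow> 'k) \<Rightarrow> nat \<times> nat \<Rightarrow> 'k" where
  "minor a b = (\<lambda>(i, j). if i < j then a i * b j - a j * b i else 0)"

text \<open>Signs disappear in characteristic 2, so minors can be indexed by unordered pairs,
  whereas Pluecker vectors carry only the coordinates with increasing indices.\<close>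

definition pl :: "(nat \<times> nat \<Rightarrow> 'k) \<Rightarrow> nat \<Rightarrow> nat \<Rightarrow> 'k" where
  "pl \<pi> r s = \<pi> (min r s, max r s)"

lemma form_pl: "form 1 (\<lambda>\<pi>. pl \<pi> r s)"
  unfolding pl_def by (rule form_var)

context char_two
begin

lemma pl_minor: "pl (minor a b) r s = a r * b s + a s * (b r :: 'k)"
  by (cases r s rule: linorder_cases) (auto simp: pl_def minor_def char2 algebra_simps)

lemma herm_add: "herm (\<lambda>n. s * a n + t * b n) c = s\<^sup>2 * herm a c + t\<^sup>2 * herm b (c :: nat \<Rightarrow> 'k)"
  "herm c (\<lambda>n. s * a n + t * b n) = s * herm c a + t * herm c b"
proof -
  have "(s * x + t * y)\<^sup>2 = s\<^sup>2 * x\<^sup>2 + t\<^sup>2 * y\<^sup>2" for x y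
    unfolding powers by (simp add: algebra_simps char2)
  then show "herm (\<lambda>n. s * a n + t * b n) c = s\<^sup>2 * herm a c + t\<^sup>2 * herm b c"
    by (simp add: herm_def distrib_right sum.distrib sum_distrib_left mult.assoc)
  show "herm c (\<lambda>n. s * a n + t * b n) = s * herm c a + t * herm c b"
    by (simp add: herm_def distrib_left sum.distrib sum_distrib_left mult_ac)
qed

text \<open>A binary cubic form with zeros at (1 : 0), (0 : 1), (1 : 1) and (1 : \<omega>) is zero,
  and its coefficients are the four values of \<open>herm\<close>.\<close>

lemma fermat_line_pencil:
  assumes "\<And>s t. s \<noteq> 0 \<or> t \<noteq> 0 \<Longrightarrow> (\<Sum>n\<le>4. (s * a n + t * b n) ^ 3) = (0::'k)"
  shows "herm a a = 0" "herm a b = 0" "herm b a = 0" "herm b b = 0"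
proof -
  have "(\<Sum>n\<le>4. x n ^ 3) = herm x x" for x :: "nat \<Rightarrow> 'k"
    by (simp add: herm_def power3_eq_cube power2_eq_square)
  then have H: "s\<^sup>2 * (s * herm a a + t * herm a b) + t\<^sup>2 * (s * herm b a + t * herm b b) = 0"
    if "s \<noteq> 0 \<or> t \<noteq> 0" for s t
    using assms[OF that] by (simp add: herm_add)
  show 1: "herm a a = 0" "herm b b = 0" using H[of 1 0] H[of 0 1] by simp_all
  have 2: "herm a b = herm b a" using H[of 1 1] 1 by (simp add: char2)
  have "\<omega> * herm a b + \<omega>\<^sup>2 * herm b a = 0" using H[of 1 \<omega>] 1 by simp
  then show "herm b a = 0" unfolding 2 by (simp add: omega algebra_simps char2)
  then show "herm a b = 0" using 2 by simp
qed

lemma minor_comb: "minor (\<lambda>n. s * a n + t * b n) (\<lambda>n. s' * a n + t' * b n) =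
    (\<lambda>x. (s * t' + s' * t) * minor a b x :: 'k)"
  by (auto simp: minor_def algebra_simps char2)

lemma fermat_cubic_threefold_cubes:
  assumes "P \<in> fermat_cubic_threefold" "v \<in> P"
  shows "(\<Sum>n\<le>4. v n ^ 3) = (0::'k)"
proof -
  have "mpol_value v (\<Sum>n\<le>4. Poly_Mapping.single (Poly_Mapping.single n 3) 1) = (\<Sum>n\<le>4. v n ^ 3)"
    by (simp add: mpol_value_sum mpol_value_single monomial_value_single)
  then show ?thesis using assms by (auto simp: fermat_cubic_threefold_def zero_locus_def)
qed

lemma line_through_eq: "line_through (proj_point p) (proj_point q) =
    {proj_point (\<lambda>n. s * p n + t * q n) | s t. s \<noteq> 0 \<or> t \<noteq> (0::'k)}"
proof (intro equalityI subsetI)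
  fix C assume "C \<in> line_through (proj_point p) (proj_point q)"
  then obtain c d s t where cd: "c \<noteq> 0" "d \<noteq> 0" "s \<noteq> 0 \<or> t \<noteq> 0"
    "C = proj_point (\<lambda>n. s * (c * p n) + t * (d * q n))"
    by (auto simp: line_through_def mem_proj_point)
  show "C \<in> {proj_point (\<lambda>n. s * p n + t * q n) | s t. s \<noteq> 0 \<or> t \<noteq> 0}"
    unfolding mem_Collect_eq
    by (intro exI[of _ "s * c"] exI[of _ "t * d"]) (use cd in \<open>simp add: mult.assoc\<close>)
next
  fix C assume "C \<in> {proj_point (\<lambda>n. s * p n + t * q n) | s t. s \<noteq> 0 \<or> t \<noteq> 0}"
  then show "C \<in> line_through (proj_point p) (proj_point q)"
    unfolding line_through_def mem_Collect_eq using self_in_proj_point by metis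
qed

text \<open>Representatives of a point differ by a scalar, which is absorbed into the first basis
  vector of the line; thus every representative is itself a vector of minors.\<close>

lemma fano_repr:
  assumes P: "P \<in> fano 4 (fermat_cubic_threefold :: (nat, 'k) ppoint set)" and \<pi>: "\<pi> \<in> P"
  shows "\<exists>a b. fermat_line a b \<and> \<pi> = minor a b \<and> P = proj_point \<pi>"
proof -
  obtain L where L: "L \<in> proj_lines {..4}" "L \<subseteq> fermat_cubic_threefold" "P = pluecker L"
    using P by (auto simp: fano_def)
  obtain A B where AB: "A \<in> proj_space {..4}" "B \<in> proj_space {..4}" "A \<noteq> B" "L = line_through A B"
    using L(1) by (auto simp: proj_lines_def)
  obtain p q where p: "p \<in> A" and q: "q \<in> B" using AB proj_space_nonempty by metis
  note p = p proj_spaceE[OF AB(1) p] and q = q proj_spaceE[OF AB(2) q]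
  have Lpq: "L = {proj_point (\<lambda>n. s * p n + t * q n) | s t. s \<noteq> 0 \<or> t \<noteq> 0}"
    unfolding AB(4) p(2) q(2) by (rule line_through_eq)
  have inL: "proj_point (\<lambda>n. s * p n + t * q n) \<in> L" if "s \<noteq> 0 \<or> t \<noteq> 0" for s t
    unfolding Lpq using that by blast
  have "A \<in> L" "B \<in> L" using inL[of 1 0] inL[of 0 1] p(2) q(2) by simp_all
  have ind: "\<exists>r s. p r * q s \<noteq> p s * q r"
  proof (rule ccontr)
    assume "\<not> ?thesis"
    then have "proj_point p = proj_point q" using p(3) q(3)
      by (intro parallel_imp_proj_point_eq) (auto simp: fun_eq_iff)
    then show False using AB(3) p(2) q(2) by simp
  qed
  have P_eq: "P = proj_point (minor p q)"
  proof (intro equalityI subsetI)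
    fix \<tau> assume "\<tau> \<in> P"
    then obtain v w C D where vw: "C \<in> L" "D \<in> L" "C \<noteq> D" "v \<in> C" "w \<in> D" "\<tau> = minor v w"
      unfolding L(3) pluecker_def minor_def by blast
    have comb: "\<exists>s t. v = (\<lambda>n. s * p n + t * q n)" if "C \<in> L" "v \<in> C" for v C
    proof -
      obtain s t c where "v = (\<lambda>n. c * (s * p n + t * q n))"
        using \<open>C \<in> L\<close> \<open>v \<in> C\<close> unfolding Lpq by (auto simp: mem_proj_point)
      then show ?thesis by (intro exI[of _ "c * s"] exI[of _ "c * t"]) (simp add: algebra_simps)
    qed
    obtain s t s' t' where v: "v = (\<lambda>n. s * p n + t * q n)" and w: "w = (\<lambda>n. s' * p n + t' * q n)"
      using comb vw by metis
    have "s * t' + s' * t \<noteq> 0"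
    proof
      assume det: "s * t' + s' * t = 0"
      have "v x * w y + v y * w x = (s * t' + s' * t) * (p x * q y + p y * q x)" for x y
        unfolding v w by (simp add: algebra_simps char2)
      then have "v x * w y = v y * w x" for x y using det by (simp add: char2)
      moreover have "C \<in> proj_space {..4}" "D \<in> proj_space {..4}"
        using vw(1,2) L(2) unfolding fermat_cubic_threefold_def zero_locus_def by auto
      then have "C = proj_point v" "D = proj_point w" "\<exists>n. v n \<noteq> 0" "\<exists>n. w n \<noteq> 0"
        using proj_spaceE(1,2) vw(4,5) by metis+
      moreover from this have "v \<noteq> (\<lambda>_. 0)" "w \<noteq> (\<lambda>_. 0)" by auto
      ultimately have "C = D" using parallel_imp_proj_point_eq[of v w] by simp
      then show False using vw(3) by simp
    qed
    then show "\<tau> \<in> proj_point (minor p q)" unfolding vw(6) v w minor_comb mem_proj_point by blast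
  next
    fix \<tau> assume "\<tau> \<in> proj_point (minor p q)"
    then obtain c where c: "c \<noteq> 0" "\<tau> = (\<lambda>x. c * minor p q x)" by (auto simp: mem_proj_point)
    have "\<tau> = minor (\<lambda>n. c * p n) q" unfolding c(2) by (auto simp: minor_def algebra_simps)
    moreover have "(\<lambda>n. c * p n) \<in> A" using c p(2) by (auto simp: mem_proj_point)
    ultimately show "\<tau> \<in> P" unfolding L(3) pluecker_def mem_Collect_eq
      using \<open>A \<in> L\<close> \<open>B \<in> L\<close> AB(3) q(1)
      by (intro exI[of _ "\<lambda>n. c * p n"] exI[of _ q] exI[of _ A] exI[of _ B] conjI)
        (simp_all add: minor_def)
  qed
  obtain c where c: "c \<noteq> 0" "\<pi> = (\<lambda>x. c * minor p q x)" using \<pi> unfolding P_eq by (auto simp: mem_proj_point)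
  define a where "a = (\<lambda>n. c * p n)"
  have \<pi>_eq: "\<pi> = minor a q" unfolding c(2) a_def by (auto simp: minor_def algebra_simps)
  have "(\<Sum>n\<le>4. (s * a n + t * q n) ^ 3) = 0" if "s \<noteq> 0 \<or> t \<noteq> 0" for s t
  proof -
    have "proj_point (\<lambda>n. s * c * p n + t * q n) \<in> L" using that c(1) by (intro inL) auto
    then have "proj_point (\<lambda>n. s * a n + t * q n) \<in> fermat_cubic_threefold"
      using L(2) by (auto simp: a_def mult.assoc)
    from fermat_cubic_threefold_cubes[OF this self_in_proj_point] show ?thesis .
  qed
  from fermat_line_pencil[OF this] have "fermat_line a q" unfolding fermat_line_def
    using ind c(1) p(4) q(4) by (auto simp: a_def)
  moreover have "P = proj_point \<pi>" unfolding P_eq c(2) using c(1) by simp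
  ultimately show ?thesis using \<pi>_eq by blast
qed

lemma fano_subset: "fano 4 (fermat_cubic_threefold :: (nat, 'k) ppoint set) \<subseteq> proj_space (pluecker_index 4)"
proof
  fix P assume P: "P \<in> fano 4 (fermat_cubic_threefold :: (nat, 'k) ppoint set)"
  have "\<exists>\<pi>. \<pi> \<in> P"
  proof -
    obtain A B where AB: "A \<in> proj_space {..4}" "B \<in> proj_space {..4}" "A \<noteq> B" "P = pluecker (line_through A B)"
      using P by (auto simp: fano_def proj_lines_def)
    obtain p q where "p \<in> A" "q \<in> B" using AB proj_space_nonempty by metis
    moreover from this have pq: "A = proj_point p" "B = proj_point q" using AB proj_spaceE(1) by metis+
    have "proj_point (\<lambda>n. s * p n + t * q n) \<in> line_through A B" if "s \<noteq> 0 \<or> t \<noteq> 0" for s t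
      unfolding pq line_through_eq using that by blast
    from this[of 1 0] this[of 0 1] have "A \<in> line_through A B" "B \<in> line_through A B"
      by (simp_all add: pq)
    ultimately show ?thesis using AB(3,4) unfolding pluecker_def by blast
  qed
  then obtain \<pi> where \<pi>: "\<pi> \<in> P" ..
  from fano_repr[OF P \<pi>] obtain a b where ab: "fermat_line a b" "\<pi> = minor a b" "P = proj_point \<pi>" by blast
  then obtain r s where rs: "a r * b s \<noteq> a s * b r" by (auto simp: fermat_line_def)
  have "minor a b (min r s, max r s) \<noteq> 0"
    using rs by (cases r s rule: linorder_cases) (auto simp: minor_def char2 add.commute)
  then show "P \<in> proj_space (pluecker_index 4)" unfolding ab(2,3)
  proof (rule proj_spaceI)
    fix x assume "x \<notin> pluecker_index 4"
    then show "minor a b x = 0" using ab(1)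
      by (cases x) (auto simp: minor_def pluecker_index_def fermat_line_def)
  qed
qed

text \<open>Let \<open>p\<close> be the cross product of \<open>a\<close> and \<open>b\<close>. The
  first two equations make the Frobenius twist of \<open>c\<close> proportional to \<open>p\<close>,
  the other two make \<open>c\<close> proportional to the twist of \<open>p\<close>. So the fourth
  powers of \<open>c\<close> are proportional to \<open>c\<close>: the point is rational over the
  field with 4 elements.\<close>

lemma flex:
  fixes a1 a2 a3 b1 b2 b3 c1 c2 c3 :: 'k
  assumes 1: "c1\<^sup>2 * a1 + c2\<^sup>2 * a2 + c3\<^sup>2 * a3 = 0" "c1\<^sup>2 * b1 + c2\<^sup>2 * b2 + c3\<^sup>2 * b3 = 0"
    and 2: "a1\<^sup>2 * c1 + a2\<^sup>2 * c2 + a3\<^sup>2 * c3 = 0" "b1\<^sup>2 * c1 + b2\<^sup>2 * c2 + b3\<^sup>2 * c3 = 0"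
    and ne: "a1 * b2 \<noteq> a2 * b1 \<or> a1 * b3 \<noteq> a3 * b1 \<or> a2 * b3 \<noteq> a3 * b2"
  shows "c1 ^ 4 * c2 = c2 ^ 4 * c1 \<and> c1 ^ 4 * c3 = c3 ^ 4 * c1 \<and> c2 ^ 4 * c3 = c3 ^ 4 * c2"
proof -
  define p1 p2 p3 where p: "p1 = a2 * b3 + a3 * b2" "p2 = a1 * b3 + a3 * b1" "p3 = a1 * b2 + a2 * b1"
  have "c1\<^sup>2 * p3 + c3\<^sup>2 * p1 = b2 * (c1\<^sup>2 * a1 + c2\<^sup>2 * a2 + c3\<^sup>2 * a3) + a2 * (c1\<^sup>2 * b1 + c2\<^sup>2 * b2 + c3\<^sup>2 * b3)"
    unfolding p by (simp add: algebra_simps char2)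
  then have e13: "c1\<^sup>2 * p3 = c3\<^sup>2 * p1" using 1 by (simp add: char2)
  have "c2\<^sup>2 * p3 + c3\<^sup>2 * p2 = b1 * (c1\<^sup>2 * a1 + c2\<^sup>2 * a2 + c3\<^sup>2 * a3) + a1 * (c1\<^sup>2 * b1 + c2\<^sup>2 * b2 + c3\<^sup>2 * b3)"
    unfolding p by (simp add: algebra_simps char2)
  then have e23: "c2\<^sup>2 * p3 = c3\<^sup>2 * p2" using 1 by (simp add: char2)
  have "c1\<^sup>2 * p2 + c2\<^sup>2 * p1 = b3 * (c1\<^sup>2 * a1 + c2\<^sup>2 * a2 + c3\<^sup>2 * a3) + a3 * (c1\<^sup>2 * b1 + c2\<^sup>2 * b2 + c3\<^sup>2 * b3)"
    unfolding p by (simp add: algebra_simps char2)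
  then have e12: "c1\<^sup>2 * p2 = c2\<^sup>2 * p1" using 1 by (simp add: char2)
  have "c1 * p3\<^sup>2 + c3 * p1\<^sup>2 = b2\<^sup>2 * (a1\<^sup>2 * c1 + a2\<^sup>2 * c2 + a3\<^sup>2 * c3) + a2\<^sup>2 * (b1\<^sup>2 * c1 + b2\<^sup>2 * c2 + b3\<^sup>2 * c3)"
    unfolding p powers by (simp add: algebra_simps char2)
  then have f13: "c1 * p3\<^sup>2 = c3 * p1\<^sup>2" using 2 by (simp add: char2)
  have "c2 * p3\<^sup>2 + c3 * p2\<^sup>2 = b1\<^sup>2 * (a1\<^sup>2 * c1 + a2\<^sup>2 * c2 + a3\<^sup>2 * c3) + a1\<^sup>2 * (b1\<^sup>2 * c1 + b2\<^sup>2 * c2 + b3\<^sup>2 * c3)"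
    unfolding p powers by (simp add: algebra_simps char2)
  then have f23: "c2 * p3\<^sup>2 = c3 * p2\<^sup>2" using 2 by (simp add: char2)
  have "c1 * p2\<^sup>2 + c2 * p1\<^sup>2 = b3\<^sup>2 * (a1\<^sup>2 * c1 + a2\<^sup>2 * c2 + a3\<^sup>2 * c3) + a3\<^sup>2 * (b1\<^sup>2 * c1 + b2\<^sup>2 * c2 + b3\<^sup>2 * c3)"
    unfolding p powers by (simp add: algebra_simps char2)
  then have f12: "c1 * p2\<^sup>2 = c2 * p1\<^sup>2" using 2 by (simp add: char2)
  have "\<exists>l t. (c1\<^sup>2 = l * p1 \<and> c2\<^sup>2 = l * p2 \<and> c3\<^sup>2 = l * p3) \<and>
    (c1 = t * p1\<^sup>2 \<and> c2 = t * p2\<^sup>2 \<and> c3 = t * p3\<^sup>2)"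
  proof -
    have "p1 \<noteq> 0 \<or> p2 \<noteq> 0 \<or> p3 \<noteq> 0" using ne by (auto simp: p char2)
    then show ?thesis
    proof (elim disjE)
      assume "p1 \<noteq> 0"
      then show ?thesis using e12 e13 f12 f13
        by (intro exI[of _ "c1\<^sup>2 / p1"] exI[of _ "c1 / p1\<^sup>2"]) (simp add: field_simps)
    next
      assume "p2 \<noteq> 0"
      then show ?thesis using e12 e23 f12 f23
        by (intro exI[of _ "c2\<^sup>2 / p2"] exI[of _ "c2 / p2\<^sup>2"]) (simp add: field_simps)
    next
      assume "p3 \<noteq> 0"
      then show ?thesis using e13 e23 f13 f23
        by (intro exI[of _ "c3\<^sup>2 / p3"] exI[of _ "c3 / p3\<^sup>2"]) (simp add: field_simps)
    qed
  qed
  then obtain l t where l: "c1\<^sup>2 = l * p1" "c2\<^sup>2 = l * p2" "c3\<^sup>2 = l * p3"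
    and t: "c1 = t * p1\<^sup>2" "c2 = t * p2\<^sup>2" "c3 = t * p3\<^sup>2" by blast
  have "c ^ 4 * d = l\<^sup>2 * t * (p\<^sup>2 * q\<^sup>2)" if "c\<^sup>2 = l * p" "d = t * q\<^sup>2" for c d p q
  proof -
    have "c ^ 4 = (c\<^sup>2)\<^sup>2" by (simp flip: power_mult)
    then show ?thesis using that by (simp add: power_mult_distrib)
  qed
  from this[OF l(1) t(2)] this[OF l(2) t(1)] this[OF l(1) t(3)] this[OF l(3) t(1)] this[OF l(2) t(3)] this[OF l(3) t(2)]
  show ?thesis by (simp add: mult.commute)
qed

end

text \<open>The Eckardt points in question have their nonzero coordinates at \<open>i\<close> and
  \<open>j\<close>. On the tangent hyperplane the cubes of these two coordinates cancel, which
  leaves a plane cubic in the coordinates \<open>k\<close>, \<open>l\<close>,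
  \<open>m\<close>.\<close>

locale eckardt = char_two +
  fixes i j k l m :: nat
  assumes indices: "distinct [i, j, k, l, m]" "{i, j, k, l, m} = {..4}"
begin

lemma herm_eq: "herm a b = (a i)\<^sup>2 * b i + (a j)\<^sup>2 * b j + (a k)\<^sup>2 * b k + (a l)\<^sup>2 * b l + (a m)\<^sup>2 * b (m :: nat)"
  unfolding herm_def indices(2)[symmetric] using indices(1) by (simp add: add_ac)

lemma index_cases: "n = i \<or> n = j \<or> n = k \<or> n = l \<or> n = m \<or> n > (4::nat)"
  using indices(2) by (metis atMost_iff empty_iff insert_iff not_le)

text \<open>The tangent hyperplane at the Eckardt point with coordinates \<open>(\<gamma>, 1)\<close> in positions \<open>i, j\<close>
  is \<open>h \<gamma> = 0\<close>; it meets the line through \<open>a\<close> and \<open>b\<close> in the point \<open>meet \<gamma> a b\<close>.\<close>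

definition h :: "'a \<Rightarrow> (nat \<Rightarrow> 'a) \<Rightarrow> 'a" where
  "h \<gamma> x = x i + \<gamma> * x j"

definition meet :: "'a \<Rightarrow> (nat \<Rightarrow> 'a) \<Rightarrow> (nat \<Rightarrow> 'a) \<Rightarrow> nat \<Rightarrow> 'a" where
  "meet \<gamma> a b = (\<lambda>n. h \<gamma> b * a n + h \<gamma> a * b n)"

definition ecoord :: "'a \<Rightarrow> (nat \<times> nat \<Rightarrow> 'a) \<Rightarrow> nat \<Rightarrow> 'a" where
  "ecoord \<gamma> \<pi> n = pl \<pi> i n + \<gamma> * pl \<pi> j n"

text \<open>The substitution \<open>y = x\<^sub>1 + x\<^sub>2\<close>, \<open>z = \<omega> x\<^sub>1 + \<omega>\<^sup>2 x\<^sub>2\<close> turns \<open>x\<^sub>1\<^sup>3 + x\<^sub>2\<^sup>3\<close> into \<open>y z (y + z)\<close>.\<close>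

definition emap :: "'a \<Rightarrow> (nat \<times> nat \<Rightarrow> 'a) \<Rightarrow> nat \<Rightarrow> 'a" where
  "emap \<gamma> \<pi> = vec3 (ecoord \<gamma> \<pi> m) (ecoord \<gamma> \<pi> k + ecoord \<gamma> \<pi> l)
     (\<omega> * ecoord \<gamma> \<pi> k + (\<omega> + 1) * ecoord \<gamma> \<pi> l)"

lemma ecoord_minor: "ecoord \<gamma> (minor a b) n = meet \<gamma> a b n"
  unfolding ecoord_def pl_minor meet_def h_def by (simp add: algebra_simps char2)

lemma meet_ij: "\<gamma> ^ 3 = 1 \<Longrightarrow> meet \<gamma> a b i = \<gamma> * meet \<gamma> a b j"
  by (simp add: meet_def h_def algebra_simps char2)

lemma emap_eq_0_iff: "emap \<gamma> \<pi> = (\<lambda>_. 0) \<longleftrightarrow>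
    ecoord \<gamma> \<pi> k = 0 \<and> ecoord \<gamma> \<pi> l = 0 \<and> ecoord \<gamma> \<pi> m = 0"
proof
  assume "emap \<gamma> \<pi> = (\<lambda>_. 0)"
  then have *: "emap \<gamma> \<pi> 0 = 0" "emap \<gamma> \<pi> 1 = 0" "emap \<gamma> \<pi> 2 = 0" by simp_all
  then have "ecoord \<gamma> \<pi> k = ecoord \<gamma> \<pi> l" by (simp add: emap_def char2)
  with * show "ecoord \<gamma> \<pi> k = 0 \<and> ecoord \<gamma> \<pi> l = 0 \<and> ecoord \<gamma> \<pi> m = 0"
    by (simp add: emap_def algebra_simps char2)
next
  assume "ecoord \<gamma> \<pi> k = 0 \<and> ecoord \<gamma> \<pi> l = 0 \<and> ecoord \<gamma> \<pi> m = 0"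
  then show "emap \<gamma> \<pi> = (\<lambda>_. 0)" by (auto simp: emap_def vec3_def)
qed

lemma fermat_lineD:
  assumes "fermat_line a b"
  shows "herm a a = 0" "herm a b = 0" "herm b a = 0" "herm b (b :: nat \<Rightarrow> 'a) = 0"
  using assms by (auto simp: fermat_line_def)

lemma emap_in_curve_vecs:
  assumes "fermat_line a b" "\<gamma> ^ 3 = 1" "emap \<gamma> (minor a b) \<noteq> (\<lambda>_. 0)"
  shows "emap \<gamma> (minor a b) \<in> curve_vecs"
proof -
  let ?x = "meet \<gamma> a b"
  have "herm ?x ?x = 0"
    unfolding meet_def by (simp add: herm_add fermat_lineD[OF assms(1)])
  then have "?x i ^ 3 + ?x j ^ 3 + ?x k ^ 3 + ?x l ^ 3 + ?x m ^ 3 = 0"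
    by (simp add: herm_eq power3_eq_cube power2_eq_square)
  moreover have "?x i ^ 3 = ?x j ^ 3" using assms(2) by (simp add: meet_ij power_mult_distrib)
  ultimately have *: "?x m ^ 3 = ?x k ^ 3 + ?x l ^ 3"
    by (simp add: char2)
  have "y ^ 3 + z ^ 3 = (y + z) * (\<omega> * y + (\<omega> + 1) * z) * (y + z + (\<omega> * y + (\<omega> + 1) * z))" for y z
    unfolding powers by (simp add: algebra_simps char2 omega_mult)
  then have "emap \<gamma> (minor a b) 0 ^ 3 =
      emap \<gamma> (minor a b) 1 * emap \<gamma> (minor a b) 2 * (emap \<gamma> (minor a b) 1 + emap \<gamma> (minor a b) 2)"
    by (simp add: emap_def ecoord_minor *)
  moreover have "\<forall>i>2. emap \<gamma> (minor a b) i = 0" by (simp add: emap_def)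
  ultimately show ?thesis using assms(3) unfolding curve_vecs_def by simp
qed

text \<open>Vanishing of \<open>emap\<close> means that the line passes through the corresponding
  Eckardt point. A line through two of these points would be \<open>x_k = x_l = x_m = 0\<close>,
  which does not lie on X.\<close>

lemma emap_zero_unique:
  assumes L: "fermat_line a b" and ne: "\<gamma> \<noteq> \<gamma>'"
    and 0: "emap \<gamma> (minor a b) = (\<lambda>_. 0)" "emap \<gamma>' (minor a b) = (\<lambda>_. 0)"
  shows False
proof -
  have "a i * b n = a n * b i \<and> a j * b n = a n * b j" if "n \<in> {k, l, m}" for n
  proof -
    have e: "ecoord \<gamma> (minor a b) n = 0" "ecoord \<gamma>' (minor a b) n = 0"
      using 0 that by (auto simp: emap_eq_0_iff)
    have "(\<gamma> + \<gamma>') * pl (minor a b) j n = ecoord \<gamma> (minor a b) n + ecoord \<gamma>' (minor a b) n"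
      by (simp add: ecoord_def algebra_simps char2)
    then have "pl (minor a b) j n = 0" using e ne by (simp add: char2)
    moreover from this have "pl (minor a b) i n = 0" using e by (simp add: ecoord_def)
    ultimately show ?thesis by (simp add: pl_minor char2)
  qed
  then have par: "a r * b n = a n * b r" if "r \<in> {i, j}" "n \<in> {k, l, m}" for r n using that by auto
  have zero: "a r = 0 \<and> b r = 0" if r: "{r, r'} = {i, j}" for r r'
  proof (rule ccontr)
    assume nz: "\<not> ?thesis"
    \<comment> \<open>The combination with vanishing coordinate \<open>r\<close>. By
      \<open>par\<close> its coordinates \<open>k\<close>, \<open>l\<close>, \<open>m\<close> vanish
      too, so isotropy leaves only the cube of coordinate \<open>r'\<close>.\<close>
    define c where "c = (\<lambda>n. b r * a n + a r * b n)"
    have "herm c c = 0" unfolding c_def by (simp add: herm_add fermat_lineD[OF L])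
    have ri: "r \<in> {i, j}" using r by auto
    have "c k = 0" "c l = 0" "c m = 0"
      using par[OF ri, of k] par[OF ri, of l] par[OF ri, of m] by (simp_all add: c_def char2 mult.commute)
    moreover have "c r = 0" by (simp add: c_def char2 mult.commute)
    ultimately have "c r' ^ 3 = 0" using \<open>herm c c = 0\<close> r
      by (auto simp: herm_eq doubleton_eq_iff power3_eq_cube power2_eq_square)
    then have "c r' = 0" by simp
    then have c: "c n = 0" for n
      using index_cases[of n] r \<open>c k = 0\<close> \<open>c l = 0\<close> \<open>c m = 0\<close> \<open>c r = 0\<close> L
      by (elim disjE) (auto simp: doubleton_eq_iff c_def fermat_line_def)
    have e: "b r * a n = a r * b n" for n using c[of n] by (simp add: c_def char2)
    have "a p * b q = a q * b p" for p q
    proof (cases "a r = 0")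
      case True
      then have "b r \<noteq> 0" using nz by simp
      then show ?thesis using e[of p] e[of q] True by simp
    next
      case False
      have "a r * (a p * b q) = a p * (b r * a q)" unfolding e by (simp add: mult_ac)
      also have "\<dots> = (b r * a p) * a q" by (simp add: mult_ac)
      also have "\<dots> = a r * (a q * b p)" unfolding e by (simp add: mult_ac)
      finally show ?thesis using False by simp
    qed
    then show False using L by (auto simp: fermat_line_def)
  qed
  have z: "a i = 0" "b i = 0" "a j = 0" "b j = 0" using zero[of i j] zero[of j i] by auto
  \<comment> \<open>The line lies in the plane \<open>x_i = x_j = 0\<close>, where
    \<open>herm\<close> is the standard form in three variables and has no isotropic plane.\<close>
  have H: "(a k)\<^sup>2 * a k + (a l)\<^sup>2 * a l + (a m)\<^sup>2 * a m = 0" "(a k)\<^sup>2 * b k + (a l)\<^sup>2 * b l + (a m)\<^sup>2 * b m = 0"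
    "(b k)\<^sup>2 * a k + (b l)\<^sup>2 * a l + (b m)\<^sup>2 * a m = 0" "(b k)\<^sup>2 * b k + (b l)\<^sup>2 * b l + (b m)\<^sup>2 * b m = 0"
    using fermat_lineD[OF L] z by (simp_all add: herm_eq)
  have "a k * b l = a l * b k" by (rule isotropic_parallel[OF H])
  moreover have "a k * b m = a m * b k"
    by (rule isotropic_parallel[of _ _ "a l" _ _ "b l"]) (use H in \<open>simp_all add: add_ac\<close>)
  moreover have "a l * b m = a m * b l"
    by (rule isotropic_parallel[of _ _ "a k" _ _ "b k"]) (use H in \<open>simp_all add: add_ac\<close>)
  moreover have "a n = 0 \<and> b n = 0" if "n > 4" for n using L that by (auto simp: fermat_line_def)
  ultimately have "a r * b s = a s * b r" for r s
    using index_cases[of r] index_cases[of s] z by (elim disjE) (simp_all add: mult.commute)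
  then show False using L by (auto simp: fermat_line_def)
qed

end

section \<open>Maps from the Fano surface to the curve\<close>

context char_two
begin

text \<open>The cubic form at \<open>u + w\<close> is \<open>hform u w + hform w u\<close>. As it
  vanishes there, the two coefficients of \<open>chord\<close> agree.\<close>

lemma star_sum:
  fixes u w :: "nat \<Rightarrow> 'k"
  assumes u: "u \<in> curve_vecs" and w: "w \<in> curve_vecs" and s: "(\<lambda>n. u n + w n) \<in> curve_vecs"
    and ne: "chord u w \<noteq> (\<lambda>_. 0)"
  shows "star (proj_point u) (proj_point w) = proj_point (\<lambda>n. u n + w n)"
proof -
  have "(u 0 + w 0) ^ 3 + (u 1 + w 1) * (u 2 + w 2) * ((u 1 + w 1) + (u 2 + w 2)) = hform u w + hform w u"
    unfolding hform_def powers
    by (simp add: algebra_simps char2 cubic_rewrite[OF curve_vecs_cubic[OF u]]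
        cubic_rewrite[OF curve_vecs_cubic[OF w]])
  moreover have "(u 0 + w 0) ^ 3 + (u 1 + w 1) * (u 2 + w 2) * ((u 1 + w 1) + (u 2 + w 2)) = 0"
    using curve_vecs_cubic[OF s] by (simp add: char2)
  ultimately have h: "hform u w = hform w u" by (simp add: char2)
  have c: "chord u w = (\<lambda>n. hform u w * (u n + w n))"
    unfolding chord_def h by (simp add: algebra_simps)
  then have "hform u w \<noteq> 0" using ne by auto
  then show ?thesis unfolding star_chord[OF u w ne] unfolding c by simp
qed

text \<open>By \<open>chord'_self\<close> the tangent meets the curve again in the Frobenius image,
  which is the point itself by \<open>f\<close>.\<close>

lemma star_flex:
  fixes u :: "nat \<Rightarrow> 'k"
  assumes u: "u \<in> curve_vecs" and f: "\<And>r s. u r ^ 4 * u s = u s ^ 4 * u r"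
  shows "star (proj_point u) (proj_point u) = proj_point u"
proof -
  have nz: "u \<noteq> (\<lambda>_. 0)" using u by (auto simp: curve_vecs_def)
  have nz4: "(\<lambda>n. u n ^ 4) \<noteq> (\<lambda>_. 0)"
  proof
    assume "(\<lambda>n. u n ^ 4) = (\<lambda>_. 0)"
    then have "u n ^ 4 = 0" for n by metis
    then show False using nz by auto
  qed
  have "chord' u u \<noteq> (\<lambda>_. 0)" using nz4 by (simp add: chord'_self[OF u])
  from star_chord'[OF u u this] show ?thesis
    unfolding chord'_self[OF u] using parallel_imp_proj_point_eq[OF nz4 nz f] by simp
qed

lemma power4_add: "(x + y) ^ 4 = x ^ 4 + (y ^ 4 :: 'k)"
  unfolding powers by (simp add: algebra_simps char2)

lemma omega_power4: "\<omega> ^ 4 = \<omega>"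
  unfolding powers by (simp add: algebra_simps char2 omega_mult)

text \<open>The coordinate change of \<open>emap\<close> has its coefficients in the field with 4
  elements and so commutes with taking fourth powers.\<close>

lemma vec3_flex:
  fixes c1 c2 c3 :: 'k
  assumes c: "c1 ^ 4 * c2 = c2 ^ 4 * c1" "c1 ^ 4 * c3 = c3 ^ 4 * c1" "c2 ^ 4 * c3 = c3 ^ 4 * c2"
    and u: "u = vec3 c3 (c1 + c2) (\<omega> * c1 + (\<omega> + 1) * c2)"
  shows "u r ^ 4 * u s = u s ^ 4 * u r"
proof -
  have z: "c1 ^ 4 * c2 + c2 ^ 4 * c1 = 0" "c1 ^ 4 * c3 + c3 ^ 4 * c1 = 0" "c2 ^ 4 * c3 + c3 ^ 4 * c2 = 0"
    using c by (simp_all add: char2)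
  have u4: "(\<omega> * c1 + (\<omega> + 1) * c2) ^ 4 = \<omega> * c1 ^ 4 + (\<omega> + 1) * c2 ^ 4"
    by (simp add: power4_add power_mult_distrib omega_power4)
  have "u 0 ^ 4 * u 1 + u 1 ^ 4 * u 0 = (c1 ^ 4 * c3 + c3 ^ 4 * c1) + (c2 ^ 4 * c3 + c3 ^ 4 * c2)"
    unfolding u by (simp add: power4_add algebra_simps)
  then have 1: "u 0 ^ 4 * u 1 = u 1 ^ 4 * u 0" unfolding z by (simp add: char2)
  have "u 0 ^ 4 * u 2 + u 2 ^ 4 * u 0 = \<omega> * (c1 ^ 4 * c3 + c3 ^ 4 * c1) + (\<omega> + 1) * (c2 ^ 4 * c3 + c3 ^ 4 * c2)"
    unfolding u vec3_simps u4 by (simp add: algebra_simps)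
  then have 2: "u 0 ^ 4 * u 2 = u 2 ^ 4 * u 0" unfolding z by (simp add: char2)
  have "u 1 ^ 4 * u 2 + u 2 ^ 4 * u 1 = c1 ^ 4 * c2 + c2 ^ 4 * c1"
    unfolding u vec3_simps u4 power4_add[of c1 c2] by (simp add: algebra_simps char2 omega_mult)
  then have 3: "u 1 ^ 4 * u 2 = u 2 ^ 4 * u 1" unfolding z by (simp add: char2)
  have 4: "u n = 0" if "n > 2" for n using that by (simp add: u)
  show ?thesis using nat_cases3[of r] nat_cases3[of s] 1 2 3 4
    by (elim disjE) (simp_all add: 4)
qed

end

context eckardt
begin

text \<open>\<open>ecoord\<close> is affine linear in \<open>\<gamma>\<close>, and
  \<open>\<gamma>\<close> is the affine combination of \<open>\<gamma> * \<omega>\<close> and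
  \<open>\<gamma> * (\<omega> + 1)\<close> with coefficients \<open>\<omega>\<close> and
  \<open>\<omega> + 1\<close>, whose sum is 1.\<close>

lemma emap_relation: "emap \<gamma> \<pi> n = \<omega> * emap (\<gamma> * \<omega>) \<pi> n + (\<omega> + 1) * emap (\<gamma> * (\<omega> + 1)) \<pi> n"
proof -
  have e: "ecoord \<gamma> \<pi> r = \<omega> * ecoord (\<gamma> * \<omega>) \<pi> r + (\<omega> + 1) * ecoord (\<gamma> * (\<omega> + 1)) \<pi> r" for r
    by (simp add: ecoord_def algebra_simps char2 omega_mult)
  show ?thesis unfolding emap_def
    using nat_cases3[of n] by (elim disjE) (simp_all add: e algebra_simps char2)
qed

lemma ecoord_emap: "ecoord \<gamma> \<pi> m = emap \<gamma> \<pi> 0" "ecoord \<gamma> \<pi> l = \<omega> * emap \<gamma> \<pi> 1 + emap \<gamma> \<pi> 2"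
  "ecoord \<gamma> \<pi> k = (\<omega> + 1) * emap \<gamma> \<pi> 1 + emap \<gamma> \<pi> 2"
  by (simp_all add: emap_def algebra_simps char2)

lemma ecoord_scale:
  assumes "\<And>n. emap \<delta> \<tau> n = d * emap \<gamma> \<pi> n" "n \<in> {k, l, m}"
  shows "ecoord \<delta> \<tau> n = d * ecoord \<gamma> \<pi> n"
  using assms(2) by (auto simp: ecoord_emap assms(1) algebra_simps)

lemma cube_root_cases:
  assumes "\<gamma> ^ 3 = 1" "\<delta> ^ 3 = (1 :: 'a)"
  shows "\<delta> = \<gamma> \<or> \<delta> = \<gamma> * \<omega> \<or> \<delta> = \<gamma> * (\<omega> + 1)"
proof -
  have "(\<delta> + \<gamma>) * (\<delta> + \<gamma> * \<omega>) * (\<delta> + \<gamma> * (\<omega> + 1)) = \<delta> ^ 3 + \<gamma> ^ 3"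
    unfolding powers by (simp add: algebra_simps char2 omega_mult)
  also have "\<dots> = 0" using assms by (simp add: char2)
  finally show ?thesis by (simp add: char2)
qed

lemma cube_roots:
  assumes "\<gamma> ^ 3 = (1 :: 'a)"
  shows "(\<gamma> * \<omega>) ^ 3 = 1" "(\<gamma> * (\<omega> + 1)) ^ 3 = 1" "\<gamma> \<noteq> 0"
  using assms omega_mult(5) by (auto simp: power_mult_distrib) (simp add: powers algebra_simps char2 omega_mult)

lemma fermat_line_independent:
  assumes L: "fermat_line a b" and c: "\<And>n. s * a n + t * b n = (0::'a)"
  shows "s = 0 \<and> t = 0"
proof (rule ccontr)
  assume st: "\<not> ?thesis"
  have e: "s * a n = t * b n" for n using c[of n] by (simp add: char2)
  have "a p * b q = a q * b p" for p q
  proof (cases "s = 0")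
    case False
    have "s * (a p * b q) = (s * a p) * b q" by (simp only: mult.assoc)
    also have "\<dots> = (t * b q) * b p" unfolding e by (simp only: mult_ac)
    also have "\<dots> = s * (a q * b p)" unfolding e[symmetric] by (simp only: mult.assoc)
    finally show ?thesis using False by simp
  next
    case True
    have "t * (a p * b q) = (t * b q) * a p" by (simp only: mult_ac)
    also have "\<dots> = (s * a p) * a q" unfolding e[symmetric] by (simp only: mult_ac)
    also have "\<dots> = t * (a q * b p)" unfolding e by (simp only: mult_ac)
    finally show ?thesis using True st by simp
  qed
  then show False using L by (auto simp: fermat_line_def)
qed

lemma projected_parallel_imp_relation:
  assumes par: "a k * b l = a l * b k" "a k * b m = a m * b k" "a l * b m = a m * (b l :: 'a)"
  shows "\<exists>s t. (s \<noteq> 0 \<or> t \<noteq> 0) \<and> (\<forall>n\<in>{k, l, m}. s * a n + t * b n = 0)"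
proof (cases "\<forall>n\<in>{k, l, m}. a n = 0 \<and> b n = 0")
  case True
  then show ?thesis by (intro exI[of _ 1] exI[of _ 0]) simp
next
  case False
  then obtain r where "r \<in> {k, l, m}" "b r \<noteq> 0 \<or> a r \<noteq> 0" by blast
  then show ?thesis using par
    by (intro exI[of _ "b r"] exI[of _ "a r"]) (auto simp: char2 mult.commute)
qed

text \<open>A dependence between the projections yields a point of the line with vanishing
  coordinates \<open>k\<close>, \<open>l\<close>, \<open>m\<close>. Lying on X, it is an Eckardt
  point, and \<open>\<delta>\<close> is the ratio of its remaining coordinates.\<close>

lemma projected_parallel_imp_emap_zero:
  assumes L: "fermat_line a b"
    and par: "a k * b l = a l * b k" "a k * b m = a m * b k" "a l * b m = a m * b l"
  shows "\<exists>\<delta>. \<delta> ^ 3 = 1 \<and> emap \<delta> (minor a b) = (\<lambda>_. 0)"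
proof -
  from projected_parallel_imp_relation[OF par] obtain s t
    where st: "s \<noteq> 0 \<or> t \<noteq> 0" "\<And>n. n \<in> {k, l, m} \<Longrightarrow> s * a n + t * b n = 0" by blast
  define c where "c = (\<lambda>n. s * a n + t * b n)"
  have c0: "c k = 0" "c l = 0" "c m = 0" using st(2) by (simp_all add: c_def)
  have "herm c c = 0" unfolding c_def by (simp add: herm_add fermat_lineD[OF L])
  then have c3: "c i ^ 3 = c j ^ 3" using c0 by (simp add: herm_eq powers char2)
  have "c j \<noteq> 0"
  proof
    assume "c j = 0"
    then have "c i = 0" using c3 by simp
    then have c: "c n = 0" for n using index_cases[of n] c0 \<open>c j = 0\<close> L
      by (elim disjE) (auto simp: c_def fermat_line_def)
    then show False using fermat_line_independent[OF L, of s t] st(1) by (simp add: c_def)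
  qed
  define \<delta> where "\<delta> = c i / c j"
  have "\<delta> ^ 3 = 1" using c3 \<open>c j \<noteq> 0\<close> by (simp add: \<delta>_def power_divide)
  have hc: "s * h \<delta> a + t * h \<delta> b = 0"
  proof -
    have "s * h \<delta> a + t * h \<delta> b = c i + \<delta> * c j" by (simp add: h_def c_def algebra_simps)
    also have "\<dots> = 0" using \<open>c j \<noteq> 0\<close> by (simp add: \<delta>_def char2)
    finally show ?thesis .
  qed
  have "meet \<delta> a b n = 0" if n: "n \<in> {k, l, m}" for n
  proof -
    have "s * meet \<delta> a b n = h \<delta> b * (s * a n + t * b n) + b n * (s * h \<delta> a + t * h \<delta> b)"
      "t * meet \<delta> a b n = h \<delta> a * (s * a n + t * b n) + a n * (s * h \<delta> a + t * h \<delta> b)"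
      by (simp_all add: meet_def algebra_simps char2)
    then have "s * meet \<delta> a b n = 0" "t * meet \<delta> a b n = 0" using hc st(2)[OF n] by simp_all
    then show ?thesis using st(1) by auto
  qed
  then have "emap \<delta> (minor a b) = (\<lambda>_. 0)" by (simp add: emap_eq_0_iff ecoord_minor)
  then show ?thesis using \<open>\<delta> ^ 3 = 1\<close> by blast
qed

text \<open>The three values are collinear by \<open>emap_relation\<close>, and
  \<open>star_sum\<close> settles the case of distinct values. If they coincide, the three
  hyperplanes meet the line in one and the same point, whose coordinates \<open>i\<close> and
  \<open>j\<close> vanish, and its image is a flex by \<open>flex\<close>.\<close>

lemma star_emap:
  assumes L: "fermat_line a b" and \<gamma>: "\<gamma> ^ 3 = 1"
    and nz: "emap \<gamma> (minor a b) \<noteq> (\<lambda>_. 0)" "emap (\<gamma> * \<omega>) (minor a b) \<noteq> (\<lambda>_. 0)"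
      "emap (\<gamma> * (\<omega> + 1)) (minor a b) \<noteq> (\<lambda>_. 0)"
  shows "star (proj_point (emap (\<gamma> * \<omega>) (minor a b))) (proj_point (emap (\<gamma> * (\<omega> + 1)) (minor a b))) =
    proj_point (emap \<gamma> (minor a b))"
proof -
  let ?\<pi> = "minor a b"
  note cr = cube_roots[OF \<gamma>]
  have w1: "\<omega> + 1 \<noteq> 0" using omega_mult(4) by (simp add: char2)
  define u where "u = (\<lambda>n. \<omega> * emap (\<gamma> * \<omega>) ?\<pi> n)"
  define w where "w = (\<lambda>n. (\<omega> + 1) * emap (\<gamma> * (\<omega> + 1)) ?\<pi> n)"
  have u: "u \<in> curve_vecs" "proj_point u = proj_point (emap (\<gamma> * \<omega>) ?\<pi>)"
    unfolding u_def using omega_mult(3) curve_vecs_scale[OF emap_in_curve_vecs[OF L cr(1) nz(2)]] by auto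
  have w: "w \<in> curve_vecs" "proj_point w = proj_point (emap (\<gamma> * (\<omega> + 1)) ?\<pi>)"
    unfolding w_def using w1 curve_vecs_scale[OF emap_in_curve_vecs[OF L cr(2) nz(3)]] by auto
  have sum: "emap \<gamma> ?\<pi> = (\<lambda>n. u n + w n)" unfolding u_def w_def using emap_relation by blast
  have s: "(\<lambda>n. u n + w n) \<in> curve_vecs" using emap_in_curve_vecs[OF L \<gamma> nz(1)] sum by simp
  show ?thesis
  proof (cases "chord u w = (\<lambda>_. 0)")
    case False
    then show ?thesis using star_sum[OF u(1) w(1) s] u w sum by simp
  next
    case True
    have uw: "proj_point u = proj_point w" by (rule chord_eq_0_imp[OF u(1) w(1) True])
    then obtain c where c: "w = (\<lambda>n. c * u n)" by (auto simp: proj_point_eq_iff)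
    have "1 + c \<noteq> 0" using s c unfolding curve_vecs_def
      by (auto simp: distrib_right[symmetric] fun_eq_iff) (metis add_0 distrib_right mult_1 mult_zero_left)
    have "emap \<gamma> ?\<pi> = (\<lambda>n. (1 + c) * u n)" unfolding sum c by (simp add: algebra_simps)
    then have eu: "proj_point (emap \<gamma> ?\<pi>) = proj_point u" using \<open>1 + c \<noteq> 0\<close> by simp
    let ?e = "emap (\<gamma> * \<omega>) ?\<pi>" and ?e' = "emap (\<gamma> * (\<omega> + 1)) ?\<pi>"
    have "proj_point ?e = proj_point ?e'" using uw u w by simp
    then obtain d where d: "?e' = (\<lambda>n. d * ?e n)" by (auto simp: proj_point_eq_iff)
    then have d: "?e' n = d * ?e n" for n by metis
    let ?x = "meet (\<gamma> * \<omega>) a b" and ?y = "meet (\<gamma> * (\<omega> + 1)) a b"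
    have xy: "?y n = d * ?x n" if "n \<in> {k, l, m}" for n
      unfolding ecoord_minor[symmetric] by (rule ecoord_scale[OF d that])
    have np: "a k * b l \<noteq> a l * b k \<or> a k * b m \<noteq> a m * b k \<or> a l * b m \<noteq> a m * b l"
    proof (rule ccontr)
      assume "\<not> ?thesis"
      then obtain \<delta> where "\<delta> ^ 3 = 1" "emap \<delta> ?\<pi> = (\<lambda>_. 0)"
        using projected_parallel_imp_emap_zero[OF L] by blast
      then show False using cube_root_cases[OF \<gamma>] nz by blast
    qed
    have pij: "a i * b j + a j * b i = 0"
    proof -
      \<comment> \<open>Up to the factor \<open>\<gamma> * (a i * b j + a j * b i)\<close>, the
        determinant of the change of basis, the minors of the two intersection points are those of
        the line. The left-hand side vanishes by \<open>xy\<close>, but by \<open>np\<close> not all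
        minors of the line on \<open>k\<close>, \<open>l\<close>, \<open>m\<close> do.\<close>
      have id: "?x p * ?y q + ?x q * ?y p = \<gamma> * ((a i * b j + a j * b i) * (a p * b q + a q * b p))" for p q
        by (simp add: meet_def h_def algebra_simps char2 omega_mult)
      have "(a i * b j + a j * b i) * (a p * b q + a q * b p) = 0" if "p \<in> {k, l, m}" "q \<in> {k, l, m}" for p q
      proof -
        have "?x p * ?y q + ?x q * ?y p = 0" unfolding xy[OF that(1)] xy[OF that(2)]
          by (simp add: char2 mult_ac)
        then show ?thesis unfolding id using cr(3) by simp
      qed
      from this[of k l] this[of k m] this[of l m] show ?thesis using np by (auto simp: char2)
    qed
    have x0: "?x i = 0" "?x j = 0"
    proof -
      have "?x i = \<gamma> * \<omega> * (a i * b j + a j * b i)" "?x j = a i * b j + a j * b i"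
        by (simp_all add: meet_def h_def algebra_simps char2)
      then show "?x i = 0" "?x j = 0" using pij by simp_all
    qed
    \<comment> \<open>The intersection point lies on an isotropic line. Its coordinates
      \<open>i\<close> and \<open>j\<close> vanish, so only the projections of \<open>a\<close> and
      \<open>b\<close> enter, as \<open>flex\<close> requires.\<close>
    have H: "herm ?x a = 0" "herm ?x b = 0" "herm a ?x = 0" "herm b ?x = 0"
      unfolding meet_def by (simp_all add: herm_add fermat_lineD[OF L])
    have "?x k ^ 4 * ?x l = ?x l ^ 4 * ?x k \<and> ?x k ^ 4 * ?x m = ?x m ^ 4 * ?x k \<and> ?x l ^ 4 * ?x m = ?x m ^ 4 * ?x l"
      by (rule flex[where ?a1.0 = "a k" and ?a2.0 = "a l" and ?a3.0 = "a m" and ?b1.0 = "b k" and ?b2.0 = "b l" and ?b3.0 = "b m"])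
        (use H x0 np in \<open>simp_all add: herm_eq\<close>)
    then have f: "?x k ^ 4 * ?x l = ?x l ^ 4 * ?x k" "?x k ^ 4 * ?x m = ?x m ^ 4 * ?x k"
      "?x l ^ 4 * ?x m = ?x m ^ 4 * ?x l" by blast+
    have "?e r ^ 4 * ?e s = ?e s ^ 4 * ?e r" for r s
      by (rule vec3_flex[OF f]) (simp only: emap_def ecoord_minor)
    from star_flex[OF emap_in_curve_vecs[OF L cr(1) nz(2)] this]
    show ?thesis using uw u w eu by simp
  qed
qed

text \<open>The second branch gives the value on lines through the Eckardt point;
  \<open>star_emap\<close> shows that it continues the first one.\<close>

definition fmap :: "'a \<Rightarrow> (nat \<times> nat, 'a) ppoint \<Rightarrow> (nat, 'a) ppoint" where
  "fmap \<gamma> P = (let \<pi> = SOME \<pi>. \<pi> \<in> P in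
     if emap \<gamma> \<pi> \<noteq> (\<lambda>_. 0) then proj_point (emap \<gamma> \<pi>)
     else star (proj_point (emap (\<gamma> * \<omega>) \<pi>)) (proj_point (emap (\<gamma> * (\<omega> + 1)) \<pi>)))"

lemma emap_scale: "emap \<gamma> (\<lambda>x. c * \<pi> x) = (\<lambda>n. c * emap \<gamma> \<pi> n)"
  unfolding emap_def vec3_scale by (simp add: ecoord_def pl_def algebra_simps)

lemma fmap_eq:
  assumes P: "P \<in> fano 4 (fermat_cubic_threefold :: (nat, 'a) ppoint set)" and \<pi>: "\<pi> \<in> P"
  shows "fmap \<gamma> P = (if emap \<gamma> \<pi> \<noteq> (\<lambda>_. 0) then proj_point (emap \<gamma> \<pi>)
     else star (proj_point (emap (\<gamma> * \<omega>) \<pi>)) (proj_point (emap (\<gamma> * (\<omega> + 1)) \<pi>)))"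
proof -
  define \<tau> where "\<tau> = (SOME \<pi>. \<pi> \<in> P)"
  have "\<tau> \<in> P" unfolding \<tau>_def by (rule someI[of "\<lambda>\<pi>. \<pi> \<in> P", OF \<pi>])
  then obtain c where c: "c \<noteq> 0" "\<tau> = (\<lambda>x. c * \<pi> x)"
    using proj_spaceE(1)[OF subsetD[OF fano_subset P] \<pi>] by (auto simp: mem_proj_point)
  have z: "(\<lambda>n. c * emap \<gamma> \<pi> n) = (\<lambda>_. 0) \<longleftrightarrow> emap \<gamma> \<pi> = (\<lambda>_. 0)"
    using c(1) by (simp add: fun_eq_iff)
  show ?thesis unfolding fmap_def Let_def \<tau>_def[symmetric] c(2) emap_scale z
    using c(1) by simp
qed

lemma fmap_eq_emap:
  assumes "P \<in> fano 4 (fermat_cubic_threefold :: (nat, 'a) ppoint set)" "\<pi> \<in> P" "emap \<gamma> \<pi> \<noteq> (\<lambda>_. 0)"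
  shows "fmap \<gamma> P = proj_point (emap \<gamma> \<pi>)"
  using fmap_eq[OF assms(1,2)] assms(3) by simp

lemma fmap_eq_star:
  assumes P: "P \<in> fano 4 (fermat_cubic_threefold :: (nat, 'a) ppoint set)" and \<pi>: "\<pi> \<in> P" and \<gamma>: "\<gamma> ^ 3 = 1"
    and nz: "emap (\<gamma> * \<omega>) \<pi> \<noteq> (\<lambda>_. 0)" "emap (\<gamma> * (\<omega> + 1)) \<pi> \<noteq> (\<lambda>_. 0)"
  shows "fmap \<gamma> P = star (proj_point (emap (\<gamma> * \<omega>) \<pi>)) (proj_point (emap (\<gamma> * (\<omega> + 1)) \<pi>))"
proof (cases "emap \<gamma> \<pi> = (\<lambda>_. 0)")
  case False
  from fano_repr[OF P \<pi>] obtain a b where "fermat_line a b" "\<pi> = minor a b" by blast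
  then show ?thesis using fmap_eq_emap[OF P \<pi> False] star_emap[of a b \<gamma>] \<gamma> nz False by simp
qed (simp add: fmap_eq[OF P \<pi>])

lemma form_emap: "form 1 (\<lambda>\<pi>. emap \<gamma> \<pi> n)"
  unfolding emap_def ecoord_def by (intro form_vec3 form_add form_cmult form_pl)

lemma chord_zero: "chord (\<lambda>_. 0) w = (\<lambda>_. 0)" "chord u (\<lambda>_. 0) = (\<lambda>_. 0)"
  "chord' (\<lambda>_. 0) w = (\<lambda>_. 0)" "chord' u (\<lambda>_. 0) = (\<lambda>_. 0 :: 'a)"
  by (auto simp: chord'_def chord_def hform_def rot_def rot'_def fun_eq_iff vec3_def)

text \<open>Around a line through the Eckardt point the chart is built from the other two maps,
  which are defined there by \<open>emap_zero_unique\<close>. The same formula is valid on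
  neighbouring lines by \<open>star_emap\<close>; wherever it is nonzero, \<open>chord_zero\<close>
  guarantees that both of its arguments are.\<close>

lemma fmap_morphism:
  assumes \<gamma>: "\<gamma> ^ 3 = 1"
  shows "variety_morphism (pluecker_index 4) (fano 4 (fermat_cubic_threefold :: (nat, 'a) ppoint set)) curve (fmap \<gamma>)"
proof (rule variety_morphismI[OF fano_subset])
  let ?F = "fano 4 (fermat_cubic_threefold :: (nat, 'a) ppoint set)"
  note cr = cube_roots[OF \<gamma>]
  have w1: "\<gamma> * \<omega> \<noteq> \<gamma>" "\<gamma> * (\<omega> + 1) \<noteq> \<gamma>" using cr(3) omega_mult(3,4) by simp_all
  have nz: "emap \<gamma> \<pi> \<noteq> (\<lambda>_. 0) \<or>
      emap (\<gamma> * \<omega>) \<pi> \<in> curve_vecs \<and> emap (\<gamma> * (\<omega> + 1)) \<pi> \<in> curve_vecs"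
    if "P \<in> ?F" "\<pi> \<in> P" for P \<pi>
  proof -
    from fano_repr[OF that] obtain a b where ab: "fermat_line a b" "\<pi> = minor a b" by blast
    show ?thesis unfolding ab(2)
      using emap_zero_unique[OF ab(1)] emap_in_curve_vecs[OF ab(1)] cr w1 by metis
  qed
  show "fmap \<gamma> ` ?F \<subseteq> curve"
  proof (rule image_subsetI)
    fix P assume P: "P \<in> ?F"
    then obtain \<pi> where \<pi>: "\<pi> \<in> P" using fano_subset proj_space_nonempty by blast
    from fano_repr[OF P \<pi>] obtain a b where ab: "fermat_line a b" "\<pi> = minor a b" by blast
    show "fmap \<gamma> P \<in> curve"
      using fmap_eq[OF P \<pi>] nz[OF P \<pi>] emap_in_curve_vecs[OF ab(1) \<gamma>] ab(2)
      by (auto simp: proj_point_in_curve intro!: star_in_curve)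
  qed
  fix P assume P: "P \<in> ?F"
  then obtain \<pi> where \<pi>: "\<pi> \<in> P" using fano_subset proj_space_nonempty by blast
  let ?u = "\<lambda>\<pi>. emap (\<gamma> * \<omega>) \<pi>" and ?w = "\<lambda>\<pi>. emap (\<gamma> * (\<omega> + 1)) \<pi>"
  have cv: "?u \<tau> \<in> curve_vecs \<and> ?w \<tau> \<in> curve_vecs \<and> fmap \<gamma> Q = star (proj_point (?u \<tau>)) (proj_point (?w \<tau>))"
    if Q: "Q \<in> ?F" "\<tau> \<in> Q" and "?u \<tau> \<noteq> (\<lambda>_. 0)" "?w \<tau> \<noteq> (\<lambda>_. 0)" for Q \<tau>
  proof -
    from fano_repr[OF Q] obtain a b where "fermat_line a b" "\<tau> = minor a b" by blast
    then show ?thesis using emap_in_curve_vecs[of a b] cr that fmap_eq_star[OF Q \<gamma>] by simp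
  qed
  show "\<exists>e s d G v. form e s \<and> (\<forall>j. form d (G j)) \<and> v \<in> P \<and> s v \<noteq> 0 \<and>
           (\<forall>Q\<in>?F. \<forall>v\<in>Q. s v \<noteq> 0 \<longrightarrow> fmap \<gamma> Q = proj_point (\<lambda>j. G j v))"
  proof (cases "emap \<gamma> \<pi> = (\<lambda>_. 0)")
    case False
    then obtain r where r: "emap \<gamma> \<pi> r \<noteq> 0" by auto
    show ?thesis
    proof (intro exI conjI allI ballI impI)
      show "form 1 (\<lambda>\<pi>. emap \<gamma> \<pi> r)" "form 1 (\<lambda>\<pi>. emap \<gamma> \<pi> j)" for j by (rule form_emap)+
      show "\<pi> \<in> P" "emap \<gamma> \<pi> r \<noteq> 0" by fact+
      fix Q \<tau> assume "Q \<in> ?F" "\<tau> \<in> Q" "emap \<gamma> \<tau> r \<noteq> 0"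
      moreover from this have "emap \<gamma> \<tau> \<noteq> (\<lambda>_. 0)" by auto
      ultimately show "fmap \<gamma> Q = proj_point (emap \<gamma> \<tau>)" by (intro fmap_eq_emap)
    qed
  next
    case True
    then have c: "?u \<pi> \<in> curve_vecs" "?w \<pi> \<in> curve_vecs" using nz[OF P \<pi>] by auto
    show ?thesis
    proof (cases "chord (?u \<pi>) (?w \<pi>) = (\<lambda>_. 0)")
      case False
      then obtain r where r: "chord (?u \<pi>) (?w \<pi>) r \<noteq> 0" by auto
      show ?thesis
      proof (intro exI conjI allI ballI impI)
        show "form (2 * 1 + 2 * 1) (\<lambda>\<pi>. chord (?u \<pi>) (?w \<pi>) r)"
          "form (2 * 1 + 2 * 1) (\<lambda>\<pi>. chord (?u \<pi>) (?w \<pi>) j)" for j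
          by (intro form_chord form_emap)+
        show "\<pi> \<in> P" "chord (?u \<pi>) (?w \<pi>) r \<noteq> 0" by fact+
        fix Q \<tau> assume Q: "Q \<in> ?F" "\<tau> \<in> Q" "chord (?u \<tau>) (?w \<tau>) r \<noteq> 0"
        then have ne: "chord (?u \<tau>) (?w \<tau>) \<noteq> (\<lambda>_. 0)" by auto
        then have "?u \<tau> \<noteq> (\<lambda>_. 0)" "?w \<tau> \<noteq> (\<lambda>_. 0)" using chord_zero by metis+
        from cv[OF Q(1,2) this] show "fmap \<gamma> Q = proj_point (chord (?u \<tau>) (?w \<tau>))"
          using star_chord ne by simp
      qed
    next
      case True
      then obtain r where r: "chord' (?u \<pi>) (?w \<pi>) r \<noteq> 0" using chord_or_chord'[OF c] by auto
      show ?thesis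
      proof (intro exI conjI allI ballI impI)
        show "form (2 * 1 + 2 * 1) (\<lambda>\<pi>. chord' (?u \<pi>) (?w \<pi>) r)"
          "form (2 * 1 + 2 * 1) (\<lambda>\<pi>. chord' (?u \<pi>) (?w \<pi>) j)" for j
          by (intro form_chord' form_emap)+
        show "\<pi> \<in> P" "chord' (?u \<pi>) (?w \<pi>) r \<noteq> 0" by fact+
        fix Q \<tau> assume Q: "Q \<in> ?F" "\<tau> \<in> Q" "chord' (?u \<tau>) (?w \<tau>) r \<noteq> 0"
        then have ne: "chord' (?u \<tau>) (?w \<tau>) \<noteq> (\<lambda>_. 0)" by auto
        then have "?u \<tau> \<noteq> (\<lambda>_. 0)" "?w \<tau> \<noteq> (\<lambda>_. 0)" using chord_zero by metis+
        from cv[OF Q(1,2) this] show "fmap \<gamma> Q = proj_point (chord' (?u \<tau>) (?w \<tau>))"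
          using star_chord' ne by simp
      qed
    qed
  qed
qed

end

section \<open>Separation of lines\<close>

text \<open>Gaussian elimination: the equation \<open>f\<close> is solved for the unknown of index
  \<open>r\<close>, and \<open>gs'\<close> consists of the other equations after this unknown has
  been eliminated.\<close>

lemma nontrivial_solution:
  fixes fs :: "('i \<Rightarrow> 'k::field) list"
  assumes "finite I" "length fs < card I"
  shows "\<exists>\<phi>. (\<exists>i\<in>I. \<phi> i \<noteq> 0) \<and> (\<forall>f\<in>set fs. (\<Sum>i\<in>I. \<phi> i * f i) = 0)"
  using assms
proof (induction "length fs" arbitrary: fs I)
  case 0
  then have "I \<noteq> {}" by auto
  then show ?case using 0 by (intro exI[of _ "\<lambda>_. 1"]) auto
next
  case (Suc n)
  then obtain f gs where fs: "fs = f # gs" "length gs = n" by (metis length_Suc_conv)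
  show ?case
  proof (cases "\<forall>i\<in>I. f i = 0")
    case True
    then show ?thesis using Suc.hyps(1)[of gs I] Suc.prems fs by auto
  next
    case False
    then obtain r where r: "r \<in> I" "f r \<noteq> 0" by blast
    define gs' where "gs' = map (\<lambda>g i. g i - g r / f r * f i) gs"
    have "length gs' < card (I - {r})" using Suc.prems fs r by (simp add: gs'_def)
    then obtain \<psi> where \<psi>: "\<exists>i\<in>I - {r}. \<psi> i \<noteq> 0" "\<forall>f\<in>set gs'. (\<Sum>i\<in>I - {r}. \<psi> i * f i) = 0"
      using Suc.hyps(1)[of gs' "I - {r}"] Suc.prems(1) fs(2) by (auto simp: gs'_def)
    define S where "S = (\<Sum>i\<in>I - {r}. \<psi> i * f i)"
    define \<phi> where "\<phi> = \<psi>(r := - S / f r)"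
    have sum: "(\<Sum>i\<in>I. \<phi> i * g i) = - S / f r * g r + (\<Sum>i\<in>I - {r}. \<psi> i * g i)" for g
      using Suc.prems(1) r(1) by (simp add: sum.remove[of I r] \<phi>_def)
    have "(\<Sum>i\<in>I. \<phi> i * g i) = 0" if "g \<in> set gs" for g
    proof -
      have "(\<Sum>i\<in>I - {r}. \<psi> i * (g i - g r / f r * f i)) = 0" using \<psi>(2) that by (auto simp: gs'_def)
      then have "(\<Sum>i\<in>I - {r}. \<psi> i * g i) = (\<Sum>i\<in>I - {r}. g r / f r * (\<psi> i * f i))"
        by (simp add: right_diff_distrib sum_subtractf mult_ac)
      also have "\<dots> = g r / f r * S" by (simp only: S_def sum_distrib_left)
      finally show ?thesis unfolding sum by simp
    qed
    moreover have "(\<Sum>i\<in>I. \<phi> i * f i) = 0" unfolding sum using r(2) by (simp add: S_def)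
    moreover have "\<exists>i\<in>I. \<phi> i \<noteq> 0" using \<psi>(1) by (auto simp: \<phi>_def)
    ultimately show ?thesis unfolding fs(1) by (intro exI[of _ \<phi>]) simp
  qed
qed

section \<open>Choice of the Eckardt point for two given lines\<close>

definition common_point :: "(nat \<Rightarrow> 'k::field) \<Rightarrow> (nat \<Rightarrow> 'k) \<Rightarrow> (nat \<Rightarrow> 'k) \<Rightarrow> (nat \<Rightarrow> 'k) \<Rightarrow> (nat \<Rightarrow> 'k) \<Rightarrow> bool" where
  "common_point a b c d q \<longleftrightarrow> (\<exists>n. q n \<noteq> 0) \<and> (\<exists>s t. q = (\<lambda>n. s * a n + t * b n)) \<and>
     (\<exists>s t. q = (\<lambda>n. s * c n + t * d n))"

abbreviation dot :: "(nat \<Rightarrow> 'k::field) \<Rightarrow> (nat \<Rightarrow> 'k) \<Rightarrow> 'k" where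
  "dot \<phi> x \<equiv> (\<Sum>n\<le>4. \<phi> n * x n)"

lemma dot_comb: "dot \<phi> (\<lambda>n. s * a n + t * b n) = s * dot \<phi> a + t * dot \<phi> b"
  by (simp add: distrib_left sum.distrib sum_distrib_left mult_ac)

context char_two
begin

text \<open>Two independent common vectors would span both lines, and both vectors of minors would
  be proportional to \<open>minor q q'\<close>.\<close>

lemma common_points_parallel:
  assumes q: "common_point a b c d q" and q': "common_point a b c d q'"
    and ne: "proj_point (minor a b) \<noteq> proj_point (minor c (d :: nat \<Rightarrow> 'k))"
  shows "q x * q' y = q y * q' x"
proof (rule ccontr)
  assume nz: "q x * q' y \<noteq> q y * q' x"
  obtain s t s' t' where q1: "q = (\<lambda>n. s * a n + t * b n)" and q2: "q = (\<lambda>n. s' * c n + t' * d n)"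
    using q unfolding common_point_def by blast
  obtain u v u' v' where q1': "q' = (\<lambda>n. u * a n + v * b n)" and q2': "q' = (\<lambda>n. u' * c n + v' * d n)"
    using q' unfolding common_point_def by blast
  have m1: "minor q q' = (\<lambda>x. (s * v + u * t) * minor a b x)" unfolding q1 q1' by (rule minor_comb)
  have m2: "minor q q' = (\<lambda>x. (s' * v' + u' * t') * minor c d x)" unfolding q2 q2' by (rule minor_comb)
  have "pl (minor q q') x y \<noteq> 0" using nz by (simp add: pl_minor char2)
  then obtain z where z: "minor q q' z \<noteq> 0" unfolding pl_def by blast
  have "s * v + u * t \<noteq> 0" using z m1 by auto
  moreover have "s' * v' + u' * t' \<noteq> 0" using z m2 by auto
  ultimately show False using ne m1 m2 proj_point_scale by metis
qed

text \<open>\<open>\<gamma> * \<phi> i + \<phi> j\<close> is the value of \<open>\<phi>\<close> at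
  the Eckardt point, so a functional that is zero on both lines certifies that this point lies
  outside their span.\<close>

lemma exists_separating_functional:
  assumes ab: "fermat_line a b" and cd: "fermat_line c d"
    and ne: "proj_point (minor a b) \<noteq> proj_point (minor c (d :: nat \<Rightarrow> 'k))"
  shows "\<exists>i j \<gamma> \<phi>. i \<le> 4 \<and> j \<le> 4 \<and> i \<noteq> j \<and> \<gamma> ^ 3 = 1 \<and>
    dot \<phi> a = 0 \<and> dot \<phi> b = 0 \<and> dot \<phi> c = 0 \<and> dot \<phi> d = 0 \<and> \<gamma> * \<phi> i + \<phi> j \<noteq> 0 \<and>
    (\<forall>q. common_point a b c d q \<longrightarrow> q i + \<gamma> * q j \<noteq> 0)"
proof (cases "\<exists>q. common_point a b c d q")
  case False
  have "\<exists>\<phi>. (\<exists>i\<in>{..4}. \<phi> i \<noteq> 0) \<and> (\<forall>f\<in>set [a, b, c, d]. dot \<phi> f = 0)"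
    by (rule nontrivial_solution) simp_all
  then obtain \<phi> i where \<phi>: "i \<le> 4" "\<phi> i \<noteq> 0" "dot \<phi> a = 0" "dot \<phi> b = 0" "dot \<phi> c = 0" "dot \<phi> d = 0" by auto
  \<comment> \<open>Any index other than \<open>i\<close> will do: as
    \<open>\<phi> i \<noteq> 0\<close>, the value at the Eckardt point vanishes for at most one
    \<open>\<gamma>\<close>, so 1 or \<open>\<omega>\<close> works.\<close>
  define j :: nat where "j = (if i = 0 then 1 else 0)"
  have "\<omega> * \<phi> i + \<phi> j \<noteq> 0 \<or> 1 * \<phi> i + \<phi> j \<noteq> 0"
    using \<phi>(2) omega_mult(4) by (auto simp: char2)
  then obtain \<gamma> where "\<gamma> ^ 3 = 1" "\<gamma> * \<phi> i + \<phi> j \<noteq> 0" using omega_mult(5) by (metis power_one)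
  then show ?thesis using \<phi> False
    by (intro exI[of _ i] exI[of _ j] exI[of _ \<gamma>] exI[of _ \<phi>]) (auto simp: j_def)
next
  case True
  then obtain q where q: "common_point a b c d q" by blast
  obtain s t s' t' where q1: "q = (\<lambda>n. s * a n + t * b n)" and q2: "q = (\<lambda>n. s' * c n + t' * d n)"
    using q unfolding common_point_def by blast
  obtain i where qi: "q i \<noteq> 0" using q unfolding common_point_def by blast
  have "q n = 0" if "n > 4" for n using ab that unfolding q1 by (auto simp: fermat_line_def)
  then have i: "i \<le> 4" using qi by (meson not_le)
  \<comment> \<open>The lines meet, so \<open>q\<close> and one further vector from each of them
    generate their span. This leaves room for a fourth equation, that \<open>\<phi>\<close> vanishes
    at the basis vector \<open>?e\<close> of index \<open>i\<close>. Then
    \<open>j \<noteq> i\<close>, the value of \<open>\<phi>\<close> at the Eckardt point is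
    \<open>\<phi> j\<close> for every \<open>\<gamma>\<close>, and \<open>\<gamma>\<close> remains
    free to keep \<open>q\<close> off the tangent hyperplane.\<close>
  let ?b = "if s = 0 then a else b" and ?d = "if s' = 0 then c else d"
  let ?e = "\<lambda>n. if n = i then 1 else 0"
  have "\<exists>\<phi>. (\<exists>i\<in>{..4}. \<phi> i \<noteq> 0) \<and> (\<forall>f\<in>set [q, ?b, ?d, ?e]. dot \<phi> f = 0)"
    by (rule nontrivial_solution) simp_all
  then obtain \<phi> j where j: "j \<le> 4" "\<phi> j \<noteq> 0" and
    \<phi>: "dot \<phi> q = 0" "dot \<phi> ?b = 0" "dot \<phi> ?d = 0" "dot \<phi> ?e = 0" by auto
  have "dot \<phi> ?e = \<phi> i" using i by (simp add: if_distrib[of "(*) _"] sum.delta cong: if_cong)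
  then have \<phi>i: "\<phi> i = 0" using \<phi>(4) by simp
  have "dot \<phi> a = 0 \<and> dot \<phi> b = 0"
    using \<phi>(1,2) qi unfolding q1 dot_comb by (auto split: if_splits)
  moreover have "dot \<phi> c = 0 \<and> dot \<phi> d = 0"
    using \<phi>(1,3) qi unfolding q2 dot_comb by (auto split: if_splits)
  moreover have "q i + \<omega> * q j \<noteq> 0 \<or> q i + 1 * q j \<noteq> 0"
    using qi omega_mult(4) by (auto simp: char2)
  then obtain \<gamma> where \<gamma>: "\<gamma> ^ 3 = 1" "q i + \<gamma> * q j \<noteq> 0" using omega_mult(5) by (metis power_one)
  moreover have "q' i + \<gamma> * q' j \<noteq> 0" if q': "common_point a b c d q'" for q'
  proof -
    have par: "q i * q' n = q n * q' i" for n by (rule common_points_parallel[OF q q' ne])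
    have "q' i \<noteq> 0"
    proof
      assume "q' i = 0"
      then have "q' n = 0" for n using par[of n] qi by simp
      then show False using q' by (auto simp: common_point_def)
    qed
    moreover have "q i * (q' i + \<gamma> * q' j) = q' i * (q i + \<gamma> * q j)"
      using par[of j] by (simp add: algebra_simps)
    ultimately show ?thesis using \<gamma>(2) by (metis mult_eq_0_iff)
  qed
  ultimately show ?thesis using i j \<phi>i
    by (intro exI[of _ i] exI[of _ j] exI[of _ \<gamma>] exI[of _ \<phi>]) auto
qed

end

context eckardt
begin

lemma dot_eq: "dot \<phi> x = \<phi> i * x i + \<phi> j * x j + \<phi> k * x k + \<phi> l * x l + \<phi> m * x (m :: nat)"
  unfolding indices(2)[symmetric] using indices(1) by (simp add: add_ac)

text \<open>The conditions on coordinates make \<open>x\<close> a multiple of the Eckardt point,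
  where \<open>\<phi>\<close> does not vanish.\<close>

lemma functional_imp_zero:
  fixes x :: "nat \<Rightarrow> 'a"
  assumes "dot \<phi> x = 0" "\<gamma> * \<phi> i + \<phi> j \<noteq> 0" "x i = \<gamma> * x j" "x k = 0" "x l = 0" "x m = 0"
    and "\<And>n. n > 4 \<Longrightarrow> x n = 0"
  shows "x n = 0"
proof -
  have "dot \<phi> x = (\<gamma> * \<phi> i + \<phi> j) * x j" unfolding dot_eq using assms(3-6) by (simp add: algebra_simps)
  then have "x j = 0" using assms(1,2) by simp
  then show ?thesis using index_cases[of n] assms by (elim disjE) auto
qed

text \<open>The functional keeps the Eckardt point off the line. A line inside the tangent
  hyperplane, on which \<open>meet\<close> is identically zero, would pass through that vertex of
  the cone, because the base curve contains no line.\<close>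

lemma emap_nonzero:
  assumes L: "fermat_line a b" and \<gamma>: "\<gamma> ^ 3 = 1" and \<phi>: "dot \<phi> a = 0" "dot \<phi> b = 0" "\<gamma> * \<phi> i + \<phi> j \<noteq> 0"
  shows "emap \<gamma> (minor a b) \<noteq> (\<lambda>_. 0)"
proof
  assume "emap \<gamma> (minor a b) = (\<lambda>_. 0)"
  then have z: "meet \<gamma> a b k = 0" "meet \<gamma> a b l = 0" "meet \<gamma> a b m = 0"
    by (simp_all add: emap_eq_0_iff ecoord_minor)
  have "meet \<gamma> a b n = 0" for n
  proof (rule functional_imp_zero[OF _ \<phi>(3)])
    show "dot \<phi> (meet \<gamma> a b) = 0" unfolding meet_def dot_comb using \<phi> by simp
    show "meet \<gamma> a b n = 0" if "n > 4" for n using L that by (auto simp: meet_def fermat_line_def)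
  qed (use z meet_ij[OF \<gamma>] in auto)
  then have h0: "h \<gamma> a = 0" "h \<gamma> b = 0"
    using fermat_line_independent[OF L, of "h \<gamma> b" "h \<gamma> a"] by (simp_all add: meet_def)
  then have ij: "a i = \<gamma> * a j" "b i = \<gamma> * b j" by (simp_all add: h_def char2)
  have g: "(\<gamma> * x)\<^sup>2 * (\<gamma> * y) + x\<^sup>2 * y = 0" for x y
  proof -
    have "(\<gamma> * x)\<^sup>2 * (\<gamma> * y) = \<gamma> ^ 3 * (x\<^sup>2 * y)" by (simp add: powers mult_ac)
    then show ?thesis using \<gamma> by (simp add: char2)
  qed
  \<comment> \<open>On the tangent hyperplane the contributions of \<open>i\<close> and
    \<open>j\<close> to \<open>herm\<close> cancel, leaving an isotropic pair in three
    variables.\<close>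
  have H: "(a k)\<^sup>2 * a k + (a l)\<^sup>2 * a l + (a m)\<^sup>2 * a m = 0" "(a k)\<^sup>2 * b k + (a l)\<^sup>2 * b l + (a m)\<^sup>2 * b m = 0"
    "(b k)\<^sup>2 * a k + (b l)\<^sup>2 * a l + (b m)\<^sup>2 * a m = 0" "(b k)\<^sup>2 * b k + (b l)\<^sup>2 * b l + (b m)\<^sup>2 * b m = 0"
    using fermat_lineD[OF L] by (simp_all add: herm_eq ij g)
  have "a k * b l = a l * b k" by (rule isotropic_parallel[OF H])
  moreover have "a k * b m = a m * b k"
    by (rule isotropic_parallel[of _ _ "a l" _ _ "b l"]) (use H in \<open>simp_all add: add_ac\<close>)
  moreover have "a l * b m = a m * b l"
    by (rule isotropic_parallel[of _ _ "a k" _ _ "b k"]) (use H in \<open>simp_all add: add_ac\<close>)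
  ultimately obtain s t where st: "s \<noteq> 0 \<or> t \<noteq> 0" "\<And>n. n \<in> {k, l, m} \<Longrightarrow> s * a n + t * b n = 0"
    using projected_parallel_imp_relation by blast
  have "s * a n + t * b n = 0" for n
  proof (rule functional_imp_zero[of \<phi> "\<lambda>n. s * a n + t * b n", OF _ \<phi>(3)])
    show "dot \<phi> (\<lambda>n. s * a n + t * b n) = 0" unfolding dot_comb using \<phi> by simp
    show "s * a n + t * b n = 0" if "n > 4" for n using L that by (auto simp: fermat_line_def)
    show "s * a i + t * b i = \<gamma> * (s * a j + t * b j)" by (simp add: ij algebra_simps)
  qed (use st(2) in auto)
  then show False using fermat_line_independent[OF L, of s t] st(1) by blast
qed

text \<open>If the images agree, the points in which the lines meet the tangent hyperplane have
  proportional projections, so some combination of them is a multiple of the Eckardt point. It lies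
  in the span of both lines, where \<open>\<phi>\<close> vanishes, hence it is zero; the two points
  coincide, against \<open>common\<close>.\<close>

lemma fmap_separates:
  assumes P: "P \<in> fano 4 (fermat_cubic_threefold :: (nat, 'a) ppoint set)" "minor a b \<in> P" "fermat_line a b"
    and Q: "Q \<in> fano 4 (fermat_cubic_threefold :: (nat, 'a) ppoint set)" "minor c d \<in> Q" "fermat_line c d"
    and \<gamma>: "\<gamma> ^ 3 = 1"
    and \<phi>: "dot \<phi> a = 0" "dot \<phi> b = 0" "dot \<phi> c = 0" "dot \<phi> d = 0" "\<gamma> * \<phi> i + \<phi> j \<noteq> 0"
    and common: "\<And>q. common_point a b c d q \<Longrightarrow> q i + \<gamma> * q j \<noteq> 0"
  shows "fmap \<gamma> P \<noteq> fmap \<gamma> Q"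
proof
  assume eq: "fmap \<gamma> P = fmap \<gamma> Q"
  have nz: "emap \<gamma> (minor a b) \<noteq> (\<lambda>_. 0)" "emap \<gamma> (minor c d) \<noteq> (\<lambda>_. 0)"
    using emap_nonzero[OF P(3) \<gamma>] emap_nonzero[OF Q(3) \<gamma>] \<phi> by blast+
  then have "proj_point (emap \<gamma> (minor a b)) = proj_point (emap \<gamma> (minor c d))"
    using eq fmap_eq_emap P Q by simp
  then obtain e where e: "emap \<gamma> (minor c d) = (\<lambda>n. e * emap \<gamma> (minor a b) n)"
    by (auto simp: proj_point_eq_iff)
  then have e: "emap \<gamma> (minor c d) n = e * emap \<gamma> (minor a b) n" for n by metis
  let ?x = "meet \<gamma> a b" and ?y = "meet \<gamma> c d"
  have klm: "?y n = e * ?x n" if "n \<in> {k, l, m}" for n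
    unfolding ecoord_minor[symmetric] by (rule ecoord_scale[OF e that])
  have "1 * ?y n + e * ?x n = 0" for n
  proof (rule functional_imp_zero[of \<phi> "\<lambda>n. 1 * ?y n + e * ?x n", OF _ \<phi>(5)])
    show "dot \<phi> (\<lambda>n. 1 * ?y n + e * ?x n) = 0"
      unfolding dot_comb unfolding meet_def dot_comb using \<phi> by simp
    show "1 * ?y i + e * ?x i = \<gamma> * (1 * ?y j + e * ?x j)"
      by (simp add: meet_ij[OF \<gamma>] algebra_simps)
    show "1 * ?y n + e * ?x n = 0" if "n > 4" for n
      using P(3) Q(3) that by (auto simp: meet_def fermat_line_def)
  qed (use klm in \<open>auto simp: char2\<close>)
  then have xy: "?y n = e * ?x n" for n by (simp add: char2)
  have "common_point a b c d ?y"
    unfolding common_point_def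
  proof (intro conjI)
    show "\<exists>n. ?y n \<noteq> 0"
    proof (rule ccontr)
      assume "\<not> ?thesis"
      then have "emap \<gamma> (minor c d) = (\<lambda>_. 0)" by (simp add: emap_eq_0_iff ecoord_minor)
      then show False using nz by simp
    qed
    show "\<exists>s t. ?y = (\<lambda>n. s * c n + t * d n)" unfolding meet_def by blast
    have "?y = (\<lambda>n. (e * h \<gamma> b) * a n + (e * h \<gamma> a) * b n)"
    proof
      fix n show "?y n = (e * h \<gamma> b) * a n + (e * h \<gamma> a) * b n"
        unfolding xy by (simp add: meet_def algebra_simps)
    qed
    then show "\<exists>s t. ?y = (\<lambda>n. s * a n + t * b n)" by blast
  qed
  from common[OF this] show False using meet_ij[OF \<gamma>] by (simp add: char2)
qed

text \<open>The universal property concerns maps that send \<open>p\<close> to the neutral element.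
  So \<open>fmap \<gamma>\<close> is first translated by the inverse of its value at
  \<open>p\<close>, and the translation is cancelled in the end.\<close>

lemma albanese_determines_fmap:
  assumes alb: "albanese (pluecker_index 4) (fano 4 (fermat_cubic_threefold :: (nat, 'a) ppoint set)) p n A \<alpha>"
    and p: "p \<in> fano 4 fermat_cubic_threefold" and \<gamma>: "\<gamma> ^ 3 = 1"
    and P: "P \<in> fano 4 fermat_cubic_threefold" and Q: "Q \<in> fano 4 fermat_cubic_threefold" and eq: "\<alpha> P = \<alpha> Q"
  shows "fmap \<gamma> P = fmap \<gamma> Q"
proof -
  let ?F = "fano 4 (fermat_cubic_threefold :: (nat, 'a) ppoint set)"
  have mor: "variety_morphism (pluecker_index 4) ?F curve (fmap \<gamma>)" by (rule fmap_morphism[OF \<gamma>])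
  have cv: "fmap \<gamma> R \<in> curve" if "R \<in> ?F" for R using mor that unfolding variety_morphism_def by auto
  define N where "N = neg (fmap \<gamma> p)"
  have N: "N \<in> curve" unfolding N_def by (intro neg_in_curve cv p)
  define f where "f = (\<lambda>R. ell_add N (fmap \<gamma> R))"
  have "variety_morphism (pluecker_index 4) ?F (carrier ell_group) f"
    unfolding f_def using variety_morphism_compose[OF mor translation_morphism[OF N] fano_subset curve_subset]
    by simp
  moreover have "f p = \<one>\<^bsub>ell_group\<^esub>"
    unfolding f_def N_def using ell_add_neg[OF cv[OF p]] ell_add_commute[OF cv[OF p] neg_in_curve[OF cv[OF p]]]
    by simp
  ultimately have "\<exists>!\<phi>. \<phi> \<in> extensional (carrier A) \<and> \<phi> \<in> hom A ell_group \<and>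
      variety_morphism {..n} (carrier A) (carrier ell_group) \<phi> \<and> (\<forall>P\<in>?F. \<phi> (\<alpha> P) = f P)"
    using alb abelian_variety_ell_group unfolding albanese_def by blast
  then obtain \<phi> where "\<forall>P\<in>?F. \<phi> (\<alpha> P) = f P" by blast
  then have "f P = f Q" using P Q eq by metis
  then show ?thesis
    using inj_onD[OF group.inj_on_cmult[OF group_ell_group, of N], of "fmap \<gamma> P" "fmap \<gamma> Q"]
      cv[OF P] cv[OF Q] N
    by (simp add: f_def)
qed

end

lemma ex_eckardt_indices:
  assumes "i \<le> 4" "j \<le> 4" "i \<noteq> (j::nat)"
  shows "\<exists>k l m. distinct [i, j, k, l, m] \<and> {i, j, k, l, m} = {..4}"
proof -
  have "card ({..4} - {i, j}) = 3" using assms by (simp add: card_Diff_subset)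
  then obtain k l m where klm: "{..4} - {i, j} = {k, l, m}" "k \<noteq> l" "l \<noteq> m" "k \<noteq> m"
    unfolding card_3_iff by blast
  moreover have "{i, j, k, l, m} = {..4}" using klm(1) assms by auto
  moreover have "{k, l, m} \<inter> {i, j} = {}" unfolding klm(1)[symmetric] by auto
  then have "distinct [i, j, k, l, m]" using klm(2-4) assms(3) by simp
  ultimately show ?thesis by (intro exI[of _ k] exI[of _ l] exI[of _ m] conjI)
qed

theorem lemma5p53:
  fixes p :: "(nat \<times> nat, 'k::alg_closed_field) ppoint"
    and A :: "(nat, 'k) ppoint monoid"
    and \<alpha> :: "(nat \<times> nat, 'k) ppoint \<Rightarrow> (nat, 'k) ppoint"
  assumes "CHAR('k) = 2"
    and "p \<in> fano 4 fermat_cubic_threefold"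
    and "albanese (pluecker_index 4) (fano 4 fermat_cubic_threefold) p n A \<alpha>"
  shows "inj_on \<alpha> (fano 4 fermat_cubic_threefold)"
proof (rule inj_onI, rule ccontr)
  let ?F = "fano 4 (fermat_cubic_threefold :: (nat, 'k) ppoint set)"
  fix P Q assume P: "P \<in> ?F" and Q: "Q \<in> ?F" and eq: "\<alpha> P = \<alpha> Q" and ne: "P \<noteq> Q"
  \<comment> \<open>A root of \<open>x\<^sup>2 + x + 1\<close> supplies the primitive cube root of
    unity.\<close>
  have "degree [:1, 1, 1 :: 'k:] > 0" by simp
  then obtain \<omega> :: 'k where "poly [:1, 1, 1:] \<omega> = 0" using alg_closed_imp_poly_has_root by blast
  then have "\<omega>\<^sup>2 + (\<omega> + 1) = 0" by (simp add: algebra_simps power2_eq_square)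
  then have "\<omega>\<^sup>2 = \<omega> + 1" by (simp only: char_two_simps(5)[OF assms(1)])
  then interpret char_two \<omega> by unfold_locales (use assms(1) in auto)
  obtain \<pi> \<tau> where \<pi>: "\<pi> \<in> P" and \<tau>: "\<tau> \<in> Q" using P Q fano_subset proj_space_nonempty by blast
  from fano_repr[OF P \<pi>] obtain a b where ab: "fermat_line a b" "\<pi> = minor a b" "P = proj_point \<pi>" by blast
  from fano_repr[OF Q \<tau>] obtain c d where cd: "fermat_line c d" "\<tau> = minor c d" "Q = proj_point \<tau>" by blast
  from exists_separating_functional[OF ab(1) cd(1)] ne ab cd obtain i j \<gamma> \<phi> where
    ij: "i \<le> 4" "j \<le> 4" "i \<noteq> j" and \<gamma>: "\<gamma> ^ 3 = 1" and
    \<phi>: "dot \<phi> a = 0" "dot \<phi> b = 0" "dot \<phi> c = 0" "dot \<phi> d = 0" "\<gamma> * \<phi> i + \<phi> j \<noteq> 0" and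
    common: "\<forall>q. common_point a b c d q \<longrightarrow> q i + \<gamma> * q j \<noteq> 0" by auto
  from ex_eckardt_indices[OF ij] obtain k l m where
    "distinct [i, j, k, l, m]" "{i, j, k, l, m} = {..4}" by blast
  then interpret eckardt \<omega> i j k l m by unfold_locales
  have "fmap \<gamma> P \<noteq> fmap \<gamma> Q"
    by (rule fmap_separates[OF P _ ab(1) Q _ cd(1) \<gamma> \<phi>]) (use \<pi> \<tau> ab(2) cd(2) common in auto)
  moreover have "fmap \<gamma> P = fmap \<gamma> Q"
    by (rule albanese_determines_fmap[OF assms(3,2) \<gamma> P Q eq])
  ultimately show False by simp
qed

end
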